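(* Let $f(u,v)$ be an isothermic cylinder, with one generic family ($u$-curves) of closed planar curvature lines and one family ($v$-curves) of spherical curvature lines, from a fundamental piece of rhombic type, determined by parameters $\omega,\delta,s_1,s_2$. Let $\epsilon\in\mathbb{R}\setminus\{0\}$ and let $f^\pm$ be the Bonnet pair cylinders determined by $df^{\pm}=(\pm\epsilon-f)\,df^*\,(\pm\epsilon+f)$. Then $f^\pm$ are tori if and only if 1. (Rationality condition) the number $\theta$ given by $$\frac{\theta}{2}=\int_{s_1^-}^{s_1^+}\frac{Z_0}{\tilde Q_2(s)}\frac{Q_2(s)}{\sqrt{Q(s)}}\,ds$$ satisfies $k\theta\in2\pi\mathbb{Z}$ for some positive integer $k$; and 2. (Vanishing axial part) $$\int_{s_1^-}^{s_1^+}\frac{Q_2(s)}{\sqrt{Q(s)}}\,ds=0.$$ Here $s_1^-<s_1^+$ are the two real zeros of $Q$, and $$Q(s)=-(s-s_1)^2(s-s_2)^2+\delta^2Q_3(s),\qquad Q_3(s)=2U_1's^3-U_2s^2-2U's-U^2,$$ $$Q_2(s)=-(s-s_1)(s-s_2)+\delta^2U_1's,\qquad \tilde Q_2(s)=Z_0^2s^2-\big(1+sU^{-2}(U'+s_1s_2U_1')\big)^2,$$ where $Z_0>0$ and $$Z_0^2=U^{-2}\big(2(s_1+s_2)U_1'+\delta^2U_1'^2-U_2\big)+U^{-4}\big(U'+s_1s_2U_1'\big)^2 .$$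
   Context: Identify $\mathbb{R}^3$ with $\mathrm{Im}\,\mathbb{H}$ (units $\mathbf{i},\mathbf{j},\mathbf{k}$) and $\mathbb{C}$ with $\mathrm{span}\{1,\mathbf{i}\}$, the complex unit $i$ being $\mathbf{i}$. Jacobi theta functions $\vartheta_i(z|\tau)$ follow Whittaker–Watson (lattice $\pi,\pi\tau$, nome $e^{i\pi\tau}$). Let $\tau\in\frac12+i\mathbb{R}$ with $0<\mathrm{Im}\,\tau<\mathrm{Im}\,\tau_0\approx0.3547$, where $\tau_0\in\frac12+i\mathbb{R}$, $\vartheta_2''(0|\tau_0)=0$; let $\omega\in(0,\pi/4)$ be the unique number with $\vartheta_2'(\omega|\tau)=0$. The real constants (depending on $\tau$) are $$U=-\tfrac12\tfrac{\vartheta_1'(0)}{\vartheta_2(\omega)^2}\vartheta_1(2\omega),\quad U'=-\tfrac12\tfrac{\vartheta_1'(0)}{\vartheta_2(\omega)^2}\vartheta_1'(2\omega),\quad U_1'=\tfrac12\tfrac{\vartheta_1'(0)^2}{\vartheta_2(\omega)^2},\quad U_2=\tfrac{\vartheta_1'(0)^2}{\vartheta_2(\omega)^2}\Big(\tfrac{\vartheta_1(\omega)^2}{\vartheta_2(0)^2}+\tfrac{\vartheta_4(\omega)^2}{\vartheta_3(0)^2}+\tfrac{\vartheta_3(\omega)^2}{\vartheta_4(0)^2}\Big).$$ The cubic $Q_3$ has the single real zero $s_0=\vartheta_1(\omega)^2/\vartheta_2(0)^2$ and real oval $[s_0,\infty)$. An isothermic cylinder with one generic family ($u$-curves) of closed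 planar curvature lines is $$f(u,v)=\Phi(v)^{-1}\gamma(u,w(v))\,\mathbf{j}\,\Phi(v),\qquad \gamma(u,w)=-i\,\frac{2\vartheta_2(\omega)^2}{\vartheta_1'(0)\vartheta_1(2\omega)}\,\frac{\vartheta_1(\frac12(u+iw-3\omega))}{\vartheta_1(\frac12(u+iw+\omega))},$$ where $w:\mathbb{R}\to(0,2\pi\,\mathrm{Im}\,\tau)$ is real analytic with a real analytic (possibly sign-changing) root $\sqrt{1-w'^2}$, and $\Phi:\mathbb{R}\to\mathbb{H}_1$ (unit quaternions) solves $\Phi'\Phi^{-1}=\sqrt{1-w'(v)^2}\,W_1(w(v))\,\mathbf{k}$, $W_1(w)=i\frac{\vartheta_1'(0)}{2\vartheta_2(\omega)}\frac{\vartheta_2(\omega-iw)}{\vartheta_1(iw)}$. It is $2\pi$-periodic in $u$, with metric $e^{2h(u,w(v))}(du^2+dv^2)$, $e^{h(u,w)}=|\gamma_u(u,w)|$, and dual $df^*=e^{-2h}(f_u\,du-f_v\,dv)$. The function $s(w)=e^{-h(\omega,w)}$ increases from $s_0$ to $\infty$ on $(0,2\pi\,\mathrm{Im}\,\tau)$ and satisfies $s'(w)^2=Q_3(s)$. It is from a fundamental piece of rhombic type, with parameters $\delta\neq0$, $s_1,s_2\in\mathbb{R}$, if: $Q$ has exactly two real zeros $s_1^-<s_1^+$ (simple) and a pair of non-real complex conjugate zeros; the real oval $[s_1^-,s_1^+]$ of $Q$ is strictly contained in the real oval $[s_0,\infty)$ of $Q_3$; the function $w(v)$ is given by $w'(v)=w'(s)s'(v)$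 with $w'(s)=1/\sqrt{Q_3(s)}$ and $v'(s)=\delta/\sqrt{Q(s)}$ (positive roots on $[s_1^-,s_1^+]$, continued periodically, so that $s(w(v))$ oscillates between $s_1^-$ and $s_1^+$), with signed root $\sqrt{1-w'(v)^2}=\delta^{-1}(s-s_1)(s-s_2)/s'(w)$ at $w=w(v)$, $s=s(w(v))$; and $f$ is not closed after one period $\mathcal{V}$ of $w$, i.e. $f(u,v+\mathcal{V})\ne f(u,v)$. All $v$-curves are then spherical. $f^\pm$ are tori if (besides being $2\pi$-periodic in $u$) there is $T>0$ with $f^\pm(u,v+T)=f^\pm(u,v)$ for both signs. *)

theory Defs
  imports
    "HOL-Analysis.Analysis"
    "HOL-Computational_Algebra.Polynomial"
begin

section \<open>Quaternions\<close>

text \<open>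
  \<open>Quat a b\<close> is the quaternion \<open>a + b \<^bold>j\<close> with \<open>a, b\<close> in the complex numbers
  \<open>span {1, \<^bold>i}\<close>; the product is determined by \<open>\<^bold>j z = cnj z \<^bold>j\<close> and \<open>\<^bold>j \<^bold>j = -1\<close>.
\<close>

datatype quat = Quat (quat_C: complex) (quat_J: complex)

instantiation quat :: real_normed_div_algebra
begin

definition "0 = Quat 0 0"
definition "1 = Quat 1 0"
definition "p + q = Quat (quat_C p + quat_C q) (quat_J p + quat_J q)"
definition "- q = Quat (- quat_C q) (- quat_J q)"
definition "p - q = Quat (quat_C p - quat_C q) (quat_J p - quat_J q)"
definition "p * q = Quat (quat_C p * quat_C q - quat_J p * cnj (quat_J q))
                         (quat_C p * quat_J q + quat_J p * cnj (quat_C q))"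
definition "scaleR r q = Quat (r *\<^sub>R quat_C q) (r *\<^sub>R quat_J q)"
definition "norm q = norm (quat_C q, quat_J q)"
definition "sgn q = scaleR (inverse (norm q)) q" for q :: quat
definition "dist p q = norm (p - q)" for p q :: quat
definition "inverse q = scaleR (inverse ((norm q)\<^sup>2)) (Quat (cnj (quat_C q)) (- quat_J q))" for q :: quat
definition "p div q = p * inverse q" for p q :: quat
definition [code del]:
  "(uniformity :: (quat \<times> quat) filter) = (INF e\<in>{0 <..}. principal {(p, q). dist p q < e})"
definition [code del]:
  "open (U :: quat set) \<longleftrightarrow> (\<forall>x\<in>U. eventually (\<lambda>(x', y). x' = x \<longrightarrow> y \<in> U) uniformity)"

lemmas quat_defs = zero_quat_def one_quat_def plus_quat_def uminus_quat_def minus_quat_def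
  times_quat_def scaleR_quat_def

lemma quat_norm_sq: "(norm q)\<^sup>2 = (cmod (quat_C q))\<^sup>2 + (cmod (quat_J q))\<^sup>2" for q :: quat
  by (simp add: norm_quat_def norm_Pair)

instance
proof
  fix p q :: quat
  have cm: "complex_of_real ((cmod z)\<^sup>2) = z * cnj z" for z
    by (rule complex_norm_square)
  have sq: "(norm (p * q))\<^sup>2 = (norm p * norm q)\<^sup>2"
  proof -
    have "complex_of_real ((norm (p * q))\<^sup>2) = complex_of_real ((norm p * norm q)\<^sup>2)"
      unfolding power_mult_distrib quat_norm_sq of_real_add of_real_mult cm
      by (simp add: times_quat_def algebra_simps)
    then show ?thesis using of_real_eq_iff by blast
  qed
  show "norm (p * q) = norm p * norm q"
    using sq by (rule power2_eq_imp_eq) (auto simp: norm_quat_def)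
  show "norm (p + q) \<le> norm p + norm q"
    using norm_triangle_ineq [of "(quat_C p, quat_J p)" "(quat_C q, quat_J q)"]
    by (simp add: norm_quat_def plus_quat_def)
  show "norm p = 0 \<longleftrightarrow> p = 0"
    by (cases p) (simp add: norm_quat_def zero_quat_def norm_Pair)
  show "norm (a *\<^sub>R p) = \<bar>a\<bar> * norm p" for a
    using norm_scaleR [of a "(quat_C p, quat_J p)"]
    by (simp add: norm_quat_def scaleR_quat_def)
  assume "p \<noteq> 0"
  then have n0: "(norm p)\<^sup>2 \<noteq> 0"
    by (cases p) (simp add: norm_quat_def zero_quat_def norm_Pair)
  have c: "complex_of_real ((norm p)\<^sup>2) = quat_C p * cnj (quat_C p) + quat_J p * cnj (quat_J p)"
    unfolding quat_norm_sq of_real_add cm ..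
  have "p * Quat (cnj (quat_C p)) (- quat_J p) = Quat (of_real ((norm p)\<^sup>2)) 0"
       "Quat (cnj (quat_C p)) (- quat_J p) * p = Quat (of_real ((norm p)\<^sup>2)) 0"
    unfolding c by (simp_all add: times_quat_def algebra_simps)
  moreover have "x * scaleR a y = scaleR a (x * y)" "scaleR a y * x = scaleR a (y * x)" for x y :: quat and a
    by (simp_all add: times_quat_def scaleR_quat_def scaleR_diff_right scaleR_add_right)
  moreover have "scaleR (inverse a) (Quat (of_real a) 0) = 1" if "a \<noteq> 0" for a
    using that by (simp add: scaleR_quat_def one_quat_def scaleR_conv_of_real)
  ultimately show "inverse p * p = 1" "p * inverse p = 1"
    unfolding inverse_quat_def using n0 by (simp_all del: of_real_power)
next
  show "inverse (0 :: quat) = 0"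
    by (simp add: inverse_quat_def zero_quat_def scaleR_quat_def)
qed (auto simp: quat_defs sgn_quat_def dist_quat_def divide_quat_def uniformity_quat_def
       open_quat_def algebra_simps scaleR_add_left scaleR_add_right intro: quat.expand)

end

definition quat_of_complex :: "complex \<Rightarrow> quat" where
  "quat_of_complex z = Quat z 0"

definition quat_i :: quat where "quat_i = Quat \<i> 0"
definition quat_j :: quat where "quat_j = Quat 0 1"
definition quat_k :: quat where "quat_k = Quat 0 \<i>"

lemma quat_units: "quat_i * quat_j = quat_k" "quat_j * quat_k = quat_i" "quat_k * quat_i = quat_j"
    "quat_i * quat_i = -1" "quat_j * quat_j = -1" "quat_k * quat_k = -1"
  by (simp_all add: quat_i_def quat_j_def quat_k_def quat_defs)

definition Im_quat :: "quat set" where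
  "Im_quat = {q. Re (quat_C q) = 0}"


section \<open>Jacobi theta functions\<close>

text \<open>Whittaker--Watson normalization; \<open>nome_pow \<tau> a\<close> is \<open>q\<^sup>a\<close> for the nome \<open>q = exp (\<i> \<pi> \<tau>)\<close>.\<close>

definition nome_pow :: "complex \<Rightarrow> real \<Rightarrow> complex" where
  "nome_pow \<tau> a = exp (\<i> * of_real pi * \<tau> * of_real a)"

definition theta1 :: "complex \<Rightarrow> complex \<Rightarrow> complex" where
  "theta1 \<tau> z =
     2 * (\<Sum>n. (-1) ^ n * nome_pow \<tau> ((real n + 1/2)\<^sup>2) * sin ((2 * of_nat n + 1) * z))"

definition theta2 :: "complex \<Rightarrow> complex \<Rightarrow> complex" where
  "theta2 \<tau> z =
     2 * (\<Sum>n. nome_pow \<tau> ((real n + 1/2)\<^sup>2) * cos ((2 * of_nat n + 1) * z))"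

definition theta3 :: "complex \<Rightarrow> complex \<Rightarrow> complex" where
  "theta3 \<tau> z =
     1 + 2 * (\<Sum>n. nome_pow \<tau> ((real (Suc n))\<^sup>2) * cos (2 * of_nat (Suc n) * z))"

definition theta4 :: "complex \<Rightarrow> complex \<Rightarrow> complex" where
  "theta4 \<tau> z =
     1 + 2 * (\<Sum>n. (-1) ^ Suc n * nome_pow \<tau> ((real (Suc n))\<^sup>2) * cos (2 * of_nat (Suc n) * z))"


section \<open>The constants and the polynomials\<close>

text \<open>
  For \<open>Re \<tau> = 1/2\<close> and real \<open>\<omega>\<close> the theta quotients below have real values;
  \<open>Re\<close> only converts them to type \<open>real\<close>.
\<close>

definition const_U :: "complex \<Rightarrow> real \<Rightarrow> real" where
  "const_U \<tau> \<omega> = Re (- (1/2) * (deriv (theta1 \<tau>) 0 / (theta2 \<tau> \<omega>)\<^sup>2) * theta1 \<tau> (2 * \<omega>))"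

definition const_U' :: "complex \<Rightarrow> real \<Rightarrow> real" where
  "const_U' \<tau> \<omega> = Re (- (1/2) * (deriv (theta1 \<tau>) 0 / (theta2 \<tau> \<omega>)\<^sup>2) * deriv (theta1 \<tau>) (2 * \<omega>))"

definition const_U1' :: "complex \<Rightarrow> real \<Rightarrow> real" where
  "const_U1' \<tau> \<omega> = Re ((1/2) * ((deriv (theta1 \<tau>) 0)\<^sup>2 / (theta2 \<tau> \<omega>)\<^sup>2))"

definition const_U2 :: "complex \<Rightarrow> real \<Rightarrow> real" where
  "const_U2 \<tau> \<omega> = Re ((deriv (theta1 \<tau>) 0)\<^sup>2 / (theta2 \<tau> \<omega>)\<^sup>2 *
     ((theta1 \<tau> \<omega>)\<^sup>2 / (theta2 \<tau> 0)\<^sup>2 + (theta4 \<tau> \<omega>)\<^sup>2 / (theta3 \<tau> 0)\<^sup>2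
       + (theta3 \<tau> \<omega>)\<^sup>2 / (theta4 \<tau> 0)\<^sup>2))"

definition const_s0 :: "complex \<Rightarrow> real \<Rightarrow> real" where
  "const_s0 \<tau> \<omega> = Re ((theta1 \<tau> \<omega>)\<^sup>2 / (theta2 \<tau> 0)\<^sup>2)"

definition Q3 :: "complex \<Rightarrow> real \<Rightarrow> real poly" where
  "Q3 \<tau> \<omega> = [: - (const_U \<tau> \<omega>)\<^sup>2, - 2 * const_U' \<tau> \<omega>, - const_U2 \<tau> \<omega>, 2 * const_U1' \<tau> \<omega> :]"

definition Q :: "complex \<Rightarrow> real \<Rightarrow> real \<Rightarrow> real \<Rightarrow> real \<Rightarrow> real poly" where
  "Q \<tau> \<omega> \<delta> s1 s2 = - ([:- s1, 1:]\<^sup>2 * [:- s2, 1:]\<^sup>2) + smult (\<delta>\<^sup>2) (Q3 \<tau> \<omega>)"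

definition Q2 :: "complex \<Rightarrow> real \<Rightarrow> real \<Rightarrow> real \<Rightarrow> real \<Rightarrow> real \<Rightarrow> real" where
  "Q2 \<tau> \<omega> \<delta> s1 s2 s = - (s - s1) * (s - s2) + \<delta>\<^sup>2 * const_U1' \<tau> \<omega> * s"

definition Q2_tilde :: "complex \<Rightarrow> real \<Rightarrow> real \<Rightarrow> real \<Rightarrow> real \<Rightarrow> real \<Rightarrow> real" where
  "Q2_tilde \<tau> \<omega> s1 s2 Z0 s =
     Z0\<^sup>2 * s\<^sup>2 - (1 + s / (const_U \<tau> \<omega>)\<^sup>2 * (const_U' \<tau> \<omega> + s1 * s2 * const_U1' \<tau> \<omega>))\<^sup>2"


section \<open>Isothermic cylinders with a family of closed planar curvature lines\<close>

definition real_analytic :: "(real \<Rightarrow> real) \<Rightarrow> bool" where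
  "real_analytic g \<longleftrightarrow> (\<forall>x. \<exists>F. (\<lambda>t. g (x + t)) has_fps_expansion F)"

definition planar_curve :: "complex \<Rightarrow> real \<Rightarrow> real \<Rightarrow> real \<Rightarrow> complex" where
  "planar_curve \<tau> \<omega> u w =
     - \<i> * (2 * (theta2 \<tau> \<omega>)\<^sup>2 / (deriv (theta1 \<tau>) 0 * theta1 \<tau> (2 * \<omega>)))
       * (theta1 \<tau> ((1/2) * (u + \<i> * w - 3 * \<omega>)) / theta1 \<tau> ((1/2) * (u + \<i> * w + \<omega>)))"

definition W1 :: "complex \<Rightarrow> real \<Rightarrow> real \<Rightarrow> complex" where
  "W1 \<tau> \<omega> w =
     \<i> * (deriv (theta1 \<tau>) 0 / (2 * theta2 \<tau> \<omega>)) * (theta2 \<tau> (\<omega> - \<i> * w) / theta1 \<tau> (\<i> * w))"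

definition metric_h :: "complex \<Rightarrow> real \<Rightarrow> real \<Rightarrow> real \<Rightarrow> real" where
  "metric_h \<tau> \<omega> u w = ln (cmod (vector_derivative (\<lambda>u. planar_curve \<tau> \<omega> u w) (at u)))"

definition s_of_w :: "complex \<Rightarrow> real \<Rightarrow> real \<Rightarrow> real" where
  "s_of_w \<tau> \<omega> w = exp (- metric_h \<tau> \<omega> \<omega> w)"

text \<open>\<open>r\<close> is the chosen real analytic (possibly sign-changing) root of \<open>1 - w'\<^sup>2\<close>.\<close>

definition isothermic_planar_cylinder ::
    "complex \<Rightarrow> real \<Rightarrow> (real \<Rightarrow> real) \<Rightarrow> (real \<Rightarrow> real) \<Rightarrow> (real \<Rightarrow> quat) \<Rightarrow>
     (real \<Rightarrow> real \<Rightarrow> quat) \<Rightarrow> bool" where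
  "isothermic_planar_cylinder \<tau> \<omega> w r \<Phi> f \<longleftrightarrow>
     (\<forall>v. 0 < w v \<and> w v < 2 * pi * Im \<tau>) \<and> real_analytic w \<and>
     real_analytic r \<and> (\<forall>v. (r v)\<^sup>2 = 1 - (deriv w v)\<^sup>2) \<and>
     (\<forall>v. norm (\<Phi> v) = 1) \<and>
     (\<forall>v. (\<Phi> has_vector_derivative
             (quat_of_complex (r v * W1 \<tau> \<omega> (w v)) * quat_k) * \<Phi> v) (at v)) \<and>
     (\<forall>u v. f u v =
        inverse (\<Phi> v) * (quat_of_complex (planar_curve \<tau> \<omega> u (w v)) * quat_j) * \<Phi> v)"


section \<open>Fundamental pieces of rhombic type\<close>

text \<open>
  \<open>v_of_s\<close> is the solution of \<open>v'(s) = \<delta> / sqrt (Q s)\<close> with \<open>v(sm) = 0\<close>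
  on the real oval \<open>[sm, sp]\<close> of \<open>Q\<close>; going from \<open>sm\<close> to \<open>sp\<close> takes half a period.
\<close>

definition v_of_s :: "complex \<Rightarrow> real \<Rightarrow> real \<Rightarrow> real \<Rightarrow> real \<Rightarrow> real \<Rightarrow> real \<Rightarrow> real" where
  "v_of_s \<tau> \<omega> \<delta> s1 s2 sm s = integral {sm..s} (\<lambda>t. \<delta> / sqrt (poly (Q \<tau> \<omega> \<delta> s1 s2) t))"

definition w_period :: "complex \<Rightarrow> real \<Rightarrow> real \<Rightarrow> real \<Rightarrow> real \<Rightarrow> real \<Rightarrow> real \<Rightarrow> real" where
  "w_period \<tau> \<omega> \<delta> s1 s2 sm sp = 2 * \<bar>v_of_s \<tau> \<omega> \<delta> s1 s2 sm sp\<bar>"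

text \<open>
  The base point \<open>v0\<close> is a parameter value with \<open>s = sm\<close>. The relation \<open>w'(v) = w'(s) s'(v)\<close>
  is stated through the inverse function: along \<open>v = v0 + v_of_s s\<close> one has
  \<open>dw/ds = 1 / sqrt (Q3 s)\<close> and \<open>s(w) = s\<close>. Beyond this half period both square roots change
  sign at the branch points, that is, \<open>w\<close> is continued by reflection in \<open>v0\<close> and periodicity.
\<close>

definition rhombic_w ::
    "complex \<Rightarrow> real \<Rightarrow> real \<Rightarrow> real \<Rightarrow> real \<Rightarrow> real \<Rightarrow> real \<Rightarrow> (real \<Rightarrow> real) \<Rightarrow> bool" where
  "rhombic_w \<tau> \<omega> \<delta> s1 s2 sm sp w \<longleftrightarrow>
     (\<exists>v0.
        (\<forall>s\<in>{sm..sp}. s_of_w \<tau> \<omega> (w (v0 + v_of_s \<tau> \<omega> \<delta> s1 s2 sm s)) = s) \<and>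
        (\<forall>s\<in>{sm<..<sp}. ((\<lambda>s. w (v0 + v_of_s \<tau> \<omega> \<delta> s1 s2 sm s))
            has_real_derivative 1 / sqrt (poly (Q3 \<tau> \<omega>) s)) (at s)) \<and>
        (\<forall>v. w (v0 - v) = w (v0 + v)) \<and>
        (\<forall>v. w (v + w_period \<tau> \<omega> \<delta> s1 s2 sm sp) = w v))"

definition rhombic_fundamental_piece ::
    "complex \<Rightarrow> real \<Rightarrow> real \<Rightarrow> real \<Rightarrow> real \<Rightarrow> real \<Rightarrow> real \<Rightarrow>
     (real \<Rightarrow> real) \<Rightarrow> (real \<Rightarrow> real) \<Rightarrow> (real \<Rightarrow> real \<Rightarrow> quat) \<Rightarrow> bool" where
  "rhombic_fundamental_piece \<tau> \<omega> \<delta> s1 s2 sm sp w r f \<longleftrightarrow>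
     \<delta> \<noteq> 0 \<and>
     sm < sp \<and> {x. poly (Q \<tau> \<omega> \<delta> s1 s2) x = 0} = {sm, sp} \<and>
     order sm (Q \<tau> \<omega> \<delta> s1 s2) = 1 \<and> order sp (Q \<tau> \<omega> \<delta> s1 s2) = 1 \<and>
     (\<exists>z. Im z \<noteq> 0 \<and> {x. poly (map_poly complex_of_real (Q \<tau> \<omega> \<delta> s1 s2)) x = 0}
                        = {complex_of_real sm, complex_of_real sp, z, cnj z}) \<and>
     const_s0 \<tau> \<omega> < sm \<and>
     rhombic_w \<tau> \<omega> \<delta> s1 s2 sm sp w \<and>
     (\<forall>v. r v = (s_of_w \<tau> \<omega> (w v) - s1) * (s_of_w \<tau> \<omega> (w v) - s2)
                  / (\<delta> * deriv (s_of_w \<tau> \<omega>) (w v))) \<and>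
     \<not> (\<forall>u v. f u (v + w_period \<tau> \<omega> \<delta> s1 s2 sm sp) = f u v)"


section \<open>Bonnet pairs\<close>

definition dual_differential ::
    "(real \<Rightarrow> real \<Rightarrow> real) \<Rightarrow> (real \<Rightarrow> real \<Rightarrow> quat) \<Rightarrow> real \<Rightarrow> real \<Rightarrow> real \<times> real \<Rightarrow> quat" where
  "dual_differential h f u v = (\<lambda>(du, dv). exp (- 2 * h u v) *\<^sub>R
     (du *\<^sub>R vector_derivative (\<lambda>u. f u v) (at u) - dv *\<^sub>R vector_derivative (\<lambda>v. f u v) (at v)))"

text \<open>
  \<open>F\<close> is a surface in \<open>Im \<bbbH>\<close> with \<open>dF = (\<epsilon> - f) df* (\<epsilon> + f)\<close>. The two members \<open>f\<^sup>\<plusminus>\<close> of the Bonnet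
  pair, each determined up to a translation, are obtained with \<open>\<epsilon>\<close> and \<open>- \<epsilon>\<close>.
\<close>

definition bonnet_mate ::
    "real \<Rightarrow> (real \<Rightarrow> real \<Rightarrow> real) \<Rightarrow> (real \<Rightarrow> real \<Rightarrow> quat) \<Rightarrow> (real \<Rightarrow> real \<Rightarrow> quat) \<Rightarrow> bool" where
  "bonnet_mate \<epsilon> h f F \<longleftrightarrow>
     (\<forall>u v. F u v \<in> Im_quat) \<and>
     (\<forall>u v. ((\<lambda>(u, v). F u v) has_derivative
        (\<lambda>d. (of_real \<epsilon> - f u v) * dual_differential h f u v d * (of_real \<epsilon> + f u v))) (at (u, v)))"

definition pair_of_tori :: "(real \<Rightarrow> real \<Rightarrow> quat) \<Rightarrow> (real \<Rightarrow> real \<Rightarrow> quat) \<Rightarrow> bool" where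
  "pair_of_tori fp fm \<longleftrightarrow>
     (\<forall>u v. fp (u + 2 * pi) v = fp u v \<and> fm (u + 2 * pi) v = fm u v) \<and>
     (\<exists>T>0. \<forall>u v. fp u (v + T) = fp u v \<and> fm u (v + T) = fm u v)"

end

theory Submission
  imports Defs "HOL-Complex_Analysis.Complex_Analysis"
begin

text \<open>
  Along \<open>v\<close> the frame \<open>\<Phi>\<close> solves a linear equation whose coefficients have the period of \<open>w\<close>. After
  one period \<open>\<Phi>\<close> is therefore multiplied on the right by a fixed unit quaternion, so \<open>f\<close> returns to
  itself up to a rotation about a line through the origin. The differentials of \<open>f\<^sup>\<plusminus>\<close> are built from \<open>f\<close>
  and \<open>df\<^sup>*\<close>, so \<open>f\<^sup>\<plusminus>\<close> return up to a screw motion with the same rotational part. A screw motion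
  with nontrivial rotational part has a power equal to the identity exactly if the rotation has
  finite order and the translation has no component along the axis. These are the two conditions of
  the theorem, and what remains is to compute the angle and the axial translation.

  The computation takes place on the curve \<open>u = \<omega>\<close>, where \<open>f\<close> has the constant length \<open>1/\<bar>U\<bar>\<close> and the
  coefficients of the frame equation are algebraic in \<open>s\<close>. In this frame the axis has an explicit
  algebraic expression, of constant length \<open>Z\<^sub>0\<close> (\<open>axis_ODE\<close>, \<open>axis_norm\<close>, \<open>rot_\<xi>_const\<close>). Once the axis is
  known, the angular velocity of \<open>f\<close> about it is the integrand of \<open>\<theta>\<close> (\<open>sgn_\<zeta>_has_vector_derivative\<close>),
  and the axial velocity of \<open>f\<^sup>\<plusminus>\<close> is a multiple of \<open>Q\<^sub>2\<close> plus an exact term (\<open>axial_translation\<close>).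
  Half a period suffices: \<open>w\<close> is even about the parameter values of both zeros of \<open>Q\<close>, so the
  monodromy is the product of two half-turns about the normals of the curvature planes at these two
  values (\<open>\<Psi>_reflect\<close>, \<open>\<Psi>_per\<close>), and the angle between the normals is the integral over \<open>[s\<^sub>1\<^sup>-, s\<^sub>1\<^sup>+]\<close>
  up to a multiple of a right angle (\<open>\<kappa>_sq\<close>). Such a multiple does not affect whether the rotation has
  finite order.

  Two further points are needed. First, \<open>f\<^sup>\<plusminus>\<close> close up in \<open>u\<close>: the period vector is invariant under
  the monodromy, hence parallel to the axis, and its component normal to a curvature plane is the
  integral of an odd function (\<open>bonnet_2pi_periodic\<close>). Second, a period of \<open>f\<^sup>\<plusminus>\<close> in \<open>v\<close> is a period of the metric on
  \<open>u = \<omega>\<close>, which is \<open>(\<epsilon>\<^sup>2 + U\<^sup>-\<^sup>2) s\<close>, and so a multiple of the period of \<open>w\<close>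
  (\<open>\<sigma>_period_is_multiple\<close>).

  Theta functions enter only through the Weierstrass three-term identity, which is the Pluecker
  relation once \<open>\<theta>\<^sub>1(x + y) \<theta>\<^sub>1(x - y)\<close> is written as a \<open>2 \<times> 2\<close> determinant (\<open>theta1_product\<close>). It yields
  the conformality of \<open>f\<close> (\<open>isothermic_identity\<close>), the formula \<open>\<gamma>\<^sub>u = - \<i> (\<theta>\<^sub>2/\<theta>\<^sub>1)\<^sup>2\<close> at the critical point \<open>\<omega>\<close>
  (\<open>theta1_wronskian\<close>), and the location of the zeros of \<open>\<theta>\<^sub>1\<close> (\<open>theta1_zeros\<close>).
\<close>

section \<open>Sums over the integers\<close>

lemma has_sum_int_split:
  fixes g :: "int \<Rightarrow> 'a::{topological_comm_monoid_add,t2_space}"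
  assumes "(g has_sum a) {0..}" "(g has_sum b) {..<0}"
  shows "(g has_sum (a + b)) UNIV"
proof -
  have "(g has_sum (a + b)) ({0..} \<union> {..<0})"
    by (rule has_sum_Un_disjoint) (use assms in auto)
  moreover have "{0..} \<union> {..<0::int} = UNIV" by auto
  ultimately show ?thesis by simp
qed

lemma bij_int_nonneg: "bij_betw int UNIV {0..}"
  by (rule bij_betwI[of _ _ _ nat]) auto

lemma bij_int_neg: "bij_betw (\<lambda>n. - int n - 1) UNIV {..<0}"
  by (rule bij_betwI[of _ _ _ "\<lambda>k. nat (- k - 1)"]) auto

lemma has_sum_int_imp_sums:
  fixes g :: "int \<Rightarrow> complex"
  assumes "g summable_on UNIV"
  shows "(\<lambda>n. g (int n) + g (- int n - 1)) sums infsum g UNIV"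
proof -
  have 1: "g summable_on {0..}" and 2: "g summable_on {..<0}"
    using assms summable_on_subset by blast+
  have "((\<lambda>n. g (int n)) has_sum infsum g {0..}) UNIV"
    using 1 by (subst has_sum_reindex_bij_betw[OF bij_int_nonneg]) auto
  moreover have "((\<lambda>n. g (- int n - 1)) has_sum infsum g {..<0}) UNIV"
    using 2 by (subst has_sum_reindex_bij_betw[OF bij_int_neg]) auto
  ultimately have "((\<lambda>n. g (int n) + g (- int n - 1)) has_sum (infsum g {0..} + infsum g {..<0})) UNIV"
    by (rule has_sum_add)
  moreover have "infsum g UNIV = infsum g {0..} + infsum g {..<0}"
    using has_sum_int_split[OF has_sum_infsum[OF 1] has_sum_infsum[OF 2]] by (rule infsumI)
  ultimately show ?thesis by (simp only: has_sum_imp_sums)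
qed

text \<open>
  Completing the square bounds the exponent by a constant minus \<open>\<bar>n\<bar>\<close>, so a geometric series dominates.
\<close>

lemma summable_on_int_gaussian:
  fixes c d :: real
  assumes "c > 0"
  shows "(\<lambda>n::int. exp (- c * (of_int n)\<^sup>2 + d * of_int n)) summable_on UNIV"
proof -
  define B where "B = (\<bar>d\<bar> + 1)\<^sup>2 / (4 * c)"
  have geo: "(\<lambda>n. exp (- 1 :: real) ^ n) summable_on UNIV"
    by (rule norm_summable_imp_summable_on) (auto intro!: summable_geometric simp: power_abs)
  have "(\<lambda>n::int. exp (- 1::real) ^ nat \<bar>n\<bar>) summable_on UNIV"
  proof -
    have "(\<lambda>n::int. exp (- 1::real) ^ nat \<bar>n\<bar>) summable_on {0..}"
      using geo by (subst summable_on_reindex_bij_betw[OF bij_int_nonneg, symmetric]) auto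
    moreover have "(\<lambda>n::int. exp (- 1::real) ^ nat \<bar>n\<bar>) summable_on {..<0}"
    proof (subst summable_on_reindex_bij_betw[OF bij_int_neg, symmetric])
      have "nat \<bar>- int n - 1\<bar> = Suc n" for n by simp
      then show "(\<lambda>n. exp (- 1::real) ^ nat \<bar>- int n - 1\<bar>) summable_on UNIV"
        using summable_on_cmult_right[OF geo, of "exp (-1)"] by simp
    qed
    ultimately show ?thesis
      using has_sum_int_split unfolding summable_on_def by blast
  qed
  then have s: "(\<lambda>n::int. exp B * exp (- 1::real) ^ nat \<bar>n\<bar>) summable_on UNIV"
    by (rule summable_on_cmult_right)
  show ?thesis
  proof (rule summable_on_comparison_test[OF s])
    fix n :: int
    define x where "x = \<bar>real_of_int n\<bar>"
    have sq: "0 \<le> (2 * c * x - (\<bar>d\<bar> + 1))\<^sup>2" by simp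
    have "- c * x\<^sup>2 + (\<bar>d\<bar> + 1) * x \<le> B"
    proof -
      have "(- c * x\<^sup>2 + (\<bar>d\<bar> + 1) * x) * (4 * c) \<le> (\<bar>d\<bar> + 1)\<^sup>2"
        using sq by (simp add: power2_eq_square algebra_simps)
      then show ?thesis
        unfolding B_def using assms by (subst pos_le_divide_eq) auto
    qed
    moreover have "d * of_int n \<le> \<bar>d\<bar> * x"
      unfolding x_def by (metis abs_ge_self abs_mult)
    moreover have "x\<^sup>2 = (of_int n)\<^sup>2" by (simp add: x_def)
    ultimately have "- c * (of_int n)\<^sup>2 + d * of_int n \<le> B - x" by (simp add: algebra_simps)
    moreover have "exp (- 1::real) ^ nat \<bar>n\<bar> = exp (- x)"
      unfolding x_def by (simp add: exp_of_nat_mult[symmetric] del: exp_minus) 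
    ultimately show "exp (- c * (of_int n)\<^sup>2 + d * of_int n) \<le> exp B * exp (- 1) ^ nat \<bar>n\<bar>"
      by (simp add: exp_add[symmetric])
  qed auto
qed

section \<open>Theta functions as bilateral series\<close>

text \<open>
  Over the integers the shifts \<open>z \<mapsto> z + \<pi>\<tau>\<close> and \<open>z \<mapsto> x \<plusminus> y\<close> become reindexings, and with
  \<open>theta1_eq_theta2\<close> one series serves both functions.
\<close>

definition theta2_term :: "complex \<Rightarrow> complex \<Rightarrow> int \<Rightarrow> complex" where
  "theta2_term \<tau> z n = nome_pow \<tau> ((of_int n + 1/2)\<^sup>2) * exp (\<i> * (2 * of_int n + 1) * z)"

lemma norm_nome_pow: "norm (nome_pow \<tau> a) = exp (- pi * Im \<tau> * a)"
  by (simp add: nome_pow_def algebra_simps)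

lemma nome_pow_add: "nome_pow \<tau> (a + b) = nome_pow \<tau> a * nome_pow \<tau> b"
  by (simp add: nome_pow_def exp_add[symmetric] algebra_simps)

lemma norm_summable_theta2_term:
  assumes "Im \<tau> > 0"
  shows "(\<lambda>n. norm (theta2_term \<tau> z n)) summable_on UNIV"
proof -
  have "norm (theta2_term \<tau> z n) = exp (- pi * Im \<tau> / 4 - Im z) *
          exp (- (pi * Im \<tau>) * (of_int n)\<^sup>2 + (- pi * Im \<tau> - 2 * Im z) * of_int n)" for n
    by (simp add: theta2_term_def norm_mult norm_nome_pow exp_add[symmetric] power2_eq_square algebra_simps)
  then show ?thesis
    using summable_on_cmult_right[OF summable_on_int_gaussian, of "pi * Im \<tau>"] assms by simp
qed

lemma summable_theta2_term:
  assumes "Im \<tau> > 0"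
  shows "theta2_term \<tau> z summable_on UNIV"
  using norm_summable_theta2_term[OF assms] by (rule abs_summable_summable)

lemma theta2_eq_infsum:
  assumes "Im \<tau> > 0"
  shows "theta2 \<tau> z = infsum (theta2_term \<tau> z) UNIV"
proof -
  have "theta2_term \<tau> z (int n) + theta2_term \<tau> z (- int n - 1) =
          2 * (nome_pow \<tau> ((real n + 1/2)\<^sup>2) * cos ((2 * of_nat n + 1) * z))" for n
  proof -
    have "(of_int (- int n - 1) + 1/2 :: real)\<^sup>2 = (real n + 1/2)\<^sup>2" by (simp add: power2_eq_square algebra_simps)
    moreover have "\<i> * (2 * of_int (- int n - 1) + 1) * z = - (\<i> * ((2 * of_nat n + 1) * z))"
      by (simp add: algebra_simps)
    ultimately show ?thesis
      by (simp add: theta2_term_def cos_exp_eq algebra_simps)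
  qed
  then have s: "(\<lambda>n. 2 * (nome_pow \<tau> ((real n + 1/2)\<^sup>2) * cos ((2 * of_nat n + 1) * z)))
       sums infsum (theta2_term \<tau> z) UNIV"
    using has_sum_int_imp_sums[OF summable_theta2_term[OF assms], of z] by simp
  then have "summable (\<lambda>n. nome_pow \<tau> ((real n + 1/2)\<^sup>2) * cos ((2 * of_nat n + 1) * z))"
    by (simp only: sums_iff summable_cmult_iff) simp
  from suminf_mult[OF this, of 2] s show ?thesis
    unfolding theta2_def by (simp only: sums_iff)
qed

lemma theta1_eq_theta2: "theta1 \<tau> (z :: complex) = theta2 \<tau> (z - pi / 2)"
proof -
  have "cos ((2 * of_nat n + 1) * (z - of_real pi / 2)) = (-1) ^ n * sin ((2 * of_nat n + 1) * z)" for n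
  proof -
    have "(2 * of_nat n + 1) * (z - of_real pi / 2) = ((2 * of_nat n + 1) * z - of_real (of_nat n * pi)) - of_real (pi / 2)"
      by (simp add: algebra_simps add_divide_distrib)
    also have "cos \<dots> = sin ((2 * of_nat n + 1) * z - of_real (of_nat n * pi))"
      by (simp add: cos_diff[of _ "of_real (pi/2)"] cos_of_real sin_of_real del: of_real_divide)
    also have "\<dots> = (-1) ^ n * sin ((2 * of_nat n + 1) * z)"
      by (simp add: sin_diff[of _ "of_real (of_nat n * pi)"] cos_of_real sin_of_real del: of_real_mult)
    finally show ?thesis .
  qed
  then show ?thesis
    by (simp add: theta1_def theta2_def mult.assoc mult.left_commute)
qed

lemma theta2_eq_theta1: "theta2 \<tau> (z :: complex) = theta1 \<tau> (z + pi / 2)"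
  by (simp add: theta1_eq_theta2)

lemma theta2_minus: "theta2 \<tau> (- z) = theta2 \<tau> z"
  by (simp add: theta2_def)

lemma theta2_add_pi:
  fixes \<tau> z :: complex
  assumes "Im \<tau> > 0"
  shows "theta2 \<tau> (z + pi) = - theta2 \<tau> z"
proof -
  have "theta2_term \<tau> (z + pi) n = - theta2_term \<tau> z n" for n
  proof -
    have "\<i> * (2 * of_int n + 1) * (z + pi) = \<i> * (2 * of_int n + 1) * z + \<i> * of_int (2 * n + 1) * pi"
      by (simp add: algebra_simps)
    moreover have "exp (\<i> * of_int (2 * n + 1) * pi) = - 1"
      using exp_integer_2pi_plus1[of "of_int n"] by (simp add: mult.commute mult.left_commute)
    ultimately show ?thesis by (simp add: theta2_term_def exp_add)
  qed
  then have "theta2_term \<tau> (z + pi) = (\<lambda>n. - theta2_term \<tau> z n)" by (rule ext)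
  then show ?thesis by (simp add: theta2_eq_infsum[OF assms] infsum_uminus)
qed

lemma theta1_add_pi:
  fixes \<tau> z :: complex
  assumes "Im \<tau> > 0"
  shows "theta1 \<tau> (z + pi) = - theta1 \<tau> z"
  using theta2_add_pi[OF assms, of "z - pi/2"] by (simp add: theta1_eq_theta2 algebra_simps)

lemma theta1_minus:
  fixes \<tau> z :: complex
  assumes "Im \<tau> > 0"
  shows "theta1 \<tau> (- z) = - theta1 \<tau> z"
proof -
  have "theta1 \<tau> (- z) = theta2 \<tau> (z - pi / 2 + pi)"
    using theta2_minus[of \<tau> "z + pi/2"] by (simp add: theta1_eq_theta2 algebra_simps)
  then show ?thesis by (simp only: theta2_add_pi[OF assms] theta1_eq_theta2)
qed

lemma theta1_0: "theta1 \<tau> 0 = 0"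
  by (simp add: theta1_def)

text \<open>
  Adding \<open>\<pi>\<tau>\<close> to the argument completes the square of \<open>n + 1/2\<close> to that of \<open>n + 3/2\<close>.
\<close>

lemma theta1_add_pi_tau:
  fixes \<tau> z :: complex
  assumes "Im \<tau> > 0"
  shows "theta1 \<tau> (z + pi * \<tau>) = - exp (- \<i> * pi * \<tau> - 2 * \<i> * z) * theta1 \<tau> z"
proof -
  have t: "theta2_term \<tau> (z + pi * \<tau>) n = exp (- \<i> * pi * \<tau> - 2 * \<i> * z) * theta2_term \<tau> z (n + 1)" for z :: complex and n
    by (simp add: theta2_term_def nome_pow_def exp_add[symmetric] power2_eq_square algebra_simps)
  have "theta2 \<tau> (z + pi * \<tau>) = exp (- \<i> * pi * \<tau> - 2 * \<i> * z) * theta2 \<tau> z" for z :: complex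
  proof -
    have "bij_betw (\<lambda>n::int. n + 1) UNIV UNIV" by (rule bij_betwI[of _ _ _ "\<lambda>n. n - 1"]) auto
    then have "infsum (\<lambda>n. theta2_term \<tau> z (n + 1)) UNIV = infsum (theta2_term \<tau> z) UNIV"
      by (rule infsum_reindex_bij_betw)
    then show ?thesis unfolding theta2_eq_infsum[OF assms] t by (simp add: infsum_cmult_right')
  qed
  note this[of "z - pi/2"]
  moreover have "z - of_real (pi / 2) + of_real pi * \<tau> = z + of_real pi * \<tau> - of_real (pi / 2)"
    by simp
  moreover have "exp (- \<i> * pi * \<tau> - 2 * \<i> * (z - of_real (pi / 2))) = - exp (- \<i> * pi * \<tau> - 2 * \<i> * z)"
  proof -
    have "- \<i> * pi * \<tau> - 2 * \<i> * (z - of_real (pi / 2)) = (- \<i> * pi * \<tau> - 2 * \<i> * z) + \<i> * pi"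
      by (simp add: algebra_simps)
    then show ?thesis by (simp only: exp_add exp_pi_i') simp
  qed
  ultimately show ?thesis by (simp only: theta1_eq_theta2)
qed

section \<open>The three-term identity\<close>

lemma
  fixes f :: "'a \<Rightarrow> complex" and g :: "'b \<Rightarrow> complex"
  assumes f: "(\<lambda>x. norm (f x)) summable_on A" and g: "(\<lambda>y. norm (g y)) summable_on B"
  shows summable_on_product_of_norm_summable: "(\<lambda>(x, y). f x * g y) summable_on A \<times> B"
    and infsum_product_of_norm_summable:
      "infsum f A * infsum g B = infsum (\<lambda>(x, y). f x * g y) (A \<times> B)"
proof -
  have "(\<lambda>p. norm (case p of (x, y) \<Rightarrow> f x * g y)) summable_on A \<times> B"
    unfolding Infinite_Sum.abs_summable_on_Sigma_iff
  proof (intro conjI ballI)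
    fix x show "(\<lambda>y. norm (case (x, y) of (x, y) \<Rightarrow> f x * g y)) summable_on B"
      using summable_on_cmult_right[OF g, of "norm (f x)"] by (simp add: norm_mult)
    have "(\<Sum>\<^sub>\<infinity>y\<in>B. norm (case (x, y) of (x, y) \<Rightarrow> f x * g y)) = norm (f x) * (\<Sum>\<^sub>\<infinity>y\<in>B. norm (g y))" for x
      by (simp add: norm_mult infsum_cmult_right')
    then show "(\<lambda>x. norm (\<Sum>\<^sub>\<infinity>y\<in>B. norm (case (x, y) of (x, y) \<Rightarrow> f x * g y))) summable_on A"
      using summable_on_cmult_left[OF f, of "\<Sum>\<^sub>\<infinity>y\<in>B. norm (g y)"]
      by (simp add: abs_mult infsum_nonneg)
  qed
  then show s: "(\<lambda>(x, y). f x * g y) summable_on A \<times> B"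
    by (rule abs_summable_summable)
  have "(\<Sum>\<^sub>\<infinity>x\<in>A. \<Sum>\<^sub>\<infinity>y\<in>B. f x * g y) = infsum (\<lambda>(x, y). f x * g y) (A \<times> B)"
    by (rule infsum_Sigma'_banach[OF s])
  then show "infsum f A * infsum g B = infsum (\<lambda>(x, y). f x * g y) (A \<times> B)"
    by (simp add: infsum_cmult_right' infsum_cmult_left')
qed

definition double_term :: "complex \<Rightarrow> complex \<Rightarrow> int \<Rightarrow> complex" where
  "double_term \<tau> x k = nome_pow \<tau> ((of_int k)\<^sup>2 / 2) * exp (2 * \<i> * of_int k * x)"

text \<open>
  These are \<open>\<theta>\<^sub>3(2x | 2\<tau>)\<close> and \<open>\<theta>\<^sub>2(2x | 2\<tau>)\<close>.
\<close>

definition even_theta :: "complex \<Rightarrow> complex \<Rightarrow> complex" where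
  "even_theta \<tau> x = infsum (double_term \<tau> x) {k. even k}"

definition odd_theta :: "complex \<Rightarrow> complex \<Rightarrow> complex" where
  "odd_theta \<tau> x = infsum (double_term \<tau> x) {k. odd k}"

lemma norm_summable_double_term:
  assumes "Im \<tau> > 0"
  shows "(\<lambda>k. norm (double_term \<tau> x k)) summable_on A"
proof -
  have "norm (double_term \<tau> x k) = exp (- (pi * Im \<tau> / 2) * (of_int k)\<^sup>2 + (- 2 * Im x) * of_int k)" for k
    by (simp add: double_term_def norm_mult norm_nome_pow exp_add[symmetric] algebra_simps)
  then have "(\<lambda>k. norm (double_term \<tau> x k)) summable_on UNIV"
    using summable_on_int_gaussian[of "pi * Im \<tau> / 2" "- 2 * Im x"] assms by simp
  then show ?thesis by (rule summable_on_subset) auto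
qed

text \<open>
  The substitution \<open>k = m + n + 1\<close>, \<open>l = m - n\<close> maps pairs of integers onto the pairs of opposite parity
  and diagonalizes both the quadratic form in the nome and the exponent.
\<close>

lemma theta2_product:
  assumes "Im \<tau> > 0"
  shows "theta2 \<tau> (x + y) * theta2 \<tau> (x - y)
    = even_theta \<tau> x * odd_theta \<tau> y + odd_theta \<tau> x * even_theta \<tau> y"
proof -
  define h where "h = (\<lambda>(k, l). double_term \<tau> x k * double_term \<tau> y l)"
  have term_eq: "theta2_term \<tau> (x + y) m * theta2_term \<tau> (x - y) n = h (m + n + 1, m - n)" for m n
  proof -
    have "(of_int m + 1/2)\<^sup>2 + (of_int n + 1/2)\<^sup>2
        = (of_int (m + n + 1))\<^sup>2 / 2 + (of_int (m - n))\<^sup>2 / (2 :: real)"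
      by (simp add: power2_eq_square field_simps)
    then have 1: "nome_pow \<tau> ((of_int m + 1/2)\<^sup>2) * nome_pow \<tau> ((of_int n + 1/2)\<^sup>2)
        = nome_pow \<tau> ((of_int (m + n + 1))\<^sup>2 / 2) * nome_pow \<tau> ((of_int (m - n))\<^sup>2 / 2)"
      by (simp only: nome_pow_add[symmetric])
    have "\<i> * (2 * of_int m + 1) * (x + y) + \<i> * (2 * of_int n + 1) * (x - y)
        = 2 * \<i> * of_int (m + n + 1) * x + 2 * \<i> * of_int (m - n) * y"
      by (simp add: algebra_simps)
    then have 2: "exp (\<i> * (2 * of_int m + 1) * (x + y)) * exp (\<i> * (2 * of_int n + 1) * (x - y))
        = exp (2 * \<i> * of_int (m + n + 1) * x) * exp (2 * \<i> * of_int (m - n) * y)"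
      by (simp only: exp_add[symmetric])
    have "theta2_term \<tau> (x + y) m * theta2_term \<tau> (x - y) n
        = (nome_pow \<tau> ((of_int m + 1/2)\<^sup>2) * nome_pow \<tau> ((of_int n + 1/2)\<^sup>2))
          * (exp (\<i> * (2 * of_int m + 1) * (x + y)) * exp (\<i> * (2 * of_int n + 1) * (x - y)))"
      by (simp only: theta2_term_def mult_ac)
    also have "\<dots> = h (m + n + 1, m - n)"
      unfolding 1 2 h_def double_term_def by (simp only: prod.case mult_ac)
    finally show ?thesis .
  qed
  have eo: "(\<Sum>\<^sub>\<infinity>p\<in>{k. even k} \<times> {l. odd l}. h p) = even_theta \<tau> x * odd_theta \<tau> y"
      "h summable_on {k. even k} \<times> {l. odd l}"
    unfolding even_theta_def odd_theta_def h_def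
    by (rule infsum_product_of_norm_summable[symmetric] summable_on_product_of_norm_summable;
        rule norm_summable_double_term[OF assms])+
  have oe: "(\<Sum>\<^sub>\<infinity>p\<in>{k. odd k} \<times> {l. even l}. h p) = odd_theta \<tau> x * even_theta \<tau> y"
      "h summable_on {k. odd k} \<times> {l. even l}"
    unfolding even_theta_def odd_theta_def h_def
    by (rule infsum_product_of_norm_summable[symmetric] summable_on_product_of_norm_summable;
        rule norm_summable_double_term[OF assms])+
  \<comment> \<open>\<open>k\<close> and \<open>l\<close> have opposite parity since \<open>k + l = 2m + 1\<close>\<close>
  have bij: "bij_betw (\<lambda>(m, n). (m + n + 1, m - n)) (UNIV :: (int \<times> int) set)
      ({k. even k} \<times> {l. odd l} \<union> {k. odd k} \<times> {l. even l})"
    by (rule bij_betwI[of _ _ _ "\<lambda>(k, l). ((k + l - 1) div 2, (k - l - 1) div 2)"])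
       (auto, presburger+)
  have "theta2 \<tau> (x + y) * theta2 \<tau> (x - y)
      = (\<Sum>\<^sub>\<infinity>(m, n)\<in>UNIV \<times> UNIV. theta2_term \<tau> (x + y) m * theta2_term \<tau> (x - y) n)"
    unfolding theta2_eq_infsum[OF assms]
    by (rule infsum_product_of_norm_summable) (rule norm_summable_theta2_term[OF assms])+
  also have "\<dots> = (\<Sum>\<^sub>\<infinity>p\<in>UNIV. h ((\<lambda>(m, n). (m + n + 1, m - n)) p))"
    by (simp add: term_eq case_prod_unfold)
  also have "\<dots> = infsum h ({k. even k} \<times> {l. odd l} \<union> {k. odd k} \<times> {l. even l})"
    by (rule infsum_reindex_bij_betw[OF bij])
  also have "\<dots> = infsum h ({k. even k} \<times> {l. odd l}) + infsum h ({k. odd k} \<times> {l. even l})"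
    by (rule infsum_Un_disjoint) (use eo oe in auto)
  finally show ?thesis using eo oe by simp
qed

lemma theta1_product:
  assumes "Im \<tau> > 0"
  shows "theta1 \<tau> (x + y) * theta1 \<tau> (x - y)
    = even_theta \<tau> x * odd_theta \<tau> y - odd_theta \<tau> x * even_theta \<tau> y"
proof -
  have ex: "exp (2 * \<i> * of_int k * (x - pi / 2)) = exp (2 * \<i> * of_int k * x) * exp (- \<i> * of_int k * pi)" for k
    by (simp add: exp_add[symmetric] algebra_simps)
  have "exp (- \<i> * of_int k * pi) = 1" if "even k" for k
    using that exp_integer_2pi[of "- of_int (k div 2)"] by (auto elim!: evenE simp: algebra_simps)
  then have "double_term \<tau> (x - pi / 2) k = double_term \<tau> x k" if "even k" for k
    unfolding double_term_def ex using that by simp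
  then have e: "even_theta \<tau> (x - pi / 2) = even_theta \<tau> x"
    unfolding even_theta_def by (intro infsum_cong) auto
  have "exp (- \<i> * of_int k * pi) = - 1" if "odd k" for k
    using that exp_integer_2pi_plus1[of "- of_int (k div 2) - 1"] by (auto elim!: oddE simp: algebra_simps)
  then have "double_term \<tau> (x - pi / 2) k = - double_term \<tau> x k" if "odd k" for k
    unfolding double_term_def ex using that by simp
  then have o: "odd_theta \<tau> (x - pi / 2) = - odd_theta \<tau> x"
    unfolding odd_theta_def infsum_uminus[symmetric] by (intro infsum_cong) auto
  have "x + y - of_real (pi / 2) = (x - pi / 2) + y" "x - y - of_real (pi / 2) = (x - pi / 2) - y"
    by simp_all
  then show ?thesis
    using theta2_product[OF assms, of "x - pi / 2" y] by (simp only: theta1_eq_theta2 e o) simp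
qed

text \<open>
  By \<open>theta1_product\<close> each factor is a \<open>2 \<times> 2\<close> minor of the four vectors \<open>(even_theta, odd_theta)\<close> at
  \<open>a, b, c, d\<close>, and these minors satisfy the Pluecker relation.
\<close>

lemma theta1_three_term:
  assumes "Im \<tau> > 0"
  shows "theta1 \<tau> (a + b) * theta1 \<tau> (a - b) * (theta1 \<tau> (c + d) * theta1 \<tau> (c - d))
       - theta1 \<tau> (a + c) * theta1 \<tau> (a - c) * (theta1 \<tau> (b + d) * theta1 \<tau> (b - d))
       + theta1 \<tau> (a + d) * theta1 \<tau> (a - d) * (theta1 \<tau> (b + c) * theta1 \<tau> (b - c)) = 0"
  unfolding theta1_product[OF assms] by (simp add: algebra_simps)

section \<open>Analyticity and conjugation\<close>

lemma summable_gaussian_nat: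
  assumes "Im \<tau> > 0"
  shows "summable (\<lambda>n. exp (- pi * Im \<tau> * (real n + 1/2)\<^sup>2) * exp ((2 * real n + 1) * R))"
proof -
  have "(\<lambda>k::int. exp (- pi * Im \<tau> / 4 + R) * exp (- (pi * Im \<tau>) * (of_int k)\<^sup>2 + (2 * R - pi * Im \<tau>) * of_int k)) summable_on {0..}"
    by (rule summable_on_subset[OF summable_on_cmult_right[OF summable_on_int_gaussian]]) (use assms in auto)
  then have "(\<lambda>n::nat. exp (- pi * Im \<tau> / 4 + R) * exp (- (pi * Im \<tau>) * (of_int (int n))\<^sup>2 + (2 * R - pi * Im \<tau>) * of_int (int n))) summable_on UNIV"
    by (subst summable_on_reindex_bij_betw[OF bij_int_nonneg])
  moreover have "exp (- pi * Im \<tau> / 4 + R) * exp (- (pi * Im \<tau>) * (of_int (int n))\<^sup>2 + (2 * R - pi * Im \<tau>) * of_int (int n))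
     = exp (- pi * Im \<tau> * (real n + 1/2)\<^sup>2) * exp ((2 * real n + 1) * R)" for n
    by (simp add: exp_add[symmetric] power2_eq_square algebra_simps)
  ultimately show ?thesis using summable_on_imp_summable by simp
qed

lemma holomorphic_theta2:
  assumes "Im \<tau> > 0"
  shows "theta2 \<tau> holomorphic_on UNIV"
proof -
  define f where "f n z = nome_pow \<tau> ((real n + 1/2)\<^sup>2) * cos ((2 * of_nat n + 1) * z)" for n and z :: complex
  have "(\<lambda>z. \<Sum>n. f n z) holomorphic_on UNIV"
  proof (rule holomorphic_uniform_sequence)
    show "(\<lambda>z. \<Sum>i<n. f i z) holomorphic_on UNIV" for n
      unfolding f_def by (intro holomorphic_intros)
    show "\<exists>d>0. cball x d \<subseteq> UNIV \<and> uniform_limit (cball x d) (\<lambda>n z. \<Sum>i<n. f i z) (\<lambda>z. \<Sum>n. f n z) sequentially" for x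
    proof (intro exI[of _ 1] conjI)
      show "uniform_limit (cball x 1) (\<lambda>n z. \<Sum>i<n. f i z) (\<lambda>z. \<Sum>n. f n z) sequentially"
      proof (rule Weierstrass_m_test[OF _ summable_gaussian_nat[OF assms]])
        fix n z assume z: "z \<in> cball x 1"
        have "\<bar>Im (x - z)\<bar> \<le> 1" using z abs_Im_le_cmod[of "x - z"] by (simp add: dist_norm)
        then have "\<bar>Im z\<bar> \<le> \<bar>Im x\<bar> + 1" by simp
        have "norm (cos ((2 * of_nat n + 1) * z)) \<le> exp \<bar>Im ((2 * of_nat n + 1) * z)\<bar>"
          using cmod_cos_le_exp[of 1 "(2 * of_nat n + 1) * z"] by simp
        also have "\<bar>Im ((2 * of_nat n + 1) * z)\<bar> = (2 * real n + 1) * \<bar>Im z\<bar>" by (simp add: abs_mult)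
        also have "\<dots> \<le> (2 * real n + 1) * (\<bar>Im x\<bar> + 1)" 
          using \<open>\<bar>Im z\<bar> \<le> \<bar>Im x\<bar> + 1\<close> by (intro mult_left_mono) auto
        finally show "norm (f n z) \<le> exp (- pi * Im \<tau> * (real n + 1/2)\<^sup>2) * exp ((2 * real n + 1) * (\<bar>Im x\<bar> + 1))"
          by (simp add: f_def norm_mult norm_nome_pow)
      qed
    qed auto
  qed auto
  then show ?thesis
    unfolding theta2_def f_def by (intro holomorphic_intros)
qed

lemma holomorphic_theta1:
  assumes "Im \<tau> > 0"
  shows "theta1 \<tau> holomorphic_on UNIV"
proof -
  have "(theta2 \<tau> \<circ> (\<lambda>z. z - pi / 2)) holomorphic_on UNIV"
    by (rule holomorphic_on_compose_gen[OF _ holomorphic_theta2[OF assms]]) (auto intro!: holomorphic_intros)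
  moreover have "theta2 \<tau> \<circ> (\<lambda>z::complex. z - pi / 2) = theta1 \<tau>"
    by (simp add: fun_eq_iff theta1_eq_theta2)
  ultimately show ?thesis by simp
qed

lemma nome_pow_cnj:
  assumes "Re \<tau> = 1/2"
  shows "cnj (nome_pow \<tau> a) = exp (- \<i> * pi * a) * nome_pow \<tau> a"
proof -
  have "cnj \<tau> = 1 - \<tau>" using assms by (simp add: complex_eq_iff)
  then have "cnj (\<i> * of_real pi * \<tau> * of_real a) = - (\<i> * of_real pi * (1 - \<tau>) * of_real a)"
    by simp
  also have "\<dots> = - \<i> * pi * a + \<i> * of_real pi * \<tau> * of_real a"
    by (simp add: algebra_simps)
  finally have "cnj (\<i> * of_real pi * \<tau> * of_real a) = - \<i> * pi * a + \<i> * of_real pi * \<tau> * of_real a" .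
  then show ?thesis by (simp only: nome_pow_def exp_cnj exp_add)
qed

text \<open>
  For \<open>Re \<tau> = 1/2\<close> conjugating the nome multiplies \<open>q\<close> to the power \<open>(n + 1/2)\<^sup>2\<close> by
  \<open>exp (- \<i>\<pi>(n\<^sup>2 + n + 1/4))\<close>, and \<open>n\<^sup>2 + n\<close> is even. The common eighth root of unity cancels in the quotients
  of theta functions used later, which explains why they have real values on the real line.
\<close>

lemma theta2_cnj:
  assumes "Re \<tau> = 1/2" "Im \<tau> > 0"
  shows "cnj (theta2 \<tau> z) = exp (- \<i> * pi / 4) * theta2 \<tau> (cnj z)"
proof -
  have "cnj (theta2_term \<tau> z n) = exp (- \<i> * pi / 4) * theta2_term \<tau> (cnj z) (- n - 1)" for n
  proof -
    have "exp (- \<i> * pi * of_real ((of_int n + 1/2)\<^sup>2)) = exp (- \<i> * pi / 4) * exp (of_int (- (n * (n + 1) div 2)) * (2 * pi * \<i>))"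
    proof -
      obtain m where m: "n * (n + 1) = 2 * m" by (metis dvdE even_mult_iff even_plus_one_iff)
      then have "of_int n * (of_int n + 1) = (2 * of_int m :: complex)"
        by (metis of_int_1 of_int_add of_int_mult of_int_numeral)
      moreover have "complex_of_real ((of_int n + 1/2)\<^sup>2) = of_int n * (of_int n + 1) + 1/4"
        by (simp add: power2_eq_square field_simps)
      ultimately have sq: "complex_of_real ((of_int n + 1/2)\<^sup>2) = 2 * of_int m + 1/4" by simp
      have "- \<i> * pi * of_real ((of_int n + 1/2)\<^sup>2) = - \<i> * pi / 4 + of_int (- m) * (2 * pi * \<i>)"
        unfolding sq by (simp add: algebra_simps)
      then show ?thesis using m by (simp only: exp_add) simp
    qed
    also have "\<dots> = exp (- \<i> * pi / 4)" 
      using exp_2pi_1_int[of "- (n * (n + 1) div 2)"] by (simp only: of_real_mult of_real_numeral mult_ac mult_1_left mult_1_right)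
    finally have 1: "exp (- \<i> * pi * of_real ((of_int n + 1/2)\<^sup>2)) = exp (- \<i> * pi / 4)" .
    have 2: "(of_int (- n - 1) + 1/2 :: real)\<^sup>2 = (of_int n + 1/2)\<^sup>2" by (simp add: power2_eq_square algebra_simps)
    have 3: "cnj (exp (\<i> * (2 * of_int n + 1) * z)) = exp (\<i> * (2 * of_int (- n - 1) + 1) * cnj z)"
      by (simp add: exp_cnj algebra_simps)
    show ?thesis
      unfolding theta2_term_def complex_cnj_mult nome_pow_cnj[OF assms(1)] 1 2 3 by simp
  qed
  moreover have "bij_betw (\<lambda>n::int. - n - 1) UNIV UNIV"
    by (rule bij_betwI[of _ _ _ "\<lambda>n. - n - 1"]) auto
  then have "infsum (\<lambda>n. theta2_term \<tau> (cnj z) (- n - 1)) UNIV = infsum (theta2_term \<tau> (cnj z)) UNIV"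
    by (rule infsum_reindex_bij_betw)
  ultimately show ?thesis
    unfolding theta2_eq_infsum[OF assms(2)] infsum_cnj[symmetric] by (simp add: infsum_cmult_right')
qed

lemma theta1_cnj:
  assumes "Re \<tau> = 1/2" "Im \<tau> > 0"
  shows "cnj (theta1 \<tau> z) = exp (- \<i> * pi / 4) * theta1 \<tau> (cnj z)"
  using theta2_cnj[OF assms, of "z - pi / 2"] by (simp add: theta1_eq_theta2)

section \<open>Zeros of the first theta function\<close>

lemma theta1_differentiable:
  assumes "Im \<tau> > 0"
  shows "(theta1 \<tau> has_field_derivative deriv (theta1 \<tau>) z) (at z)"
  using holomorphic_theta1[OF assms] by (simp add: holomorphic_derivI)

lemma theta2_differentiable:
  assumes "Im \<tau> > 0"
  shows "(theta2 \<tau> has_field_derivative deriv (theta2 \<tau>) z) (at z)"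
  using holomorphic_theta2[OF assms] by (simp add: holomorphic_derivI)

lemma theta1_DERIV_compose:
  assumes "Im \<tau> > 0" "(g has_field_derivative g') (at z within A)"
  shows "((\<lambda>z. theta1 \<tau> (g z)) has_field_derivative deriv (theta1 \<tau>) (g z) * g') (at z within A)"
  using DERIV_chain2[OF theta1_differentiable[OF assms(1)] assms(2)] .

lemma integral_odd_sine_mult_sin:
  "((\<lambda>t::real. sin ((2 * real n + 1) * t) * sin t) has_integral (if n = 0 then pi else 0)) {0..2 * pi}"
proof (cases "n = 0")
  case True
  have "((\<lambda>t::real. t / 2 - sin (2 * t) / 4) has_vector_derivative sin t * sin t) (at t within {0..2*pi})" for t
  proof -
    have "sin t * sin t = 1/2 - cos (2 * t) / 2" by (simp add: cos_double_sin power2_eq_square diff_divide_distrib)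
    then show ?thesis
      unfolding has_real_derivative_iff_has_vector_derivative[symmetric]
      by (auto intro!: derivative_eq_intros)
  qed
  then have "((\<lambda>t::real. sin t * sin t) has_integral
      ((2 * pi) / 2 - sin (2 * (2 * pi)) / 4 - (0 / 2 - sin (2 * 0) / 4))) {0..2 * pi}"
    by (intro fundamental_theorem_of_calculus) auto
  moreover have "sin (2 * (2 * pi)) = 0" using sin_2npi[of 2] by (simp add: mult.commute)
  ultimately show ?thesis using True by simp
next
  case False
  define F where "F t = sin (2 * real n * t) / (2 * (2 * real n)) - sin ((2 * real n + 2) * t) / (2 * (2 * real n + 2))" for t
  have "(F has_vector_derivative sin ((2 * real n + 1) * t) * sin t) (at t within {0..2*pi})" for t
  proof -
    have "sin ((2 * real n + 1) * t) * sin t = (cos (2 * real n * t) - cos ((2 * real n + 2) * t)) / 2"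
      unfolding sin_times_sin by (simp add: algebra_simps)
    moreover have "(F has_real_derivative (cos (2 * real n * t) - cos ((2 * real n + 2) * t)) / 2) (at t within {0..2*pi})"
    proof -
      have D: "((\<lambda>t. sin (a * t) / (2 * a)) has_real_derivative cos (a * t) / 2) (at t within {0..2*pi})"
        if "a \<noteq> 0" for a
        using that by (auto intro!: derivative_eq_intros)
      show ?thesis
        using DERIV_diff[OF D[of "2 * real n"] D[of "2 * real n + 2"]] False
        by (simp add: F_def[abs_def] diff_divide_distrib)
    qed
    ultimately show ?thesis by (simp only: has_real_derivative_iff_has_vector_derivative)
  qed
  then have "((\<lambda>t. sin ((2 * real n + 1) * t) * sin t) has_integral (F (2 * pi) - F 0)) {0..2 * pi}"
    by (intro fundamental_theorem_of_calculus) auto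
  moreover have "F (2 * pi) = 0"
    using sin_2npi[of "2 * n"] sin_2npi[of "2 * n + 2"] by (simp add: F_def algebra_simps)
  ultimately show ?thesis using False by (simp add: F_def)
qed

text \<open>
  The first Fourier sine coefficient on \<open>[0, 2\<pi>]\<close> is a nonzero multiple of a power of the nome.
\<close>

lemma theta1_nonzero:
  assumes "Im \<tau> > 0"
  shows "\<exists>z. theta1 \<tau> z \<noteq> 0"
proof (rule ccontr)
  assume "\<not> ?thesis"
  then have zero: "theta1 \<tau> z = 0" for z by simp
  define c where "c n = (-1) ^ n * nome_pow \<tau> ((real n + 1/2)\<^sup>2)" for n :: nat
  define f where "f n t = c n * of_real (sin ((2 * real n + 1) * t) * sin t)" for n and t :: real
  have "(\<Sum>n. f n t) = 0" for t
  proof -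
    have "f n t = (-1) ^ n * nome_pow \<tau> ((real n + 1/2)\<^sup>2) * sin ((2 * of_nat n + 1) * of_real t) * of_real (sin t)" for n
    proof -
      have "sin ((2 * of_nat n + 1) * complex_of_real t) = of_real (sin ((2 * real n + 1) * t))"
        by (simp add: sin_of_real[symmetric])
      then show ?thesis by (simp add: f_def c_def)
    qed
    moreover have "summable (\<lambda>n. (-1) ^ n * nome_pow \<tau> ((real n + 1/2)\<^sup>2) * sin ((2 * of_nat n + 1) * complex_of_real t))"
    proof (rule summable_comparison_test'[OF summable_gaussian_nat[OF assms, of 0]])
      fix n
      have "sin ((2 * of_nat n + 1) * complex_of_real t) = of_real (sin ((2 * real n + 1) * t))"
        by (simp add: sin_of_real[symmetric])
      then show "norm ((-1) ^ n * nome_pow \<tau> ((real n + 1/2)\<^sup>2) * sin ((2 * of_nat n + 1) * complex_of_real t))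
          \<le> exp (- pi * Im \<tau> * (real n + 1/2)\<^sup>2) * exp ((2 * real n + 1) * 0)"
        by (simp add: norm_mult norm_power norm_nome_pow mult_left_le)
    qed
    ultimately show ?thesis
      using zero[of "of_real t"] unfolding theta1_def by (simp add: suminf_mult2[symmetric])
  qed
  then have sum0: "(\<lambda>t. \<Sum>n. f n t) = (\<lambda>t. 0)" by (rule ext)
  have ul: "uniform_limit {0..2 * pi} (\<lambda>N t. \<Sum>n<N. f n t) (\<lambda>t. \<Sum>n. f n t) sequentially"
  proof (rule Weierstrass_m_test[OF _ summable_gaussian_nat[OF assms, of 0]])
    fix n t
    have "\<bar>sin ((2 * real n + 1) * t)\<bar> * \<bar>sin t\<bar> \<le> 1 * 1" by (intro mult_mono) auto
    then show "norm (f n t) \<le> exp (- pi * Im \<tau> * (real n + 1/2)\<^sup>2) * exp ((2 * real n + 1) * 0)"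
      by (simp add: f_def c_def norm_mult norm_power norm_nome_pow abs_mult mult_left_le)
  qed
  obtain I J where I: "\<And>N. ((\<lambda>t. \<Sum>n<N. f n t) has_integral I N) {0..2 * pi}"
      and J: "((\<lambda>t. \<Sum>n. f n t) has_integral J) {0..2 * pi}" and IJ: "I \<longlonglongrightarrow> J"
    by (rule uniform_limit_integral[OF ul]) (auto simp: f_def intro!: continuous_intros)
  have "I N = c 0 * pi" if "N > 0" for N
  proof -
    have "(f n has_integral c n * of_real (if n = 0 then pi else 0)) {0..2 * pi}" for n
      unfolding f_def using has_integral_mult_right[OF has_integral_of_real[OF integral_odd_sine_mult_sin[of n]]] .
    then have "((\<lambda>t. \<Sum>n<N. f n t) has_integral (\<Sum>n<N. c n * of_real (if n = 0 then pi else 0))) {0..2 * pi}"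
      by (intro has_integral_sum) auto
    moreover have "(\<Sum>n<N. c n * of_real (if n = 0 then pi else 0)) = c 0 * pi"
      using that by (simp add: if_distrib[of of_real] if_distrib[of "(*) _"] sum.If_cases cong: if_cong)
    ultimately show ?thesis using I has_integral_unique by metis
  qed
  then have "eventually (\<lambda>N. I N = c 0 * pi) sequentially"
    by (auto simp: eventually_sequentially intro!: exI[of _ 1])
  then have "I \<longlonglongrightarrow> c 0 * pi" by (rule tendsto_eventually)
  then have "J = c 0 * pi" using IJ LIMSEQ_unique by blast
  moreover have "J = 0" using J unfolding sum0 by (simp add: has_integral_iff)
  ultimately show False by (simp add: c_def nome_pow_def)
qed

text \<open>
  A zero \<open>z0\<close> makes one product in the three-term identity vanish. What remains says that the quotient
  \<open>\<theta>\<^sub>1(p - z0) \<theta>\<^sub>1(m - z0) / (\<theta>\<^sub>1(p) \<theta>\<^sub>1(m))\<close> depends on \<open>p + m\<close> alone, which forces \<open>\<theta>\<^sub>1(p - z0)\<close> to be an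
  exponential times \<open>\<theta>\<^sub>1(p)\<close>. Comparing the quasi-periods of both sides puts \<open>z0\<close> into the lattice.
\<close>

lemma theta1_zeros:
  fixes \<tau> z0 :: complex
  assumes \<tau>: "Im \<tau> > 0" and z0: "theta1 \<tau> z0 = 0"
  obtains m n :: int where "z0 = of_int m * pi + of_int n * pi * \<tau>"
proof -
  let ?F = "theta1 \<tau>" and ?D = "deriv (theta1 \<tau>)"
  have key: "?F p * ?F m * (?F (p' - z0) * ?F (m' - z0)) = ?F p' * ?F m' * (?F (p - z0) * ?F (m - z0))"
    if "p + m = p' + m'" for p m p' m' :: complex
  proof -
    define x where "x = (p + m) / 2"
    define y where "y = (p - m) / 2"
    define d where "d = (p' - m') / 2"
    have e: "p = x + y" "m = x - y" "p' = x + d" "m' = x - d"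
    proof -
      have m: "m = p' + m' - p" using that by (simp add: algebra_simps)
      show "p = x + y" "m = x - y" "p' = x + d" "m' = x - d"
        by (simp_all add: x_def y_def d_def m field_simps)
    qed
    have z: "?F (x + (z0 - x)) = 0" using z0 by simp
    have o: "?F (z0 - x + d) = - ?F (x - d - z0)" "?F (z0 - x - d) = - ?F (x + d - z0)"
      "?F (y + (z0 - x)) = - ?F (x - y - z0)" "?F (y - (z0 - x)) = ?F (x + y - z0)"
      using theta1_minus[OF \<tau>, of "x - d - z0"] theta1_minus[OF \<tau>, of "x + d - z0"]
        theta1_minus[OF \<tau>, of "x - y - z0"] by (simp_all add: algebra_simps)
    show ?thesis
      using theta1_three_term[OF \<tau>, of x y "z0 - x" d] unfolding e z o by (simp add: mult_ac)
  qed
  have shift: "(\<lambda>p. ?F (p - z0)) holomorphic_on UNIV"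
    by (rule holomorphic_on_compose_gen[OF _ holomorphic_theta1[OF \<tau>], unfolded o_def]) (auto intro!: holomorphic_intros)
  have nbhd: "\<exists>e>0. \<forall>p\<in>ball c e. ?F p \<noteq> 0" if "?F c \<noteq> 0" for c
  proof -
    have "continuous_on UNIV ?F" by (rule holomorphic_on_imp_continuous_on[OF holomorphic_theta1[OF \<tau>]])
    then have "open {p. ?F p \<noteq> 0}"
      using open_Collect_neq[of ?F "\<lambda>_. 0"] by simp
    then show ?thesis using that unfolding open_contains_ball by blast
  qed
  obtain c where c: "?F c \<noteq> 0" "?F (c - z0) \<noteq> 0"
  proof -
    obtain z1 where z1: "?F z1 \<noteq> 0" using theta1_nonzero[OF \<tau>] by blast
    obtain e where e: "e > 0" "\<And>p. p \<in> ball z1 e \<Longrightarrow> ?F p \<noteq> 0" using nbhd[OF z1] by blast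
    have "\<exists>p\<in>ball z1 e. ?F (p - z0) \<noteq> 0"
    proof (rule ccontr)
      assume "\<not> ?thesis"
      then have "\<And>p. p \<in> ball z1 e \<Longrightarrow> ?F (p - z0) = 0" by blast
      moreover have "ball z1 e \<noteq> {}" using e(1) by simp
      ultimately have "?F (z1 + z0 - z0) = 0"
        by (rule analytic_continuation_open[OF open_ball open_UNIV _ connected_UNIV subset_UNIV shift
              holomorphic_on_const _ UNIV_I, rotated])
      then show False using z1 by simp
    qed
    then show ?thesis using e(2) that by blast
  qed
  define \<alpha> where "\<alpha> = ?D (c - z0) / ?F (c - z0) - ?D c / ?F c"
  \<comment> \<open>the derivative of the relation above in the direction that fixes \<open>p + m\<close>, with \<open>m = c\<close>\<close>
  have ode: "?F p * ?D (p - z0) - ?D p * ?F (p - z0) = \<alpha> * ?F p * ?F (p - z0)" for p :: complex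
  proof -
    define L where "L t = ?F p * ?F c * (?F (p + t - z0) * ?F (c - t - z0))" for t
    define R where "R t = ?F (p + t) * ?F (c - t) * (?F (p - z0) * ?F (c - z0))" for t
    have "L = R" unfolding L_def R_def by (intro ext key) simp
    have "(L has_field_derivative ?F p * ?F c * (?D (p - z0) * ?F (c - z0) - ?F (p - z0) * ?D (c - z0))) (at 0)"
      unfolding L_def by (auto intro!: derivative_eq_intros theta1_DERIV_compose[OF \<tau>])
    moreover have "(R has_field_derivative (?D p * ?F c - ?F p * ?D c) * (?F (p - z0) * ?F (c - z0))) (at 0)"
      unfolding R_def by (auto intro!: derivative_eq_intros theta1_DERIV_compose[OF \<tau>] simp: algebra_simps)
    ultimately have "?F p * ?F c * (?D (p - z0) * ?F (c - z0) - ?F (p - z0) * ?D (c - z0))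
        = (?D p * ?F c - ?F p * ?D c) * (?F (p - z0) * ?F (c - z0))"
      using \<open>L = R\<close> DERIV_unique by blast
    then show ?thesis unfolding \<alpha>_def using c by (simp add: field_simps)
  qed
  define H where "H p = ?F (p - z0) * exp (- \<alpha> * p)" for p :: complex
  obtain e where e: "e > 0" "\<And>p. p \<in> ball c e \<Longrightarrow> ?F p \<noteq> 0"
    using nbhd[OF c(1)] by blast
  \<comment> \<open>the equation says that \<open>H/\<theta>\<^sub>1\<close> has derivative \<open>0\<close> where \<open>\<theta>\<^sub>1\<close> does not vanish; the identity theorem
    then removes the restriction to the ball\<close>
  obtain K where K: "H p = K * ?F p" if "p \<in> ball c e" for p
  proof -
    have "((\<lambda>p. H p / ?F p) has_field_derivative 0) (at p within ball c e)" if "p \<in> ball c e" for p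
    proof -
      have "((\<lambda>p. H p / ?F p) has_field_derivative
          ((?D (p - z0) * exp (- \<alpha> * p) + ?F (p - z0) * (exp (- \<alpha> * p) * (- \<alpha>))) * ?F p - H p * ?D p) / (?F p * ?F p)) (at p within ball c e)"
        unfolding H_def using e(2)[OF that]
        by (auto intro!: derivative_eq_intros theta1_DERIV_compose[OF \<tau>])
      moreover have "(?D (p - z0) * exp (- \<alpha> * p) + ?F (p - z0) * (exp (- \<alpha> * p) * (- \<alpha>))) * ?F p - H p * ?D p
          = exp (- \<alpha> * p) * (?F p * ?D (p - z0) - ?D p * ?F (p - z0) - \<alpha> * ?F p * ?F (p - z0))"
        by (simp add: H_def algebra_simps)
      ultimately show ?thesis by (simp add: ode)
    qed
    then obtain K where "H p / ?F p = K" if "p \<in> ball c e" for p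
      using has_field_derivative_zero_constant[of "ball c e" "\<lambda>p. H p / ?F p"] by auto
    then show ?thesis using that e(2) by (metis nonzero_divide_eq_eq)
  qed
  have glob: "?F (p - z0) * exp (- \<alpha> * p) = K * ?F p" for p :: complex
  proof -
    have "H holomorphic_on UNIV"
      unfolding H_def by (intro holomorphic_intros shift)
    moreover have "(\<lambda>p. K * ?F p) holomorphic_on UNIV"
      by (intro holomorphic_intros holomorphic_theta1[OF \<tau>])
    moreover have "ball c e \<noteq> {}" using e(1) by simp
    ultimately have "H p = K * ?F p"
      using analytic_continuation_open[OF open_ball open_UNIV _ connected_UNIV subset_UNIV, of c e H "\<lambda>p. K * ?F p" p] K
      by blast
    then show ?thesis by (simp add: H_def)
  qed
  have Knz: "K \<noteq> 0" using glob[of c] c by auto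
  have gc: "?F (c - z0) * exp (- \<alpha> * c) = K * ?F c" by (rule glob)
  have "exp (- \<alpha> * pi) = 1"
  proof -
    have sh: "?F (c + pi - z0) = - ?F (c - z0)"
      using theta1_add_pi[OF \<tau>, of "c - z0"] by (simp add: algebra_simps)
    have ex: "exp (- \<alpha> * (c + pi)) = exp (- \<alpha> * c) * exp (- \<alpha> * pi)"
      by (simp only: exp_add[symmetric] distrib_left)
    have "?F (c - z0) * exp (- \<alpha> * c) * exp (- \<alpha> * pi) = K * ?F c"
      using glob[of "c + pi"] unfolding sh ex theta1_add_pi[OF \<tau>] by (simp add: mult_ac)
    also have "\<dots> = ?F (c - z0) * exp (- \<alpha> * c)" by (rule gc[symmetric])
    finally have "?F (c - z0) * exp (- \<alpha> * c) * exp (- \<alpha> * pi) = ?F (c - z0) * exp (- \<alpha> * c)" .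
    then show ?thesis using c by simp
  qed
  moreover have "exp (2 * \<i> * z0 - \<alpha> * (pi * \<tau>)) = 1"
  proof -
    define E where "E = exp (- \<i> * pi * \<tau> - 2 * \<i> * c)"
    have e1: "exp (- \<i> * pi * \<tau> - 2 * \<i> * (c - z0)) = E * exp (2 * \<i> * z0)"
      unfolding E_def exp_add[symmetric] by (simp add: algebra_simps)
    have e2: "exp (- \<alpha> * (c + pi * \<tau>)) = exp (- \<alpha> * c) * exp (- \<alpha> * (pi * \<tau>))"
      by (simp only: exp_add[symmetric] distrib_left)
    have e3: "exp (2 * \<i> * z0 - \<alpha> * (pi * \<tau>)) = exp (2 * \<i> * z0) * exp (- \<alpha> * (pi * \<tau>))"
      unfolding exp_add[symmetric] by (simp add: algebra_simps)
    have sh: "?F (c + pi * \<tau> - z0) = - (E * exp (2 * \<i> * z0)) * ?F (c - z0)"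
      using theta1_add_pi_tau[OF \<tau>, of "c - z0"] unfolding e1 by (simp add: algebra_simps)
    have "?F (c + pi * \<tau>) = - E * ?F c"
      using theta1_add_pi_tau[OF \<tau>, of c] by (simp add: E_def)
    with glob[of "c + pi * \<tau>"] have "E * ?F (c - z0) * exp (- \<alpha> * c) * exp (2 * \<i> * z0 - \<alpha> * (pi * \<tau>))
        = E * (K * ?F c)"
      unfolding sh e2 e3 by (simp add: mult_ac)
    then have "E * ?F (c - z0) * exp (- \<alpha> * c) * exp (2 * \<i> * z0 - \<alpha> * (pi * \<tau>))
        = E * ?F (c - z0) * exp (- \<alpha> * c)"
      unfolding gc[symmetric] by simp
    then show ?thesis using c by (simp add: E_def)
  qed
  ultimately obtain k l :: int where k: "- \<alpha> * pi = 2 * of_int k * pi * \<i>" and l: "2 * \<i> * z0 - \<alpha> * (pi * \<tau>) = 0 + 2 * of_int l * pi * \<i>"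
    unfolding exp_zero[symmetric] exp_eq by (auto simp: mult.commute mult.left_commute)
  have "2 * \<i> * z0 = - (- \<alpha> * pi) * \<tau> + 2 * of_int l * pi * \<i>" using l by (simp add: algebra_simps)
  then have "2 * \<i> * z0 = 2 * \<i> * (of_int l * pi + of_int (- k) * pi * \<tau>)"
    unfolding k by (simp add: algebra_simps)
  then have "z0 = of_int l * pi + of_int (- k) * pi * \<tau>"
    by (simp only: mult_cancel_left) simp
  then show ?thesis by (rule that)
qed

section \<open>The family of planar curves\<close>

lemma no_int_multiple_between:
  fixes c :: real and n :: int
  assumes "0 < c" "0 < of_int n * c" "of_int n * c < c"
  shows False
proof -
  have "0 < n" using assms by (auto simp: zero_less_mult_iff)
  moreover have "real_of_int n < 1"
    using assms(3) mult_less_cancel_right_pos[OF assms(1), of "of_int n" 1] by simp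
  ultimately show False by simp
qed

locale planar_family =
  fixes \<tau> :: complex and \<omega> :: real
  assumes Re_\<tau>: "Re \<tau> = 1/2" and Im_\<tau>: "0 < Im \<tau>"
    and \<omega>: "0 < \<omega>" "\<omega> < pi / 4" and crit: "deriv (theta2 \<tau>) \<omega> = 0"
begin

abbreviation "\<theta>\<^sub>1 \<equiv> theta1 \<tau>"
abbreviation "\<theta>\<^sub>2 \<equiv> theta2 \<tau>"

lemma theta1_strip:
  fixes z :: complex
  assumes "0 < Im z" "Im z < pi * Im \<tau>" shows "\<theta>\<^sub>1 z \<noteq> 0"
proof
  assume "\<theta>\<^sub>1 z = 0"
  then obtain m n :: int where z: "z = of_int m * pi + of_int n * pi * \<tau>"
    using theta1_zeros[OF Im_\<tau>] by blast
  then have "Im z = of_int n * (pi * Im \<tau>)" by simp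
  moreover have "0 < pi * Im \<tau>" using Im_\<tau> by simp
  ultimately show False using no_int_multiple_between assms by metis
qed

lemma theta2_strip:
  fixes z :: complex
  assumes "0 < Im z" "Im z < pi * Im \<tau>" shows "\<theta>\<^sub>2 z \<noteq> 0"
  unfolding theta2_eq_theta1 by (rule theta1_strip) (use assms in auto)

lemma theta1_of_real:
  fixes x :: real
  assumes "0 < x" "x < pi" shows "\<theta>\<^sub>1 x \<noteq> 0"
proof
  assume "\<theta>\<^sub>1 x = 0"
  then obtain m n :: int where z: "of_real x = of_int m * pi + of_int n * pi * \<tau>"
    using theta1_zeros[OF Im_\<tau>] by blast
  have "0 = of_int n * (pi * Im \<tau>)" using arg_cong[OF z, of Im] by simp
  then have "n = 0" using Im_\<tau> by simp
  then have "x = of_int m * pi" using arg_cong[OF z, of Re] by simp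
  then show False using no_int_multiple_between[of pi m] assms by simp
qed

text \<open>
  As \<open>Re \<tau> = 1/2\<close>, the lattice points on the imaginary axis are the multiples of \<open>2\<pi> \<i> Im \<tau>\<close>; this is
  where the bound on \<open>w\<close> comes from.
\<close>

lemma theta1_imaginary:
  assumes "0 < w" "w < 2 * pi * Im \<tau>" shows "\<theta>\<^sub>1 (\<i> * of_real w) \<noteq> 0"
proof
  assume "\<theta>\<^sub>1 (\<i> * of_real w) = 0"
  then obtain m n :: int where z: "\<i> * of_real w = of_int m * pi + of_int n * pi * \<tau>"
    using theta1_zeros[OF Im_\<tau>] by blast
  have w: "w = of_int n * (pi * Im \<tau>)" using arg_cong[OF z, of Im] by simp
  have "0 = (of_int m + of_int n / 2) * pi" using arg_cong[OF z, of Re] Re_\<tau> by (simp add: algebra_simps)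
  then have "of_int (2 * m + n) = (0 :: real)" by simp
  then have "n = 2 * (- m)" unfolding of_int_eq_0_iff by presburger
  then have "w = of_int (- m) * (2 * pi * Im \<tau>)" using w by simp
  moreover have "0 < 2 * pi * Im \<tau>" using Im_\<tau> by simp
  ultimately show False using no_int_multiple_between assms by metis
qed

lemma theta2_\<omega>: "\<theta>\<^sub>2 \<omega> \<noteq> 0"
  using theta1_of_real[of "\<omega> + pi / 2"] \<omega> by (simp add: theta2_eq_theta1)

lemma theta1_2\<omega>: "\<theta>\<^sub>1 (2 * of_real \<omega>) \<noteq> 0"
  using theta1_of_real[of "2 * \<omega>"] \<omega> by simp

text \<open>
  The three-term identity at the half-sums \<open>a, b, c, d\<close> that make the arguments of its four constant or
  diagonal factors \<open>2\<omega>\<close>, \<open>X - Y\<close> and \<open>\<omega> \<plusminus> \<pi>/2\<close>.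
\<close>

lemma theta_identity:
  fixes X Y :: complex
  shows "\<theta>\<^sub>2 \<omega> * (\<theta>\<^sub>1 (Y - \<omega>) * \<theta>\<^sub>1 (X + \<omega>) * \<theta>\<^sub>2 (\<omega> - X + Y) - \<theta>\<^sub>1 (X - \<omega>) * \<theta>\<^sub>1 (Y + \<omega>) * \<theta>\<^sub>2 (X - Y + \<omega>))
    = - \<theta>\<^sub>1 (2 * of_real \<omega>) * \<theta>\<^sub>1 (X - Y) * \<theta>\<^sub>2 X * \<theta>\<^sub>2 Y"
proof -
  define a where "a = \<omega> + (X - Y) / 2"
  define b where "b = \<omega> - (X - Y) / 2"
  define c where "c = pi / 2 + (X - Y) / 2"
  define d where "d = (X + Y) / 2"
  have odd: "\<theta>\<^sub>1 (z - pi / 2) = - \<theta>\<^sub>2 z" for z :: complex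
    using theta1_minus[OF Im_\<tau>, of "pi / 2 - z"] theta2_minus[of \<tau> z] by (simp add: theta2_eq_theta1 add.commute)
  have even: "\<theta>\<^sub>1 (pi / 2 - z) = \<theta>\<^sub>2 z" for z :: complex
    using theta2_minus[of \<tau> z] by (simp add: theta2_eq_theta1 add.commute)
  have 1: "a + b = 2 * of_real \<omega>" "a - b = X - Y" "c + d = X + pi / 2" "c - d = pi / 2 - Y"
    "a + c = (\<omega> + X - Y) + pi / 2" "a - c = \<omega> - pi / 2" "b + d = Y + \<omega>" "b - d = - (X - \<omega>)"
    "a + d = X + \<omega>" "a - d = - (Y - \<omega>)" "b + c = \<omega> + pi / 2" "b - c = (\<omega> - X + Y) - pi / 2"
    by (simp_all add: a_def b_def c_def d_def field_simps)
  have 2: "\<theta>\<^sub>1 (\<omega> - pi / 2) = - \<theta>\<^sub>2 \<omega>" using odd[of \<omega>] by simp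
  have 3: "\<theta>\<^sub>1 (\<omega> + pi / 2) = \<theta>\<^sub>2 \<omega>" by (simp add: theta2_eq_theta1)
  have 4: "\<theta>\<^sub>1 (z + pi / 2) = \<theta>\<^sub>2 z" for z :: complex by (simp add: theta2_eq_theta1)
  have 5: "\<omega> + X - Y = X - Y + \<omega>" by simp
  show ?thesis
    using theta1_three_term[OF Im_\<tau>, of a b c d]
    unfolding 1 2 3 4 5 odd even theta1_minus[OF Im_\<tau>]
    by (simp add: algebra_simps)
qed

text \<open>
  The derivative of \<open>theta_identity\<close> in \<open>Y\<close> at \<open>Y = X\<close>, where the terms with \<open>\<theta>\<^sub>2'(\<omega>)\<close> drop out. The left side is
  the numerator of the derivative of \<open>\<theta>\<^sub>1(x - \<omega>)/\<theta>\<^sub>1(x + \<omega>)\<close>, so up to a constant \<open>\<gamma>\<^sub>u\<close> is a perfect square.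
\<close>

lemma theta1_wronskian:
  fixes x :: complex
  shows "(\<theta>\<^sub>2 \<omega>)\<^sup>2 * (deriv \<theta>\<^sub>1 (x - \<omega>) * \<theta>\<^sub>1 (x + \<omega>) - \<theta>\<^sub>1 (x - \<omega>) * deriv \<theta>\<^sub>1 (x + \<omega>))
    = \<theta>\<^sub>1 (2 * of_real \<omega>) * deriv \<theta>\<^sub>1 0 * (\<theta>\<^sub>2 x)\<^sup>2"
proof -
  note D1 = theta1_DERIV_compose[OF Im_\<tau>]
  note D2 = DERIV_chain2[OF theta2_differentiable[OF Im_\<tau>]]
  define L where "L Y = \<theta>\<^sub>2 \<omega> * (\<theta>\<^sub>1 (Y - \<omega>) * \<theta>\<^sub>1 (x + \<omega>) * \<theta>\<^sub>2 (\<omega> - x + Y) - \<theta>\<^sub>1 (x - \<omega>) * \<theta>\<^sub>1 (Y + \<omega>) * \<theta>\<^sub>2 (x - Y + \<omega>))" for Y :: complex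
  define R where "R Y = - \<theta>\<^sub>1 (2 * of_real \<omega>) * \<theta>\<^sub>1 (x - Y) * \<theta>\<^sub>2 x * \<theta>\<^sub>2 Y" for Y :: complex
  have "L = R" by (rule ext) (simp add: L_def R_def theta_identity)
  have "(L has_field_derivative \<theta>\<^sub>2 \<omega> * ((deriv \<theta>\<^sub>1 (x - \<omega>) * \<theta>\<^sub>1 (x + \<omega>) - \<theta>\<^sub>1 (x - \<omega>) * deriv \<theta>\<^sub>1 (x + \<omega>)) * \<theta>\<^sub>2 \<omega>)) (at x)"
    unfolding L_def
    by (rule derivative_eq_intros D1 D2 refl)+ (simp add: crit algebra_simps)
  moreover have "(R has_field_derivative \<theta>\<^sub>1 (2 * of_real \<omega>) * deriv \<theta>\<^sub>1 0 * (\<theta>\<^sub>2 x)\<^sup>2) (at x)"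
    unfolding R_def
    by (rule derivative_eq_intros D1 D2 theta2_differentiable[OF Im_\<tau>] refl)+ (simp add: theta1_0 power2_eq_square)
  ultimately show ?thesis
    unfolding \<open>L = R\<close> using DERIV_unique by (fastforce simp: power2_eq_square algebra_simps)
qed

text \<open>
  Otherwise the Wronskian vanishes identically, so \<open>\<theta>\<^sub>1(x - \<omega>)\<close> is a constant multiple of \<open>\<theta>\<^sub>1(x + \<omega>)\<close>
  near the zero \<open>x = \<omega>\<close> of the former, where the latter does not vanish.
\<close>

lemma deriv_theta1_0: "deriv \<theta>\<^sub>1 0 \<noteq> 0"
proof
  assume "deriv \<theta>\<^sub>1 0 = 0"
  then have W: "deriv \<theta>\<^sub>1 (x - \<omega>) * \<theta>\<^sub>1 (x + \<omega>) - \<theta>\<^sub>1 (x - \<omega>) * deriv \<theta>\<^sub>1 (x + \<omega>) = 0" for x :: complex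
    using theta1_wronskian[of x] theta2_\<omega> by simp
  \<comment> \<open>on this interval \<open>\<theta>\<^sub>1(x + \<omega>)\<close> has no zeros, and it contains both \<open>\<omega>\<close> and \<open>\<omega>/2\<close>\<close>
  define S where "S = {0<..<pi - 2 * \<omega>}"
  have S: "convex S" "\<omega> / 2 \<in> S" "\<omega> \<in> S" using \<omega> by (auto simp: S_def)
  have "((\<lambda>x::real. \<theta>\<^sub>1 (complex_of_real x - \<omega>) / \<theta>\<^sub>1 (complex_of_real x + \<omega>)) has_vector_derivative 0) (at x within S)" if "x \<in> S" for x
  proof (rule has_vector_derivative_real_field)
    have nz: "\<theta>\<^sub>1 (complex_of_real x + of_real \<omega>) \<noteq> 0"
      using theta1_of_real[of "x + \<omega>"] that \<omega> by (auto simp: S_def)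
    have "((\<lambda>z. \<theta>\<^sub>1 (z - \<omega>) / \<theta>\<^sub>1 (z + \<omega>)) has_field_derivative
        (deriv \<theta>\<^sub>1 (complex_of_real x - \<omega>) * \<theta>\<^sub>1 (complex_of_real x + \<omega>) - \<theta>\<^sub>1 (complex_of_real x - \<omega>) * deriv \<theta>\<^sub>1 (complex_of_real x + \<omega>))
          / (\<theta>\<^sub>1 (complex_of_real x + \<omega>) * \<theta>\<^sub>1 (complex_of_real x + \<omega>))) (at (of_real x))"
      by (rule derivative_eq_intros theta1_DERIV_compose[OF Im_\<tau>] nz refl)+ simp
    then show "((\<lambda>z. \<theta>\<^sub>1 (z - \<omega>) / \<theta>\<^sub>1 (z + \<omega>)) has_field_derivative 0) (at (of_real x))"
      unfolding W by simp
  qed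
  then obtain k where "\<theta>\<^sub>1 (complex_of_real x - \<omega>) / \<theta>\<^sub>1 (complex_of_real x + \<omega>) = k" if "x \<in> S" for x
    using has_vector_derivative_zero_constant[OF S(1)] by blast
  then have "\<theta>\<^sub>1 (complex_of_real (\<omega> / 2) - \<omega>) / \<theta>\<^sub>1 (complex_of_real (\<omega> / 2) + \<omega>) = \<theta>\<^sub>1 (complex_of_real \<omega> - \<omega>) / \<theta>\<^sub>1 (complex_of_real \<omega> + \<omega>)"
    using S by metis
  also have "\<dots> = 0" by (simp add: theta1_0)
  finally have "\<theta>\<^sub>1 (complex_of_real (\<omega> / 2) - \<omega>) = 0 \<or> \<theta>\<^sub>1 (complex_of_real (\<omega> / 2) + \<omega>) = 0" by simp
  moreover have "complex_of_real (\<omega> / 2) - of_real \<omega> = - complex_of_real (\<omega> / 2)" by simp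
  ultimately have "\<theta>\<^sub>1 (of_real (\<omega> / 2)) = 0 \<or> \<theta>\<^sub>1 (of_real (\<omega> / 2 + \<omega>)) = 0"
    by (metis theta1_minus[OF Im_\<tau>] neg_equal_0_iff_equal of_real_add)
  then show False
    using theta1_of_real[of "\<omega> / 2"] theta1_of_real[of "\<omega> / 2 + \<omega>"] \<omega> by simp
qed

abbreviation unit8 :: complex where "unit8 \<equiv> exp (- \<i> * pi / 4)"

lemma cmod_unit8: "cmod unit8 = 1" by simp

lemma deriv_theta1_cnj: "cnj (deriv \<theta>\<^sub>1 0) = unit8 * deriv \<theta>\<^sub>1 0"
proof -
  have "((cnj \<circ> \<theta>\<^sub>1 \<circ> cnj) has_field_derivative cnj (deriv \<theta>\<^sub>1 (cnj 0))) (at 0)"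
    by (rule has_field_derivative_cnj_cnj) (rule theta1_differentiable[OF Im_\<tau>])
  moreover have "cnj \<circ> \<theta>\<^sub>1 \<circ> cnj = (\<lambda>z. unit8 * \<theta>\<^sub>1 z)"
    by (simp add: fun_eq_iff theta1_cnj[OF Re_\<tau> Im_\<tau>])
  moreover have "((\<lambda>z. unit8 * \<theta>\<^sub>1 z) has_field_derivative unit8 * deriv \<theta>\<^sub>1 0) (at 0)"
    by (rule DERIV_cmult) (rule theta1_differentiable[OF Im_\<tau>])
  ultimately show ?thesis using DERIV_unique by (metis complex_cnj_zero)
qed

lemma of_real_Re: "cnj z = z \<Longrightarrow> complex_of_real (Re z) = z"
  by (simp add: complex_eq_iff)

lemma of_real_U: "complex_of_real (const_U \<tau> \<omega>) = - (1/2) * (deriv \<theta>\<^sub>1 0 / (\<theta>\<^sub>2 \<omega>)\<^sup>2) * \<theta>\<^sub>1 (2 * of_real \<omega>)"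
  unfolding const_U_def
proof (subst of_real_Re)
  have "cnj (\<theta>\<^sub>2 \<omega>) = unit8 * \<theta>\<^sub>2 \<omega>" "cnj (\<theta>\<^sub>1 (2 * of_real \<omega>)) = unit8 * \<theta>\<^sub>1 (2 * of_real \<omega>)"
    using theta2_cnj[OF Re_\<tau> Im_\<tau>, of "of_real \<omega>"] theta1_cnj[OF Re_\<tau> Im_\<tau>, of "2 * of_real \<omega>"] by auto
  then show "cnj (- (1/2) * (deriv \<theta>\<^sub>1 0 / (\<theta>\<^sub>2 \<omega>)\<^sup>2) * \<theta>\<^sub>1 (of_real (2 * \<omega>))) = - (1/2) * (deriv \<theta>\<^sub>1 0 / (\<theta>\<^sub>2 \<omega>)\<^sup>2) * \<theta>\<^sub>1 (of_real (2 * \<omega>))"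
    by (simp add: deriv_theta1_cnj power2_eq_square)
qed simp

lemma of_real_U1': "complex_of_real (const_U1' \<tau> \<omega>) = (1/2) * ((deriv \<theta>\<^sub>1 0)\<^sup>2 / (\<theta>\<^sub>2 \<omega>)\<^sup>2)"
  unfolding const_U1'_def
proof (subst of_real_Re)
  have "cnj (\<theta>\<^sub>2 \<omega>) = unit8 * \<theta>\<^sub>2 \<omega>"
    using theta2_cnj[OF Re_\<tau> Im_\<tau>, of "of_real \<omega>"] by auto
  then show "cnj ((1/2) * ((deriv \<theta>\<^sub>1 0)\<^sup>2 / (\<theta>\<^sub>2 \<omega>)\<^sup>2)) = (1/2) * ((deriv \<theta>\<^sub>1 0)\<^sup>2 / (\<theta>\<^sub>2 \<omega>)\<^sup>2)"
    by (simp add: deriv_theta1_cnj power2_eq_square)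
qed simp

lemma U_nz: "const_U \<tau> \<omega> \<noteq> 0"
proof -
  have "complex_of_real (const_U \<tau> \<omega>) \<noteq> 0"
    unfolding of_real_U using deriv_theta1_0 theta2_\<omega> theta1_2\<omega> by simp
  then show ?thesis by simp
qed

lemma U1'_nz: "const_U1' \<tau> \<omega> \<noteq> 0"
proof -
  have "complex_of_real (const_U1' \<tau> \<omega>) \<noteq> 0"
    unfolding of_real_U1' using deriv_theta1_0 theta2_\<omega> by simp
  then show ?thesis by simp
qed

end

lemma Re_mult_cnj_has_real_derivative:
  assumes "(a has_vector_derivative a') (at t)" "(b has_vector_derivative b') (at t)"
  shows "((\<lambda>t. Re (a t * cnj (b t))) has_real_derivative Re (a' * cnj (b t)) + Re (a t * cnj b')) (at t)"
proof -
  have "((\<lambda>t. a t * cnj (b t)) has_vector_derivative a t * cnj b' + a' * cnj (b t)) (at t)"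
    by (intro has_vector_derivative_mult has_vector_derivative_cnj assms)
  then show ?thesis by (simp add: has_vector_derivative_complex_iff add.commute)
qed

lemma Im_mult_cnj_has_real_derivative:
  assumes "(a has_vector_derivative a') (at t)" "(b has_vector_derivative b') (at t)"
  shows "((\<lambda>t. Im (a t * cnj (b t))) has_real_derivative Im (a' * cnj (b t)) + Im (a t * cnj b')) (at t)"
proof -
  have "((\<lambda>t. a t * cnj (b t)) has_vector_derivative a t * cnj b' + a' * cnj (b t)) (at t)"
    by (intro has_vector_derivative_mult has_vector_derivative_cnj assms)
  then show ?thesis by (simp add: has_vector_derivative_complex_iff add.commute)
qed

context planar_family
begin

abbreviation "U \<equiv> const_U \<tau> \<omega>"
abbreviation "\<gamma> \<equiv> planar_curve \<tau> \<omega>"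

definition strip :: "complex set" where "strip = {x. 0 < Im x \<and> Im x < pi * Im \<tau>}"

lemma open_strip: "open strip"
proof -
  have "strip = {x. 0 < Im x} \<inter> {x. Im x < pi * Im \<tau>}" by (auto simp: strip_def)
  then show ?thesis by (auto intro!: open_Int open_Collect_less continuous_intros)
qed

definition \<eta> :: "complex \<Rightarrow> complex" where "\<eta> x = \<theta>\<^sub>2 x / \<theta>\<^sub>1 (x + \<omega>)"

text \<open>
  In this variable the zero and the pole of the planar curve lie at \<open>\<plusminus>\<omega>\<close>, and the curve \<open>u = \<omega>\<close> becomes the
  imaginary axis, where conjugation is \<open>x \<mapsto> -x\<close>.
\<close>

definition node :: "real \<Rightarrow> real \<Rightarrow> complex" where
  "node u w = (of_real u + \<i> * of_real w - of_real \<omega>) / 2"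

definition curve_u :: "real \<Rightarrow> real \<Rightarrow> complex" where
  "curve_u u w = - \<i> * (\<eta> (node u w))\<^sup>2"

definition height :: "real set" where "height = {0<..<2 * pi * Im \<tau>}"

lemma node_strip: "w \<in> height \<Longrightarrow> node u w \<in> strip"
  by (auto simp: height_def strip_def node_def)

lemma theta1_shift_strip: "x \<in> strip \<Longrightarrow> \<theta>\<^sub>1 (x + of_real a) \<noteq> 0"
  by (rule theta1_strip) (auto simp: strip_def)

lemma theta2_in_strip: "x \<in> strip \<Longrightarrow> \<theta>\<^sub>2 x \<noteq> 0"
  by (rule theta2_strip) (auto simp: strip_def)

lemma \<eta>_nz: "x \<in> strip \<Longrightarrow> \<eta> x \<noteq> 0"
  using theta1_shift_strip[of x \<omega>] theta2_in_strip[of x] by (simp add: \<eta>_def)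

lemma curve_u_nz: "w \<in> height \<Longrightarrow> curve_u u w \<noteq> 0"
  using \<eta>_nz[OF node_strip] by (simp add: curve_u_def)

lemma \<eta>_holomorphic: "\<eta> holomorphic_on strip"
proof -
  have "(\<lambda>x. \<theta>\<^sub>1 (x + \<omega>)) holomorphic_on strip"
    by (rule holomorphic_on_compose_gen[OF _ holomorphic_theta1[OF Im_\<tau>], unfolded o_def]) (auto intro!: holomorphic_intros)
  moreover have "\<theta>\<^sub>2 holomorphic_on strip"
    using holomorphic_theta2[OF Im_\<tau>] holomorphic_on_subset by blast
  ultimately show ?thesis
    unfolding \<eta>_def using theta1_shift_strip[of _ \<omega>] by (intro holomorphic_intros) auto
qed

lemma planar_curve_eq: "\<gamma> u w = (\<i> / U) * (\<theta>\<^sub>1 (node u w - \<omega>) / \<theta>\<^sub>1 (node u w + \<omega>))"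
proof -
  have 1: "(of_real u + \<i> * of_real w - 3 * of_real \<omega>) / 2 = node u w - of_real \<omega>"
    "(of_real u + \<i> * of_real w + of_real \<omega>) / 2 = node u w + of_real \<omega>"
    by (simp_all add: node_def field_simps)
  have 2: "- \<i> * (2 * (\<theta>\<^sub>2 \<omega>)\<^sup>2 / (deriv \<theta>\<^sub>1 0 * \<theta>\<^sub>1 (2 * of_real \<omega>))) = \<i> / U"
    unfolding of_real_U using deriv_theta1_0 theta1_2\<omega> theta2_\<omega> by (simp add: field_simps)
  have "\<gamma> u w = - \<i> * (2 * (\<theta>\<^sub>2 \<omega>)\<^sup>2 / (deriv \<theta>\<^sub>1 0 * \<theta>\<^sub>1 (2 * of_real \<omega>)))
      * (\<theta>\<^sub>1 ((of_real u + \<i> * of_real w - 3 * of_real \<omega>) / 2) / \<theta>\<^sub>1 ((of_real u + \<i> * of_real w + of_real \<omega>) / 2))"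
    by (simp add: planar_curve_def)
  then show ?thesis unfolding 1 2 .
qed

lemma quotient_has_field_derivative:
  assumes "x \<in> strip"
  shows "((\<lambda>x. \<theta>\<^sub>1 (x - \<omega>) / \<theta>\<^sub>1 (x + \<omega>)) has_field_derivative - 2 * U * (\<eta> x)\<^sup>2) (at x)"
proof -
  let ?N = "deriv \<theta>\<^sub>1 (x - \<omega>) * \<theta>\<^sub>1 (x + \<omega>) - \<theta>\<^sub>1 (x - \<omega>) * deriv \<theta>\<^sub>1 (x + \<omega>)"
  have nz: "\<theta>\<^sub>1 (x + \<omega>) \<noteq> 0" using theta1_shift_strip[OF assms] .
  have "((\<lambda>x. \<theta>\<^sub>1 (x - \<omega>) / \<theta>\<^sub>1 (x + \<omega>)) has_field_derivative ?N / (\<theta>\<^sub>1 (x + \<omega>) * \<theta>\<^sub>1 (x + \<omega>))) (at x)"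
    by (rule derivative_eq_intros theta1_DERIV_compose[OF Im_\<tau>] nz refl)+ simp
  moreover have "?N = \<theta>\<^sub>1 (2 * of_real \<omega>) * deriv \<theta>\<^sub>1 0 * (\<theta>\<^sub>2 x)\<^sup>2 / (\<theta>\<^sub>2 \<omega>)\<^sup>2"
    unfolding theta1_wronskian[symmetric] using theta2_\<omega> by simp
  ultimately show ?thesis
    by (simp add: \<eta>_def of_real_U power_divide power2_eq_square mult_ac)
qed

lemma node_has_vector_derivative_u: "((\<lambda>u. node u w) has_vector_derivative 1/2) (at u)"
  unfolding node_def by (auto intro!: derivative_eq_intros)

lemma node_has_vector_derivative_w: "((\<lambda>w. node u w) has_vector_derivative \<i>/2) (at w)"
  unfolding node_def by (auto intro!: derivative_eq_intros)

lemma planar_curve_has_vector_derivative_u: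
  assumes "w \<in> height"
  shows "((\<lambda>u. \<gamma> u w) has_vector_derivative curve_u u w) (at u)"
proof -
  have "((\<lambda>u. (\<i> / U) * (\<theta>\<^sub>1 (node u w - \<omega>) / \<theta>\<^sub>1 (node u w + \<omega>))) has_vector_derivative
      (\<i> / U) * (1/2 * (- 2 * U * (\<eta> (node u w))\<^sup>2))) (at u)"
    using field_vector_diff_chain_at[OF node_has_vector_derivative_u quotient_has_field_derivative[OF node_strip[OF assms]]]
    by (intro has_vector_derivative_mult_right) (simp add: o_def)
  then show ?thesis using U_nz by (simp add: planar_curve_eq curve_u_def)
qed

lemma planar_curve_has_vector_derivative_w:
  assumes "w \<in> height"
  shows "((\<lambda>w. \<gamma> u w) has_vector_derivative \<i> * curve_u u w) (at w)"
proof -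
  have "((\<lambda>w. (\<i> / U) * (\<theta>\<^sub>1 (node u w - \<omega>) / \<theta>\<^sub>1 (node u w + \<omega>))) has_vector_derivative
      (\<i> / U) * (\<i>/2 * (- 2 * U * (\<eta> (node u w))\<^sup>2))) (at w)"
    using field_vector_diff_chain_at[OF node_has_vector_derivative_w quotient_has_field_derivative[OF node_strip[OF assms]]]
    by (intro has_vector_derivative_mult_right) (simp add: o_def)
  then show ?thesis using U_nz by (simp add: planar_curve_eq curve_u_def)
qed

lemma planar_curve_periodic: "\<gamma> (u + 2 * pi) w = \<gamma> u w"
proof -
  have "node (u + 2 * pi) w - \<omega> = (node u w - \<omega>) + pi" "node (u + 2 * pi) w + \<omega> = (node u w + \<omega>) + pi"
    by (simp_all add: node_def field_simps)
  then show ?thesis unfolding planar_curve_eq by (simp only: theta1_add_pi[OF Im_\<tau>]) simp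
qed

lemma curve_u_periodic: "curve_u (u + 2 * pi) w = curve_u u w"
proof -
  have "node (u + 2 * pi) w = node u w + pi" "node u w + pi + \<omega> = (node u w + \<omega>) + pi"
    by (simp_all add: node_def field_simps)
  then show ?thesis
    unfolding curve_u_def \<eta>_def by (simp only: theta1_add_pi[OF Im_\<tau>] theta2_add_pi[OF Im_\<tau>]) simp
qed

lemma exp_metric_h:
  assumes "w \<in> height"
  shows "exp (metric_h \<tau> \<omega> u w) = cmod (curve_u u w)"
  using curve_u_nz[OF assms]
  by (simp add: metric_h_def vector_derivative_at[OF planar_curve_has_vector_derivative_u[OF assms]])

lemma exp_minus_2_metric_h:
  assumes "w \<in> height"
  shows "exp (- 2 * metric_h \<tau> \<omega> u w) = 1 / (cmod (curve_u u w))\<^sup>2"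
proof -
  have "exp (- 2 * metric_h \<tau> \<omega> u w) = 1 / (exp (metric_h \<tau> \<omega> u w))\<^sup>2"
    by (simp add: exp_minus power2_eq_square exp_add[symmetric] inverse_eq_divide[symmetric] del: exp_add)
  then show ?thesis by (simp only: exp_metric_h[OF assms])
qed

lemma s_of_w_eq:
  assumes "w \<in> height"
  shows "s_of_w \<tau> \<omega> w = 1 / cmod (curve_u \<omega> w)"
  by (simp only: s_of_w_def exp_minus exp_metric_h[OF assms] inverse_eq_divide)

lemma \<eta>_cnj: "cnj (\<eta> x) = \<eta> (cnj x)"
  by (simp add: \<eta>_def theta1_cnj[OF Re_\<tau> Im_\<tau>] theta2_cnj[OF Re_\<tau> Im_\<tau>])

lemma planar_curve_cnj:
  "cnj (\<gamma> u w) = (- \<i> / U) * (\<theta>\<^sub>1 (cnj (node u w) - \<omega>) / \<theta>\<^sub>1 (cnj (node u w) + \<omega>))"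
  by (simp add: planar_curve_eq theta1_cnj[OF Re_\<tau> Im_\<tau>])

text \<open>
  With \<open>X\<close> the node and \<open>Y\<close> its conjugate, \<open>X - Y = \<i> w\<close>, so the real part on the left is the left side of
  \<open>theta_identity\<close> divided by theta functions. Since \<open>\<bar>\<gamma>\<^sub>u\<bar> = \<bar>\<eta>\<bar>\<^sup>2\<close>, the identity says that \<open>f\<^sub>u\<close> and \<open>f\<^sub>v\<close> have
  equal length.
\<close>

lemma isothermic_identity:
  assumes "w \<in> height"
  shows "2 * Re (\<gamma> u w * cnj (W1 \<tau> \<omega> w)) = (cmod (\<eta> (node u w)))\<^sup>2"
proof -
  define X where "X = node u w"
  define y where "y = \<i> * complex_of_real w"
  define c where "c = deriv \<theta>\<^sub>1 0 / (2 * \<theta>\<^sub>2 \<omega>)"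
  have nz: "\<theta>\<^sub>1 (X + \<omega>) \<noteq> 0" using theta1_shift_strip[OF node_strip[OF assms]] by (simp add: X_def)
  have "cnj (\<theta>\<^sub>1 (X + \<omega>)) \<noteq> 0" using nz by simp
  then have nz': "\<theta>\<^sub>1 (cnj X + \<omega>) \<noteq> 0" by (simp add: theta1_cnj[OF Re_\<tau> Im_\<tau>])
  have nzy: "\<theta>\<^sub>1 y \<noteq> 0" using theta1_imaginary[of w] assms by (simp add: y_def height_def)
  have XY: "X - cnj X = y" by (simp add: X_def node_def y_def complex_eq_iff)
  have e: "of_real \<omega> - X + cnj X = of_real \<omega> - y" "X - cnj X + of_real \<omega> = of_real \<omega> + y"
    by (simp_all add: XY[symmetric])
  have c_cnj: "cnj c = c"
    using theta2_cnj[OF Re_\<tau> Im_\<tau>, of "of_real \<omega>"] by (simp add: c_def deriv_theta1_cnj)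
  have W: "W1 \<tau> \<omega> w = \<i> * c * (\<theta>\<^sub>2 (\<omega> - y) / \<theta>\<^sub>1 y)"
    by (simp add: W1_def c_def y_def)
  have W': "cnj (W1 \<tau> \<omega> w) = \<i> * c * (\<theta>\<^sub>2 (\<omega> + y) / \<theta>\<^sub>1 y)"
  proof -
    have "cnj y = - y" by (simp add: y_def)
    then show ?thesis
      unfolding W by (simp add: c_cnj theta1_cnj[OF Re_\<tau> Im_\<tau>] theta2_cnj[OF Re_\<tau> Im_\<tau>] theta1_minus[OF Im_\<tau>])
  qed
  have cU: "c * \<theta>\<^sub>1 (2 * of_real \<omega>) / \<theta>\<^sub>2 \<omega> = - U"
    by (simp add: c_def of_real_U power2_eq_square)
  let ?B = "\<theta>\<^sub>1 (cnj X - \<omega>) * \<theta>\<^sub>1 (X + \<omega>) * \<theta>\<^sub>2 (\<omega> - y) - \<theta>\<^sub>1 (X - \<omega>) * \<theta>\<^sub>1 (cnj X + \<omega>) * \<theta>\<^sub>2 (\<omega> + y)"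
  have B: "?B = - \<theta>\<^sub>1 (2 * of_real \<omega>) * \<theta>\<^sub>1 y * \<theta>\<^sub>2 X * \<theta>\<^sub>2 (cnj X) / \<theta>\<^sub>2 \<omega>"
    using theta_identity[of "cnj X" X] theta2_\<omega> unfolding e XY by (simp add: field_simps)
  have "\<gamma> u w * cnj (W1 \<tau> \<omega> w) + cnj (\<gamma> u w) * W1 \<tau> \<omega> w
      = (c / U) * (?B / (\<theta>\<^sub>1 y * \<theta>\<^sub>1 (X + \<omega>) * \<theta>\<^sub>1 (cnj X + \<omega>)))"
    unfolding W' planar_curve_cnj X_def[symmetric] unfolding W planar_curve_eq X_def[symmetric]
    using nz nz' nzy U_nz by (simp add: field_simps)
  also have "\<dots> = - (c * \<theta>\<^sub>1 (2 * of_real \<omega>) / \<theta>\<^sub>2 \<omega>) / U * (\<theta>\<^sub>2 X / \<theta>\<^sub>1 (X + \<omega>)) * (\<theta>\<^sub>2 (cnj X) / \<theta>\<^sub>1 (cnj X + \<omega>))"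
    unfolding B using nzy by (simp add: mult_ac)
  also have "\<dots> = \<eta> X * cnj (\<eta> X)"
    unfolding cU \<eta>_cnj using U_nz by (simp add: \<eta>_def)
  also have "\<dots> = of_real ((cmod (\<eta> X))\<^sup>2)" by (rule complex_norm_square[symmetric])
  finally have "\<gamma> u w * cnj (W1 \<tau> \<omega> w) + cnj (\<gamma> u w * cnj (W1 \<tau> \<omega> w)) = of_real ((cmod (\<eta> X))\<^sup>2)"
    by simp
  then have "of_real (2 * Re (\<gamma> u w * cnj (W1 \<tau> \<omega> w))) = complex_of_real ((cmod (\<eta> X))\<^sup>2)"
    by (simp only: complex_add_cnj)
  then show ?thesis by (simp only: of_real_eq_iff X_def)
qed

text \<open>
  The quotient is an even function of the node, and real under conjugation; reflecting \<open>u\<close> in \<open>\<omega>\<close> amounts to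
  conjugating and negating the node.
\<close>

lemma quotient_symmetric:
  assumes "w \<in> height"
  shows "Im (\<gamma> (\<omega> + t) w / curve_u (\<omega> + t) w) = - Im (\<gamma> (\<omega> - t) w / curve_u (\<omega> - t) w)"
proof -
  define G where "G x = - (1 / U) * (\<theta>\<^sub>1 (x - \<omega>) * \<theta>\<^sub>1 (x + \<omega>) / (\<theta>\<^sub>2 x)\<^sup>2)" for x :: complex
  have eq: "\<gamma> u w / curve_u u w = G (node u w)" for u
    using theta1_shift_strip[OF node_strip[OF assms], of u \<omega>] theta2_in_strip[OF node_strip[OF assms], of u]
    by (simp add: planar_curve_eq curve_u_def \<eta>_def G_def field_simps power2_eq_square)
  have ev: "G (- x) = G x" for x
  proof -
    have "- x - of_real \<omega> = - (x + of_real \<omega>)" "- x + of_real \<omega> = - (x - of_real \<omega>)" by simp_all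
    then show ?thesis by (simp only: G_def theta1_minus[OF Im_\<tau>] theta2_minus) simp
  qed
  have cn: "cnj (G x) = G (cnj x)" for x
    by (simp add: G_def theta1_cnj[OF Re_\<tau> Im_\<tau>] theta2_cnj[OF Re_\<tau> Im_\<tau>] power2_eq_square)
  have nd: "cnj (node (\<omega> + t) w) = - node (\<omega> - t) w"
    by (simp add: node_def field_simps)
  have "cnj (G (node (\<omega> + t) w)) = G (node (\<omega> - t) w)" unfolding cn nd ev ..
  from arg_cong[OF this, of Im] show ?thesis unfolding eq by simp
qed

lemma node_\<omega>: "node \<omega> w = \<i> * of_real (w / 2)" by (simp add: node_def)

text \<open>
  On \<open>u = \<omega>\<close> numerator and denominator of the curve have conjugate arguments up to sign. Hence the curve moves on a
  circle about the origin as \<open>w\<close> varies. By the Cauchy-Riemann equations \<open>\<gamma>\<^sub>u\<close> is orthogonal to this circle, hence radial.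
\<close>

lemma
  assumes "w \<in> height"
  shows cmod_planar_curve_\<omega>: "cmod (\<gamma> \<omega> w) = 1 / \<bar>U\<bar>"
    and curve_u_\<omega>: "curve_u \<omega> w = of_real (U / s_of_w \<tau> \<omega> w) * \<gamma> \<omega> w"
proof -
  define x where "x = node \<omega> w"
  have x: "x \<in> strip" "cnj x = - x"
    using node_strip[OF assms] by (simp_all only: x_def) (simp add: node_\<omega>)
  have nz: "\<theta>\<^sub>1 (x + \<omega>) \<noteq> 0" "\<theta>\<^sub>1 (x - \<omega>) \<noteq> 0"
    using theta1_shift_strip[OF x(1), of \<omega>] theta1_shift_strip[OF x(1), of "- \<omega>"] by simp_all
  have m: "- x - of_real \<omega> = - (x + of_real \<omega>)" "- x + of_real \<omega> = - (x - of_real \<omega>)" by simp_all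
  have "cmod (cnj (\<theta>\<^sub>1 (x - \<omega>))) = cmod (\<theta>\<^sub>1 (x + \<omega>))"
    by (simp only: theta1_cnj[OF Re_\<tau> Im_\<tau>] norm_mult cmod_unit8 complex_cnj_diff x(2) complex_cnj_complex_of_real m
        theta1_minus[OF Im_\<tau>] norm_minus_cancel mult_1_left)
  then show "cmod (\<gamma> \<omega> w) = 1 / \<bar>U\<bar>"
    using nz by (simp add: planar_curve_eq norm_mult norm_divide flip: x_def)
  have "complex_of_real ((cmod (\<eta> x))\<^sup>2) = \<eta> x * \<eta> (- x)"
    unfolding complex_norm_square \<eta>_cnj x(2) ..
  also have "\<dots> = - (\<theta>\<^sub>2 x)\<^sup>2 / (\<theta>\<^sub>1 (x + \<omega>) * \<theta>\<^sub>1 (x - \<omega>))"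
    unfolding \<eta>_def m theta1_minus[OF Im_\<tau>] theta2_minus by (simp add: power2_eq_square)
  finally have c: "complex_of_real ((cmod (\<eta> x))\<^sup>2) = - (\<theta>\<^sub>2 x)\<^sup>2 / (\<theta>\<^sub>1 (x + \<omega>) * \<theta>\<^sub>1 (x - \<omega>))" .
  have "U / s_of_w \<tau> \<omega> w = U * (cmod (\<eta> x))\<^sup>2"
    by (simp add: s_of_w_eq[OF assms] curve_u_def norm_mult norm_power x_def)
  then have "of_real (U / s_of_w \<tau> \<omega> w) * \<gamma> \<omega> w = of_real U * (- (\<theta>\<^sub>2 x)\<^sup>2 / (\<theta>\<^sub>1 (x + \<omega>) * \<theta>\<^sub>1 (x - \<omega>))) * \<gamma> \<omega> w"
    by (simp only: of_real_mult c)
  also have "\<dots> = curve_u \<omega> w"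
    unfolding planar_curve_eq curve_u_def x_def[symmetric] \<eta>_def
    using nz U_nz by (simp add: field_simps power2_eq_square)
  finally show "curve_u \<omega> w = of_real (U / s_of_w \<tau> \<omega> w) * \<gamma> \<omega> w" by simp
qed

lemma \<eta>_compose_has_vector_derivative:
  assumes "(g has_vector_derivative g') (at t)" "g t \<in> strip"
  shows "((\<lambda>t. \<eta> (g t)) has_vector_derivative g' * deriv \<eta> (g t)) (at t)"
    and "((\<lambda>t. deriv \<eta> (g t)) has_vector_derivative g' * deriv (deriv \<eta>) (g t)) (at t)"
proof -
  have "(\<eta> has_field_derivative deriv \<eta> (g t)) (at (g t))"
    by (rule holomorphic_derivI[OF \<eta>_holomorphic open_strip assms(2)])
  then show "((\<lambda>t. \<eta> (g t)) has_vector_derivative g' * deriv \<eta> (g t)) (at t)"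
    using field_vector_diff_chain_at[OF assms(1)] by (simp add: o_def)
  have "(deriv \<eta> has_field_derivative deriv (deriv \<eta>) (g t)) (at (g t))"
    by (rule holomorphic_derivI[OF holomorphic_deriv[OF \<eta>_holomorphic open_strip] open_strip assms(2)])
  then show "((\<lambda>t. deriv \<eta> (g t)) has_vector_derivative g' * deriv (deriv \<eta>) (g t)) (at t)"
    using field_vector_diff_chain_at[OF assms(1)] by (simp add: o_def)
qed

lemma open_height: "open height" by (simp add: height_def)

text \<open>
  The real part of \<open>\<gamma>\<^sub>u\<close> times the conjugate of \<open>W\<^sub>1\<close> is known from \<open>isothermic_identity\<close>, differentiated once in \<open>u\<close>. A second
  derivative in \<open>u\<close> brings in the imaginary part, because \<open>\<gamma>\<^sub>u\<^sub>u/\<gamma>\<^sub>u\<close> is not real. All \<open>u\<close>-derivatives of \<open>\<bar>\<eta>\<bar>\<^sup>2\<close> that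
  occur are turned into \<open>w\<close>-derivatives of \<open>1/s\<close> by the Cauchy-Riemann equations.
\<close>

lemma
  assumes w: "w \<in> height"
  shows s_of_w_DERIV: "(s_of_w \<tau> \<omega> has_real_derivative deriv (s_of_w \<tau> \<omega>) w) (at w)"
    and deriv_s_of_w_DERIV: "(deriv (s_of_w \<tau> \<omega>) has_real_derivative deriv (deriv (s_of_w \<tau> \<omega>)) w) (at w)"
    and Im_curve_u_W1: "2 * (s_of_w \<tau> \<omega> w)\<^sup>2 * deriv (s_of_w \<tau> \<omega>) w * Im (curve_u \<omega> w * cnj (W1 \<tau> \<omega> w))
      = (deriv (s_of_w \<tau> \<omega>) w)\<^sup>2 - s_of_w \<tau> \<omega> w * deriv (deriv (s_of_w \<tau> \<omega>)) w"
proof -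
  let ?s = "s_of_w \<tau> \<omega>"
  define A where "A w = \<eta> (node \<omega> w)" for w
  define A1 where "A1 w = deriv \<eta> (node \<omega> w)" for w
  define A2 where "A2 w = deriv (deriv \<eta>) (node \<omega> w)" for w
  define m where "m w = Re (A w * cnj (A w))" for w
  define m1 where "m1 w = - Im (A1 w * cnj (A w))" for w
  define m2 where "m2 w = (Re (A1 w * cnj (A1 w)) - Re (A2 w * cnj (A w))) / 2" for w
  have A: "(A has_vector_derivative \<i>/2 * A1 w) (at w)" "(A1 has_vector_derivative \<i>/2 * A2 w) (at w)"
    if "w \<in> height" for w
    unfolding A_def A1_def A2_def
    by (rule \<eta>_compose_has_vector_derivative[OF node_has_vector_derivative_w node_strip[OF that]])+
  have m: "(m has_real_derivative m1 w) (at w)" if "w \<in> height" for w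
    unfolding m_def
    by (rule DERIV_cong[OF Re_mult_cnj_has_real_derivative[OF A(1)[OF that] A(1)[OF that]]])
       (simp add: m1_def field_simps)
  have m1: "(m1 has_real_derivative m2 w) (at w)" if "w \<in> height" for w
    unfolding m1_def
    by (rule DERIV_cong[OF DERIV_minus[OF Im_mult_cnj_has_real_derivative[OF A(2)[OF that] A(1)[OF that]]]])
       (simp add: m2_def field_simps)
  have mpos: "m w > 0" if "w \<in> height" for w
    using \<eta>_nz[OF node_strip[OF that], of \<omega>] unfolding m_def A_def complex_norm_square[symmetric] by simp
  have s: "?s w = 1 / m w" if "w \<in> height" for w
    unfolding s_of_w_eq[OF that] curve_u_def m_def A_def complex_norm_square[symmetric]
    by (simp add: norm_mult norm_power)
  have ds: "(?s has_real_derivative - m1 w / (m w)\<^sup>2) (at w)" if "w \<in> height" for w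
  proof (rule has_field_derivative_transform_within_open[OF _ open_height that])
    show "((\<lambda>w. 1 / m w) has_real_derivative - m1 w / (m w)\<^sup>2) (at w)"
      using mpos[OF that] by (auto intro!: derivative_eq_intros m[OF that] simp: power2_eq_square)
  qed (simp add: s)
  have d1: "deriv ?s w = - m1 w / (m w)\<^sup>2" if "w \<in> height" for w
    by (rule DERIV_imp_deriv[OF ds[OF that]])
  have dds: "(deriv ?s has_real_derivative - m2 w / (m w)\<^sup>2 + 2 * (m1 w)\<^sup>2 / (m w) ^ 3) (at w)"
  proof (rule has_field_derivative_transform_within_open[OF _ open_height w])
    show "((\<lambda>w. - m1 w / (m w)\<^sup>2) has_real_derivative - m2 w / (m w)\<^sup>2 + 2 * (m1 w)\<^sup>2 / (m w) ^ 3) (at w)"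
      using mpos[OF w] by (auto intro!: derivative_eq_intros m[OF w] m1[OF w] simp: field_simps power2_eq_square power3_eq_cube)
  qed (simp add: d1)
  show "(?s has_real_derivative deriv ?s w) (at w)" using ds[OF w] d1[OF w] by simp
  show "(deriv ?s has_real_derivative deriv (deriv ?s) w) (at w)"
    using dds DERIV_imp_deriv[OF dds] by simp
  define W where "W = W1 \<tau> \<omega> w"
  define Y where "Y u = \<eta> (node u w)" for u
  define Y1 where "Y1 u = deriv \<eta> (node u w)" for u
  define Y2 where "Y2 u = deriv (deriv \<eta>) (node u w)" for u
  have Y: "(Y has_vector_derivative 1/2 * Y1 u) (at u)" "(Y1 has_vector_derivative 1/2 * Y2 u) (at u)" for u
    unfolding Y_def Y1_def Y2_def
    by (rule \<eta>_compose_has_vector_derivative[OF node_has_vector_derivative_u node_strip[OF w]])+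
  have first: "2 * Re (curve_u u w * cnj W) = Re (Y1 u * cnj (Y u))" for u
  proof -
    have "((\<lambda>u. 2 * Re (\<gamma> u w * cnj W)) has_real_derivative
        2 * (Re (curve_u u w * cnj W) + Re (\<gamma> u w * cnj 0))) (at u)"
      by (intro DERIV_cmult Re_mult_cnj_has_real_derivative has_vector_derivative_const
          planar_curve_has_vector_derivative_u[OF w])
    moreover have "((\<lambda>u. Re (Y u * cnj (Y u))) has_real_derivative Re (Y1 u * cnj (Y u))) (at u)"
      by (rule DERIV_cong[OF Re_mult_cnj_has_real_derivative[OF Y(1) Y(1)]]) (simp add: field_simps)
    moreover have "2 * Re (\<gamma> u w * cnj W) = Re (Y u * cnj (Y u))" for u
      unfolding W_def isothermic_identity[OF w] Y_def complex_norm_square[symmetric] by simp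
    ultimately show ?thesis using DERIV_unique by simp
  qed
  have second: "2 * Re (- \<i> * Y u * Y1 u * cnj W) = (Re (Y2 u * cnj (Y u)) + Re (Y1 u * cnj (Y1 u))) / 2" for u
  proof -
    have "((\<lambda>u. curve_u u w) has_vector_derivative - \<i> * Y u * Y1 u) (at u)"
    proof -
      have "((\<lambda>u. - \<i> * (Y u * Y u)) has_vector_derivative - \<i> * (Y u * (1/2 * Y1 u) + 1/2 * Y1 u * Y u)) (at u)"
        by (intro has_vector_derivative_mult_right has_vector_derivative_mult Y)
      then show ?thesis by (simp add: curve_u_def Y_def power2_eq_square mult_ac)
    qed
    then have "((\<lambda>u. 2 * Re (curve_u u w * cnj W)) has_real_derivative
        2 * (Re (- \<i> * Y u * Y1 u * cnj W) + Re (curve_u u w * cnj 0))) (at u)"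
      by (intro DERIV_cmult Re_mult_cnj_has_real_derivative has_vector_derivative_const)
    moreover have "((\<lambda>u. Re (Y1 u * cnj (Y u))) has_real_derivative (Re (Y2 u * cnj (Y u)) + Re (Y1 u * cnj (Y1 u))) / 2) (at u)"
      by (rule DERIV_cong[OF Re_mult_cnj_has_real_derivative[OF Y(2) Y(1)]]) (simp add: field_simps)
    ultimately show ?thesis unfolding first using DERIV_unique by fastforce
  qed
  have YA: "Y \<omega> = A w" "Y1 \<omega> = A1 w" "Y2 \<omega> = A2 w"
    by (simp_all add: Y_def Y1_def Y2_def A_def A1_def A2_def)
  define \<zeta> where "\<zeta> = curve_u \<omega> w * cnj W"
  define c where "c = A1 w * cnj (A w)"
  have \<zeta>: "\<zeta> = - \<i> * (A w * A w) * cnj W" by (simp add: \<zeta>_def curve_u_def A_def power2_eq_square)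
  have re: "2 * Re \<zeta> = Re c" using first[of \<omega>] by (simp add: \<zeta>_def c_def YA)
  have im: "m1 w = - Im c" by (simp add: m1_def c_def)
  have AA: "A w * cnj (A w) = of_real (m w)" by (simp add: m_def complex_mult_cnj)
  define B where "B = - \<i> * A w * A1 w * cnj W"
  have "\<zeta> * c = B * (A w * cnj (A w))"
    by (simp add: \<zeta> c_def B_def mult_ac)
  then have "\<zeta> * c = B * of_real (m w)" by (simp only: AA)
  then have "2 * Re (\<zeta> * c) = m w * (2 * Re B)" by simp
  also have "\<dots> = m w * (Re (A1 w * cnj (A1 w)) - m2 w)"
  proof -
    have "2 * Re B = Re (A1 w * cnj (A1 w)) - m2 w"
      using second[of \<omega>] unfolding YA B_def[symmetric] m2_def by argo
    then show ?thesis by simp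
  qed
  finally have e1: "2 * Re (\<zeta> * c) = m w * Re (A1 w * cnj (A1 w)) - m w * m2 w"
    by (simp add: algebra_simps)
  have "c * cnj c = (A1 w * cnj (A1 w)) * (A w * cnj (A w))" by (simp add: c_def mult_ac)
  then have "Re (c * cnj c) = m w * Re (A1 w * cnj (A1 w))" unfolding AA by simp
  then have e2: "m w * Re (A1 w * cnj (A1 w)) = (Re c)\<^sup>2 + (Im c)\<^sup>2" by (simp add: power2_eq_square)
  have "2 * Re \<zeta> * Re c - 2 * Im \<zeta> * Im c = (Re c)\<^sup>2 + (Im c)\<^sup>2 - m w * m2 w"
    using e1 unfolding e2 by simp
  then have key: "2 * Im \<zeta> * m1 w = (m1 w)\<^sup>2 - m w * m2 w"
    unfolding re im by (simp add: power2_eq_square)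
  have d2: "deriv (deriv ?s) w = - m2 w / (m w)\<^sup>2 + 2 * (m1 w)\<^sup>2 / (m w) ^ 3"
    by (rule DERIV_imp_deriv[OF dds])
  have "2 * (1 / m w)\<^sup>2 * (- m1 w / (m w)\<^sup>2) * Im \<zeta> = - (2 * Im \<zeta> * m1 w) / (m w) ^ 4"
    by (simp add: power_divide power2_eq_square power4_eq_xxxx mult_ac)
  also have "\<dots> = (- m1 w / (m w)\<^sup>2)\<^sup>2 - 1 / m w * (- m2 w / (m w)\<^sup>2 + 2 * (m1 w)\<^sup>2 / (m w) ^ 3)"
    unfolding key using mpos[OF w] by (simp add: field_simps power2_eq_square power3_eq_cube power4_eq_xxxx)
  finally show "2 * (?s w)\<^sup>2 * deriv ?s w * Im (curve_u \<omega> w * cnj (W1 \<tau> \<omega> w)) = (deriv ?s w)\<^sup>2 - ?s w * deriv (deriv ?s) w"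
    unfolding d2 d1[OF w] s[OF w] \<zeta>_def W_def .
qed

end

section \<open>Quaternionic frames\<close>

lemma real_analytic_DERIV:
  assumes "real_analytic g"
  shows "(g has_real_derivative deriv g x) (at x)" and "isCont (deriv g) x"
proof -
  obtain F where F: "(\<lambda>t. g (x + t)) has_fps_expansion F"
    using assms unfolding real_analytic_def by blast
  have "fps_conv_radius F > 0" and ev: "\<forall>\<^sub>F t in nhds 0. eval_fps F t = g (x + t)"
    using F by (auto simp: has_fps_expansion_def)
  then have "(eval_fps F has_real_derivative eval_fps (fps_deriv F) 0) (at 0)"
    by (intro has_field_derivative_eval_fps) (simp add: zero_ereal_def)
  then have "((\<lambda>t. g (x + t)) has_real_derivative eval_fps (fps_deriv F) 0) (at 0)"
    using DERIV_cong_ev[OF refl ev refl] by simp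
  then have D: "(g has_real_derivative eval_fps (fps_deriv F) 0) (at x)"
    using DERIV_shift[of g _ 0 x] by (simp add: add.commute)
  then show "(g has_real_derivative deriv g x) (at x)"
    using DERIV_imp_deriv[OF D] by simp
  have shift: "deriv (\<lambda>t. g (x + t)) = (\<lambda>t. deriv g (x + t))"
    by (rule ext) (use DERIV_shift[of g] in \<open>simp add: deriv_def add.commute\<close>)
  have "isCont (deriv (\<lambda>t. g (x + t))) 0"
    by (rule has_fps_expansion_imp_continuous[OF has_fps_expansion_deriv[OF F]])
  then have "isCont (\<lambda>t. deriv g (x + t)) 0" unfolding shift .
  then show "isCont (deriv g) x"
    by (subst isCont_iff) (simp add: isCont_def)
qed

text \<open>
  Coordinates of an imaginary quaternion: for a curve in the plane \<open>span {\<^bold>j, \<^bold>k}\<close> the first one is the normal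
  component, the second one the position in the plane as a complex number.
\<close>

definition qvec :: "real \<Rightarrow> complex \<Rightarrow> quat" where
  "qvec a b = Quat (\<i> * of_real a) b"

definition rot :: "quat \<Rightarrow> quat \<Rightarrow> quat" where
  "rot p x = inverse p * x * p"

definition qdot :: "quat \<Rightarrow> quat \<Rightarrow> real" where
  "qdot p q = Re (quat_C p * cnj (quat_C q) + quat_J p * cnj (quat_J q))"

lemma quat_sel [simp]:
  "quat_C (p + q) = quat_C p + quat_C q" "quat_J (p + q) = quat_J p + quat_J q"
  "quat_C (p - q) = quat_C p - quat_C q" "quat_J (p - q) = quat_J p - quat_J q"
  "quat_C (- p) = - quat_C p" "quat_J (- p) = - quat_J p"
  "quat_C (c *\<^sub>R p) = c *\<^sub>R quat_C p" "quat_J (c *\<^sub>R p) = c *\<^sub>R quat_J p"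
  "quat_C 0 = 0" "quat_J 0 = 0" "quat_C 1 = 1" "quat_J 1 = 0"
  "quat_C (p * q) = quat_C p * quat_C q - quat_J p * cnj (quat_J q)"
  "quat_J (p * q) = quat_C p * quat_J q + quat_J p * cnj (quat_C q)"
  by (simp_all add: quat_defs)

lemma quat_eq_iff: "p = q \<longleftrightarrow> quat_C p = quat_C q \<and> quat_J p = quat_J q"
  by (cases p; cases q) simp

lemma qvec_sel [simp]: "quat_C (qvec a b) = \<i> * of_real a" "quat_J (qvec a b) = b"
  by (simp_all add: qvec_def)

lemma of_real_quat_sel [simp]: "quat_C (of_real c) = of_real c" "quat_J (of_real c) = 0"
  by (simp_all add: of_real_def scaleR_conv_of_real[symmetric])

lemma bounded_linear_quat_C: "bounded_linear quat_C"
  by (rule bounded_linear_intro[of _ 1]) (auto simp: norm_quat_def norm_Pair intro: real_le_rsqrt)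

lemma bounded_linear_quat_J: "bounded_linear quat_J"
  by (rule bounded_linear_intro[of _ 1]) (auto simp: norm_quat_def norm_Pair intro: real_le_rsqrt)

lemma bounded_linear_Quat_C: "bounded_linear (\<lambda>a. Quat a 0)"
  by (rule bounded_linear_intro[of _ 1]) (auto simp: norm_quat_def norm_Pair quat_defs)

lemma bounded_linear_Quat_J: "bounded_linear (\<lambda>b. Quat 0 b)"
  by (rule bounded_linear_intro[of _ 1]) (auto simp: norm_quat_def norm_Pair quat_defs)

lemma qvec_has_vector_derivative:
  assumes "(a has_real_derivative a') (at t)" "(b has_vector_derivative b') (at t)"
  shows "((\<lambda>t. qvec (a t) (b t)) has_vector_derivative qvec a' b') (at t)"
proof -
  have "((\<lambda>t. \<i> * of_real (a t)) has_vector_derivative \<i> * of_real a') (at t)"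
    by (intro has_vector_derivative_mult_right has_vector_derivative_of_real assms)
  then have "((\<lambda>t. Quat (\<i> * of_real (a t)) 0 + Quat 0 (b t)) has_vector_derivative Quat (\<i> * of_real a') 0 + Quat 0 b') (at t)"
    by (intro has_vector_derivative_add bounded_linear.has_vector_derivative[OF bounded_linear_Quat_C]
        bounded_linear.has_vector_derivative[OF bounded_linear_Quat_J] assms)
  then show ?thesis by (simp add: qvec_def plus_quat_def)
qed

lemma rot_add: "rot p (x + y) = rot p x + rot p y"
  and rot_diff: "rot p (x - y) = rot p x - rot p y"
  and rot_minus: "rot p (- x) = - rot p x"
  and rot_scaleR: "rot p (c *\<^sub>R x) = c *\<^sub>R rot p x"
  by (simp_all add: rot_def algebra_simps)

lemma rot_mult: "p \<noteq> 0 \<Longrightarrow> rot p (x * y) = rot p x * rot p y"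
proof -
  assume "p \<noteq> 0"
  then have "rot p x * rot p y = inverse p * x * (p * inverse p) * y * p"
    by (simp only: rot_def mult.assoc)
  also have "\<dots> = inverse p * x * y * p" using \<open>p \<noteq> 0\<close> by simp
  finally show ?thesis by (simp only: rot_def mult.assoc)
qed

lemma rot_of_real: "p \<noteq> 0 \<Longrightarrow> rot p (of_real c) = of_real c"
  by (simp add: rot_def of_real_def)

lemma rot_rot: "p \<noteq> 0 \<Longrightarrow> q \<noteq> 0 \<Longrightarrow> rot (p * q) x = rot q (rot p x)"
  by (simp add: rot_def nonzero_inverse_mult_distrib mult.assoc)

lemma rot_inverse: "p \<noteq> 0 \<Longrightarrow> rot (inverse p) (rot p x) = x" "p \<noteq> 0 \<Longrightarrow> rot p (rot (inverse p) x) = x"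
  by (simp_all add: rot_rot[symmetric]) (simp_all add: rot_def)

lemma norm_rot: "p \<noteq> 0 \<Longrightarrow> norm (rot p x) = norm x"
  by (simp add: rot_def norm_mult norm_inverse)

lemma bounded_linear_rot: "bounded_linear (rot p)"
  unfolding rot_def by (intro bounded_linear_compose[OF bounded_linear_mult_left bounded_linear_mult_right])

lemma qdot_polarization: "2 * qdot x y = (norm (x + y))\<^sup>2 - (norm x)\<^sup>2 - (norm y)\<^sup>2"
  unfolding quat_norm_sq qdot_def cmod_power2 by (simp add: power2_eq_square algebra_simps)

lemma qdot_rot: "p \<noteq> 0 \<Longrightarrow> qdot (rot p x) (rot p y) = qdot x y"
  using qdot_polarization[of x y] qdot_polarization[of "rot p x" "rot p y"]
  by (simp add: rot_add[symmetric] norm_rot)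

lemma qdot_qvec: "qdot (qvec a b) (qvec c d) = a * c + Re (b * cnj d)"
  by (simp add: qdot_def)

lemma qdot_scaleR_right: "qdot x (c *\<^sub>R y) = c * qdot x y"
  by (simp add: qdot_def algebra_simps)

lemma qdot_axis: "qdot x (qvec 1 0) = Im (quat_C x)"
  by (simp add: qdot_def)

lemma norm_qvec: "(norm (qvec a b))\<^sup>2 = a\<^sup>2 + (cmod b)\<^sup>2"
  by (simp add: quat_norm_sq norm_mult)

lemma Re_quat_C_rot:
  assumes "p \<noteq> 0" shows "Re (quat_C (rot p x)) = Re (quat_C x)"
proof -
  have "qdot (rot p x) (rot p 1) = qdot x 1" by (rule qdot_rot[OF assms])
  moreover have "rot p 1 = 1" using rot_of_real[OF assms, of 1] by simp
  ultimately show ?thesis by (simp add: qdot_def)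
qed

lemma rot_qvec_eq:
  assumes "p \<noteq> 0"
  shows "rot p (qvec a b) = qvec (Im (quat_C (rot p (qvec a b)))) (quat_J (rot p (qvec a b)))"
  using Re_quat_C_rot[OF assms, of "qvec a b"] by (simp add: quat_eq_iff complex_eq_iff)

lemma inverse_frame_has_vector_derivative:
  fixes \<Phi> :: "real \<Rightarrow> quat"
  assumes P: "(\<Phi> has_vector_derivative A * \<Phi> t) (at t)" and nz: "\<Phi> t \<noteq> 0"
  shows "((\<lambda>t. inverse (\<Phi> t)) has_vector_derivative - (inverse (\<Phi> t) * A)) (at t)"
proof -
  have "((\<lambda>t. inverse (\<Phi> t)) has_vector_derivative - (inverse (\<Phi> t) * (A * \<Phi> t) * inverse (\<Phi> t))) (at t)"
    using Deriv.has_derivative_inverse[OF nz P[unfolded has_vector_derivative_def]]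
    unfolding has_vector_derivative_def by simp
  moreover have "inverse (\<Phi> t) * (A * \<Phi> t) * inverse (\<Phi> t) = inverse (\<Phi> t) * A"
    using nz by (simp add: mult.assoc)
  ultimately show ?thesis by simp
qed

text \<open>
  The velocity of a vector with coordinates \<open>x\<close> in a moving frame is the derivative of the coordinates plus a
  commutator with the angular velocity.
\<close>

lemma rot_has_vector_derivative:
  assumes P: "(\<Phi> has_vector_derivative A * \<Phi> t) (at t)" and nz: "\<Phi> t \<noteq> 0"
    and x: "(x has_vector_derivative x') (at t)"
  shows "((\<lambda>t. rot (\<Phi> t) (x t)) has_vector_derivative rot (\<Phi> t) (x' + (x t * A - A * x t))) (at t)"
proof -
  have "((\<lambda>t. inverse (\<Phi> t) * x t * \<Phi> t) has_vector_derivative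
      inverse (\<Phi> t) * x t * (A * \<Phi> t) + (inverse (\<Phi> t) * x' + - (inverse (\<Phi> t) * A) * x t) * \<Phi> t) (at t)"
    by (intro has_vector_derivative_mult inverse_frame_has_vector_derivative[OF P nz] x P)
  then show ?thesis unfolding rot_def by (simp add: algebra_simps)
qed

lemma qvec_commutator:
  "qvec a b * Quat 0 (\<i> * (of_real r * W)) - Quat 0 (\<i> * (of_real r * W)) * qvec a b
    = qvec (2 * r * Re (W * cnj b)) (- 2 * of_real (r * a) * W)"
  by (simp add: quat_eq_iff complex_eq_iff algebra_simps)

text \<open>
  For imaginary units \<open>n\<close> and \<open>i\<close> the quaternion \<open>h = 1 - n i\<close> satisfies \<open>n h = n + i = h i\<close>. It vanishes only
  if \<open>n = - i\<close>, and then \<open>\<^bold>j\<close> does the same.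
\<close>

lemma unit_imaginary_rot_to_axis:
  assumes "norm (qvec a b) = 1"
  obtains g where "norm g = 1" "rot g (qvec a b) = qvec 1 0"
proof -
  define n where "n = qvec a b"
  define i where "i = qvec 1 0"
  have "a\<^sup>2 + (cmod b)\<^sup>2 = 1" using norm_qvec[of a b] assms by simp
  then have "complex_of_real (a * a) + b * cnj b = 1"
    unfolding complex_norm_square[symmetric] of_real_add[symmetric] power2_eq_square by simp
  then have nn: "n * n = - 1" by (simp add: n_def quat_eq_iff algebra_simps)
  have ii: "i * i = - 1" by (simp add: i_def quat_eq_iff)
  have "\<exists>h. h \<noteq> 0 \<and> n * h = h * i"
  proof (cases "n = - i")
    case True
    then show ?thesis
      by (intro exI[of _ "Quat 0 1"]) (simp add: i_def quat_eq_iff)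
  next
    case False
    have "1 - n * i \<noteq> 0"
    proof
      assume "1 - n * i = 0"
      then have "n * i = 1" by simp
      then have "n * (i * i) = i" by (simp only: mult.assoc[symmetric]) simp
      then have "- n = i" using ii by simp
      then show False using False by (metis minus_minus)
    qed
    moreover have "n * (1 - n * i) = n - (n * n) * i" by (simp add: algebra_simps)
    moreover have "(1 - n * i) * i = i - n * (i * i)" by (simp add: algebra_simps)
    ultimately show ?thesis
      using nn ii by (intro exI[of _ "1 - n * i"]) simp
  qed
  then obtain h where h: "h \<noteq> 0" "n * h = h * i" by blast
  define g where "g = (1 / norm h) *\<^sub>R h"
  have "norm g = 1" using h by (simp add: g_def)
  moreover have "n * g = g * i" by (simp add: g_def h(2))
  then have "rot g n = inverse g * g * i" by (simp add: rot_def mult.assoc)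
  then have "rot g n = i" using \<open>norm g = 1\<close> by (metis left_inverse mult_1 norm_zero zero_neq_one)
  ultimately show ?thesis using that unfolding n_def i_def by blast
qed

section \<open>The oval of the quartic\<close>

lemma poly_same_sign_if_no_roots:
  fixes G :: "real poly"
  assumes "\<And>x. poly G x \<noteq> 0" "lead_coeff G > 0"
  shows "poly G x > 0"
proof (rule ccontr)
  assume "\<not> poly G x > 0"
  then have neg: "poly G x < 0" using assms(1)[of x] by linarith
  obtain n where n: "\<And>y. y \<ge> n \<Longrightarrow> poly G y \<ge> lead_coeff G"
    using poly_pinfty_gt_lc[OF assms(2)] by blast
  define y where "y = max n (x + 1)"
  have "x < y" "poly G y > 0" using n[of y] assms(2) by (auto simp: y_def)
  then show False using poly_IVT_pos[OF _ neg] assms(1) by blast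
qed

lemma quartic_oval_factorization:
  fixes q :: "real poly"
  assumes roots: "{x. poly q x = 0} = {a, b}" and ab: "a < b"
    and ord: "order a q = 1" "order b q = 1" and lead: "lead_coeff q = - 1"
  obtains G where "q = [:- a, 1:] * [:- b, 1:] * (- G)" "\<And>x. poly G x > 0"
proof -
  have q0: "q \<noteq> 0" using lead by auto
  have "poly q a = 0" "poly q b = 0" using roots by auto
  then obtain q1 where q1: "q = [:- a, 1:] * q1" by (auto simp: poly_eq_0_iff_dvd elim: dvdE)
  then have "poly q1 b = 0" using \<open>poly q b = 0\<close> ab by simp
  then obtain H where H: "q1 = [:- b, 1:] * H" by (auto simp: poly_eq_0_iff_dvd elim: dvdE)
  define G where "G = - H"
  have qG: "q = [:- a, 1:] * [:- b, 1:] * (- G)" unfolding q1 H G_def by (simp only: mult.assoc minus_minus)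
  have nr: "poly G x \<noteq> 0" for x
  proof
    assume "poly G x = 0"
    then have "poly q x = 0" by (simp add: qG)
    then have x: "x = a \<or> x = b" using roots by auto
    have dG: "[:- x, 1:] dvd - G" using \<open>poly G x = 0\<close> by (simp add: poly_eq_0_iff_dvd[symmetric])
    have "\<exists>K. q = [:- x, 1:] * (K * (- G))"
      using x
    proof (elim disjE)
      assume "x = a"
      then show ?thesis by (intro exI[of _ "[:- b, 1:]"]) (simp only: qG mult.assoc)
    next
      assume "x = b"
      then show ?thesis by (intro exI[of _ "[:- a, 1:]"]) (simp only: qG mult_ac)
    qed
    then obtain K where K: "q = [:- x, 1:] * (K * (- G))" by blast
    have "[:- x, 1:] * [:- x, 1:] dvd [:- x, 1:] * (K * (- G))"
      by (intro mult_dvd_mono dvd_refl dvd_mult dG)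
    then have "[:- x, 1:] ^ 2 dvd q" unfolding K[symmetric] power2_eq_square .
    then have "2 \<le> order x q" using q0 by (simp add: order_divides)
    then show False using x ord by auto
  qed
  have "lead_coeff q = - lead_coeff G"
    unfolding qG lead_coeff_mult by simp
  then have "lead_coeff G > 0" using lead by simp
  then show ?thesis using that qG poly_same_sign_if_no_roots nr by blast
qed

text \<open>
  The endpoint singularities are those of \<open>1/sqrt ((t - a)(b - t))\<close>, whose antiderivative is an arcsine.
\<close>

lemma integrable_inverse_sqrt_oval:
  fixes a b c :: real
  assumes ab: "a < b" and q: "\<And>x. q x = (x - a) * (b - x) * g x"
    and g: "continuous_on {a..b} g" "\<And>x. g x > 0" and cq: "continuous_on UNIV q"
  shows "(\<lambda>t. c / sqrt (q t)) integrable_on {a..b}"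
proof -
  define F where "F t = arcsin ((2 * t - a - b) / (b - a))" for t
  have "((\<lambda>t. 1 / sqrt ((t - a) * (b - t))) has_integral F b - F a) {a..b}"
  proof (rule fundamental_theorem_of_calculus_interior)
    show "continuous_on {a..b} F"
      unfolding F_def
    proof (rule continuous_on_arcsin)
      show "continuous_on {a..b} (\<lambda>t. (2 * t - a - b) / (b - a))"
        using ab by (intro continuous_on_divide continuous_on_diff continuous_on_mult continuous_on_const continuous_on_id) auto
      show "\<forall>t\<in>{a..b}. - 1 \<le> (2 * t - a - b) / (b - a) \<and> (2 * t - a - b) / (b - a) \<le> 1"
        using ab by (simp add: pos_le_divide_eq pos_divide_le_eq)
    qed
    fix t assume t: "t \<in> {a<..<b}"
    define y where "y = (2 * t - a - b) / (b - a)"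
    have y: "- 1 < y" "y < 1" using t ab by (auto simp: y_def field_simps)
    have "1 - y\<^sup>2 = ((b - a)\<^sup>2 - (2 * t - a - b)\<^sup>2) / (b - a)\<^sup>2"
      unfolding y_def power_divide diff_divide_distrib[of "(b - a)\<^sup>2"] using ab by simp
    also have "(b - a)\<^sup>2 - (2 * t - a - b)\<^sup>2 = 4 * ((t - a) * (b - t))"
      by (simp add: power2_eq_square algebra_simps)
    finally have sq: "1 - y\<^sup>2 = (2 * sqrt ((t - a) * (b - t)) / (b - a))\<^sup>2"
      using t by (simp add: power_divide power_mult_distrib)
    have "sqrt (1 - y\<^sup>2) = 2 * sqrt ((t - a) * (b - t)) / (b - a)"
      unfolding sq by (rule real_sqrt_unique) (use t ab in auto)
    moreover have "(F has_real_derivative inverse (sqrt (1 - y\<^sup>2)) * (2 / (b - a))) (at t)"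
    proof -
      have "((\<lambda>t. (2 * t - a - b) / (b - a)) has_real_derivative (2 * 1 - 0 - 0) / (b - a)) (at t)"
        by (intro DERIV_cdivide DERIV_diff DERIV_cmult DERIV_ident DERIV_const)
      then have "((\<lambda>t. (2 * t - a - b) / (b - a)) has_real_derivative 2 / (b - a)) (at t)" by simp
      then show ?thesis
        unfolding F_def y_def using y[unfolded y_def] by (intro DERIV_chain2[OF DERIV_arcsin])
    qed
    moreover have "inverse (2 * x / d) * (2 / d) = 1 / x" if "d \<noteq> 0" for x d :: real
      using that by (cases "x = 0") (auto simp: field_simps)
    ultimately have "(F has_real_derivative 1 / sqrt ((t - a) * (b - t))) (at t)"
      using ab by (metis diff_gt_0_iff_gt less_irrefl)
    then show "(F has_vector_derivative 1 / sqrt ((t - a) * (b - t))) (at t)"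
      by (simp only: has_real_derivative_iff_has_vector_derivative)
  qed (use ab in auto)
  then have h: "(\<lambda>t. 1 / sqrt ((t - a) * (b - t))) integrable_on {a..b}" by blast
  obtain m where m: "m > 0" "\<And>x. x \<in> {a..b} \<Longrightarrow> m \<le> g x"
  proof -
    obtain z where "z \<in> {a..b}" "\<And>x. x \<in> {a..b} \<Longrightarrow> g z \<le> g x"
      using continuous_attains_inf[of "{a..b}" g] g(1) ab by auto
    then show ?thesis using that[of "g z"] g(2) by blast
  qed
  have "(\<lambda>t. c / sqrt (q t)) absolutely_integrable_on {a..b}"
  proof (rule measurable_bounded_by_integrable_imp_absolutely_integrable)
    have "q \<in> borel_measurable borel" by (rule borel_measurable_continuous_onI[OF cq])
    then have "(\<lambda>t. c / sqrt (q t)) \<in> borel_measurable borel" by measurable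
    then show "(\<lambda>t. c / sqrt (q t)) \<in> borel_measurable (lebesgue_on {a..b})"
      by (intro measurable_restrict_space1 measurable_completion) simp
    show "(\<lambda>t. (\<bar>c\<bar> / sqrt m) * (1 / sqrt ((t - a) * (b - t)))) integrable_on {a..b}"
      using integrable_cmul[OF h, of "\<bar>c\<bar> / sqrt m"] by simp
    fix t assume t: "t \<in> {a..b}"
    show "norm (c / sqrt (q t)) \<le> (\<bar>c\<bar> / sqrt m) * (1 / sqrt ((t - a) * (b - t)))"
    proof (cases "t = a \<or> t = b")
      case True then show ?thesis by (auto simp: q)
    next
      case False
      then have p: "(t - a) * (b - t) > 0" using t by auto
      have "sqrt m * sqrt ((t - a) * (b - t)) \<le> sqrt (q t)"
      proof -
        have "m * ((t - a) * (b - t)) \<le> g t * ((t - a) * (b - t))"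
          using m(2)[OF t] p by (intro mult_right_mono) auto
        then show ?thesis unfolding q real_sqrt_mult[symmetric] by (intro real_sqrt_le_mono) (simp only: mult_ac)
      qed
      moreover have "sqrt m * sqrt ((t - a) * (b - t)) > 0" using m p by simp
      ultimately have "\<bar>c\<bar> / sqrt (q t) \<le> \<bar>c\<bar> / (sqrt m * sqrt ((t - a) * (b - t)))"
        by (meson abs_ge_zero divide_left_mono mult_pos_pos order_less_le_trans)
      moreover have "q t \<ge> 0" unfolding q using p g(2)[of t] by simp
      ultimately show ?thesis by simp
    qed
  qed simp
  then show ?thesis using set_lebesgue_integral_eq_integral(1) by blast
qed

section \<open>The rhombic piece as a function of \<open>s\<close>\<close>

text \<open>
  Here \<open>v0\<close> is a parameter value at which \<open>s\<close> takes its minimum \<open>sm\<close>.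
\<close>

locale rhombic_cylinder = planar_family \<tau> \<omega> for \<tau> :: complex and \<omega> :: real +
  fixes \<delta> s1 s2 sm sp Z0 v0 :: real and w r :: "real \<Rightarrow> real" and \<Phi> :: "real \<Rightarrow> quat"
    and f :: "real \<Rightarrow> real \<Rightarrow> quat"
  assumes cylinder: "isothermic_planar_cylinder \<tau> \<omega> w r \<Phi> f"
    and \<delta>_nz: "\<delta> \<noteq> 0" and sm_sp: "sm < sp"
    and roots: "{x. poly (Q \<tau> \<omega> \<delta> s1 s2) x = 0} = {sm, sp}"
    and simple: "order sm (Q \<tau> \<omega> \<delta> s1 s2) = 1" "order sp (Q \<tau> \<omega> \<delta> s1 s2) = 1"
    and s_of_w_at: "\<forall>s\<in>{sm..sp}. s_of_w \<tau> \<omega> (w (v0 + v_of_s \<tau> \<omega> \<delta> s1 s2 sm s)) = s"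
    and w_at_DERIV: "\<forall>s\<in>{sm<..<sp}. ((\<lambda>s. w (v0 + v_of_s \<tau> \<omega> \<delta> s1 s2 sm s))
            has_real_derivative 1 / sqrt (poly (Q3 \<tau> \<omega>) s)) (at s)"
    and w_even: "\<forall>v. w (v0 - v) = w (v0 + v)"
    and w_period_abs: "\<forall>v. w (v + w_period \<tau> \<omega> \<delta> s1 s2 sm sp) = w v"
    and r_eq: "\<forall>v. r v = (s_of_w \<tau> \<omega> (w v) - s1) * (s_of_w \<tau> \<omega> (w v) - s2)
                  / (\<delta> * deriv (s_of_w \<tau> \<omega>) (w v))"
    and not_closed: "\<not> (\<forall>u v. f u (v + w_period \<tau> \<omega> \<delta> s1 s2 sm sp) = f u v)"
    and Z0_pos: "0 < Z0"
    and Z0_sq: "Z0\<^sup>2 = (2 * (s1 + s2) * const_U1' \<tau> \<omega> + \<delta>\<^sup>2 * (const_U1' \<tau> \<omega>)\<^sup>2 - const_U2 \<tau> \<omega>)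
                / (const_U \<tau> \<omega>)\<^sup>2
              + (const_U' \<tau> \<omega> + s1 * s2 * const_U1' \<tau> \<omega>)\<^sup>2 / (const_U \<tau> \<omega>) ^ 4"
begin

abbreviation "q \<equiv> Q \<tau> \<omega> \<delta> s1 s2"
abbreviation "q3 \<equiv> Q3 \<tau> \<omega>"
abbreviation "U' \<equiv> const_U' \<tau> \<omega>"
abbreviation "U1' \<equiv> const_U1' \<tau> \<omega>"
abbreviation "U2 \<equiv> const_U2 \<tau> \<omega>"

lemma poly_q3: "poly q3 s = 2 * U1' * s ^ 3 - U2 * s\<^sup>2 - 2 * U' * s - U\<^sup>2"
  by (simp add: Q3_def algebra_simps power2_eq_square power3_eq_cube)

lemma poly_q: "poly q s = - ((s - s1) * (s - s2))\<^sup>2 + \<delta>\<^sup>2 * poly q3 s"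
  by (simp add: Q_def power_mult_distrib)

lemma lead_coeff_q: "lead_coeff q = - 1"
proof -
  obtain c0 c1 c2 c3 where c: "q = [: c0, c1, c2, c3, - 1 :]"
    by (simp add: Q_def Q3_def power2_eq_square)
  show ?thesis unfolding c by simp
qed

lemma oval:
  obtains G where "q = [:- sm, 1:] * [:- sp, 1:] * (- G)" "\<And>x. poly G x > 0"
  using quartic_oval_factorization[OF roots sm_sp simple lead_coeff_q] by blast

lemma q_pos: "s \<in> {sm<..<sp} \<Longrightarrow> poly q s > 0"
proof -
  assume s: "s \<in> {sm<..<sp}"
  obtain G where G: "q = [:- sm, 1:] * [:- sp, 1:] * (- G)" "\<And>x. poly G x > 0" by (rule oval) blast
  have "poly q s = (s - sm) * (sp - s) * poly G s" by (simp add: G(1) algebra_simps)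
  then show ?thesis using s G(2) by simp
qed

lemma integrable_inverse_sqrt_q: "(\<lambda>t. c / sqrt (poly q t)) integrable_on {sm..sp}"
proof -
  obtain G where G: "q = [:- sm, 1:] * [:- sp, 1:] * (- G)" "\<And>x. poly G x > 0" by (rule oval) blast
  have "poly q x = (x - sm) * (sp - x) * poly G x" for x
    unfolding G(1) by (simp add: algebra_simps)
  then show ?thesis
    by (rule integrable_inverse_sqrt_oval[OF sm_sp]) (auto intro!: continuous_intros G(2))
qed

definition v_at :: "real \<Rightarrow> real" where
  "v_at s = v0 + v_of_s \<tau> \<omega> \<delta> s1 s2 sm s"

text \<open>
  The period of \<open>w\<close> with the sign of \<open>\<delta>\<close>, so that \<open>s\<close> increases from \<open>v0\<close> to \<open>v0 + per/2\<close> in either orientation.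
\<close>

definition per :: real where "per = 2 * v_of_s \<tau> \<omega> \<delta> s1 s2 sm sp"

definition v1 :: real where "v1 = v0 + per / 2"

lemma v_at_ends: "v_at sm = v0" "v_at sp = v1"
  by (simp_all add: v_at_def v_of_s_def v1_def per_def)

lemma continuous_on_v_at: "continuous_on {sm..sp} v_at"
  unfolding v_at_def v_of_s_def
  by (intro continuous_intros indefinite_integral_continuous_1 integrable_inverse_sqrt_q)

lemma v_at_DERIV:
  assumes "s \<in> {sm<..<sp}"
  shows "(v_at has_real_derivative \<delta> / sqrt (poly q s)) (at s)"
proof -
  have "((\<lambda>s. integral {sm..s} (\<lambda>t. \<delta> / sqrt (poly q t))) has_vector_derivative \<delta> / sqrt (poly q s))
      (at s within ({sm..sp} - {}))"
  proof (rule integral_has_vector_derivative_continuous_at)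
    show "continuous (at s within {sm..sp} - {}) (\<lambda>t. \<delta> / sqrt (poly q t))"
      using q_pos[OF assms] by (intro continuous_intros) auto
  qed (use assms integrable_inverse_sqrt_q in auto)
  moreover have "at s within ({sm..sp} - {}) = at s"
    using at_within_interior[of s "{sm..sp}"] assms by simp
  ultimately have "((\<lambda>s. integral {sm..s} (\<lambda>t. \<delta> / sqrt (poly q t))) has_real_derivative \<delta> / sqrt (poly q s)) (at s)"
    by (simp add: has_real_derivative_iff_has_vector_derivative)
  then show ?thesis
    unfolding v_at_def v_of_s_def by (auto intro!: derivative_eq_intros)
qed

lemma w_height: "w v \<in> height"
  using cylinder by (simp add: isothermic_planar_cylinder_def height_def)

lemma w_per: "w (v + per) = w v"
proof (cases "per \<ge> 0")
  case True
  then show ?thesis using w_period_abs by (simp add: w_period_def per_def)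
next
  case False
  then have "w_period \<tau> \<omega> \<delta> s1 s2 sm sp = - per" by (simp add: w_period_def per_def)
  then show ?thesis using w_period_abs[rule_format, of "v + per"] by simp
qed

lemma w_reflect0: "w (v0 - t) = w (v0 + t)"
  using w_even by blast

lemma w_reflect1: "w (v1 - t) = w (v1 + t)"
  using w_reflect0[of "t - per / 2"] w_per[of "v0 - (t - per/2) - per"] w_per[of "v0 + t - per / 2"]
  by (simp add: v1_def algebra_simps)

lemma r_height_cong: "w v = w v' \<Longrightarrow> r v = r v'"
  using r_eq by simp

lemma w_DERIV: "(w has_real_derivative deriv w v) (at v)"
  and isCont_deriv_w: "isCont (deriv w) v"
  using cylinder real_analytic_DERIV unfolding isothermic_planar_cylinder_def by blast+

lemma r_sq: "(r v)\<^sup>2 = 1 - (deriv w v)\<^sup>2"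
  using cylinder unfolding isothermic_planar_cylinder_def by blast

definition \<sigma> :: "real \<Rightarrow> real" where "\<sigma> v = s_of_w \<tau> \<omega> (w v)"

lemma \<sigma>_pos: "\<sigma> v > 0" by (simp add: \<sigma>_def s_of_w_def)

lemma \<sigma>_at: "s \<in> {sm..sp} \<Longrightarrow> \<sigma> (v_at s) = s"
  using s_of_w_at by (simp add: \<sigma>_def v_at_def)

lemma sm_pos: "sm > 0"
  using \<sigma>_pos[of "v_at sm"] \<sigma>_at[of sm] sm_sp by simp

lemma q3_pos:
  assumes "s \<in> {sm<..<sp}"
  shows "poly q3 s > 0"
proof -
  have "\<delta>\<^sup>2 * poly q3 s = poly q s + ((s - s1) * (s - s2))\<^sup>2" by (simp add: poly_q)
  also have "\<dots> > 0" using q_pos[OF assms] by (simp add: add_pos_nonneg)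
  finally show ?thesis by (simp add: zero_less_mult_iff)
qed

lemma w_v_at_DERIV:
  assumes "s \<in> {sm<..<sp}"
  shows "((\<lambda>s. w (v_at s)) has_real_derivative 1 / sqrt (poly q3 s)) (at s)"
  using w_at_DERIV assms by (simp add: v_at_def)

lemma deriv_w_at:
  assumes "s \<in> {sm<..<sp}"
  shows "deriv w (v_at s) = sqrt (poly q s) / (\<delta> * sqrt (poly q3 s))"
proof -
  have "((\<lambda>s. w (v_at s)) has_real_derivative deriv w (v_at s) * (\<delta> / sqrt (poly q s))) (at s)"
    by (rule DERIV_chain2[OF w_DERIV v_at_DERIV[OF assms]])
  then have "deriv w (v_at s) * (\<delta> / sqrt (poly q s)) = 1 / sqrt (poly q3 s)"
    using w_v_at_DERIV[OF assms] DERIV_unique by blast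
  then show ?thesis using q_pos[OF assms] \<delta>_nz q3_pos[OF assms] by (simp add: field_simps)
qed

lemma deriv_s_at:
  assumes "s \<in> {sm<..<sp}"
  shows "deriv (s_of_w \<tau> \<omega>) (w (v_at s)) = sqrt (poly q3 s)"
proof -
  have "((\<lambda>s. s_of_w \<tau> \<omega> (w (v_at s))) has_real_derivative
      deriv (s_of_w \<tau> \<omega>) (w (v_at s)) * (1 / sqrt (poly q3 s))) (at s)"
    by (rule DERIV_chain2[OF s_of_w_DERIV[OF w_height] w_v_at_DERIV[OF assms]])
  moreover have "((\<lambda>s. s_of_w \<tau> \<omega> (w (v_at s))) has_real_derivative 1) (at s)"
    by (rule has_field_derivative_transform_within_open[OF DERIV_ident open_greaterThanLessThan assms])
       (use \<sigma>_at in \<open>auto simp: \<sigma>_def\<close>)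
  ultimately have "deriv (s_of_w \<tau> \<omega>) (w (v_at s)) * (1 / sqrt (poly q3 s)) = 1"
    using DERIV_unique by blast
  then show ?thesis using q3_pos[OF assms] by (simp add: field_simps)
qed

lemma deriv_deriv_s_at:
  assumes "s \<in> {sm<..<sp}"
  shows "deriv (deriv (s_of_w \<tau> \<omega>)) (w (v_at s)) = poly (pderiv q3) s / 2"
proof -
  have "((\<lambda>s. deriv (s_of_w \<tau> \<omega>) (w (v_at s))) has_real_derivative
      deriv (deriv (s_of_w \<tau> \<omega>)) (w (v_at s)) * (1 / sqrt (poly q3 s))) (at s)"
    by (rule DERIV_chain2[OF deriv_s_of_w_DERIV[OF w_height] w_v_at_DERIV[OF assms]])
  moreover have "((\<lambda>s. deriv (s_of_w \<tau> \<omega>) (w (v_at s))) has_real_derivative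
      poly (pderiv q3) s * (inverse (sqrt (poly q3 s)) / 2)) (at s)"
  proof (rule has_field_derivative_transform_within_open[OF _ open_greaterThanLessThan assms])
    show "((\<lambda>s. sqrt (poly q3 s)) has_real_derivative poly (pderiv q3) s * (inverse (sqrt (poly q3 s)) / 2)) (at s)"
      using q3_pos[OF assms] by (auto intro!: derivative_eq_intros)
  qed (simp add: deriv_s_at)
  ultimately have "deriv (deriv (s_of_w \<tau> \<omega>)) (w (v_at s)) * (1 / sqrt (poly q3 s))
      = poly (pderiv q3) s * (inverse (sqrt (poly q3 s)) / 2)"
    using DERIV_unique by blast
  then show ?thesis using q3_pos[OF assms] by (simp add: field_simps)
qed

lemma r_at:
  assumes "s \<in> {sm<..<sp}"
  shows "r (v_at s) = (s - s1) * (s - s2) / (\<delta> * sqrt (poly q3 s))"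
  using r_eq[rule_format, of "v_at s"] \<sigma>_at[of s] assms by (simp add: \<sigma>_def deriv_s_at)

end

section \<open>The axis in the moving frame\<close>

text \<open>
  The polynomial identities behind \<open>axis_ODE\<close>, with \<open>x\<close> and \<open>S\<close> for the square roots of \<open>Q\<close> and \<open>Q\<^sub>3\<close>, \<open>P\<close> for
  \<open>(s - s1)(s - s2)\<close>, and \<open>P1\<close>, \<open>D\<close> for the derivatives of \<open>P\<close> and \<open>Q\<^sub>3\<close>. All three come down to \<open>s D = 2 (R + S\<^sup>2)\<close> and the
  identity \<open>key\<close>.
\<close>

lemma axis_algebra:
  fixes s s1 s2 U U1 V V2 \<delta>2 x S P P1 D R K :: real
  assumes nz: "s \<noteq> 0" "U \<noteq> 0" "x \<noteq> 0" "S \<noteq> 0"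
    and P: "P = (s - s1) * (s - s2)" "P1 = 2 * s - s1 - s2"
    and R: "R = U1 * s ^ 3 + V * s + U\<^sup>2" and K: "K = (V + s1 * s2 * U1) / U\<^sup>2"
    and x: "x\<^sup>2 = - P\<^sup>2 + \<delta>2 * S\<^sup>2"
    and S: "S\<^sup>2 = 2 * U1 * s ^ 3 - V2 * s\<^sup>2 - 2 * V * s - U\<^sup>2"
    and D: "D = 6 * U1 * s\<^sup>2 - 2 * V2 * s - 2 * V"
  shows "- (U1 / U) * (((- 2 * P * P1 + \<delta>2 * D) / (2 * x) * S - x * (D / (2 * S))) / S\<^sup>2)
      = - 2 * (P / (x * S)) * (U / (2 * s) * (K + 1 / s) + R / (2 * s * S) * (- S / (U * s) + U1 * P / (U * S)))"
    and "- 1 / s\<^sup>2 = (- S / (U * s) + U1 * P / (U * S)) * (U / (s * S))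
        + 2 * (P / (x * S)) * (- (U1 / U) * (x / S)) * (U / (2 * s))"
    and "- ((D / (2 * S) * s - S) / s\<^sup>2) / U + U1 / U * ((P1 * S - P * (D / (2 * S))) / S\<^sup>2)
      = - (K + 1 / s) * (U / (s * S)) + 2 * (P / (x * S)) * (- (U1 / U) * (x / S)) * (R / (2 * s * S))"
proof -
  have DR: "s * D = 2 * (R + S\<^sup>2)"
    unfolding D R S by (simp add: power2_eq_square power3_eq_cube algebra_simps)
  have KU: "K * U\<^sup>2 = V + s1 * s2 * U1" using nz by (simp add: K)
  have key: "U1 * (s * P - s\<^sup>2 * P1) = K * U\<^sup>2 * s + U\<^sup>2 - R"
    unfolding KU R P by (simp add: power2_eq_square power3_eq_cube algebra_simps)
  have \<delta>S: "\<delta>2 * S\<^sup>2 = x\<^sup>2 + P\<^sup>2" using x by simp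
  have "(- 2 * P * P1 + \<delta>2 * D) / (2 * x) * S - x * (D / (2 * S)) = ((- 2 * P * P1 + \<delta>2 * D) * S\<^sup>2 - x\<^sup>2 * D) / (2 * x * S)"
    using nz by (simp add: field_simps power2_eq_square)
  also have "(- 2 * P * P1 + \<delta>2 * D) * S\<^sup>2 - x\<^sup>2 * D = - 2 * P * P1 * S\<^sup>2 + D * (\<delta>2 * S\<^sup>2 - x\<^sup>2)"
    by (simp add: algebra_simps)
  also have "\<dots> = P * (P * D - 2 * P1 * S\<^sup>2)" unfolding \<delta>S by (simp add: power2_eq_square algebra_simps)
  finally have m0: "(- 2 * P * P1 + \<delta>2 * D) / (2 * x) * S - x * (D / (2 * S)) = P * (P * D - 2 * P1 * S\<^sup>2) / (2 * x * S)" .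
  have l: "- (U1 / U) * (((- 2 * P * P1 + \<delta>2 * D) / (2 * x) * S - x * (D / (2 * S))) / S\<^sup>2)
      = - (P / (x * U * S ^ 3 * s\<^sup>2)) * (U1 * s\<^sup>2 * (P * D - 2 * P1 * S\<^sup>2) / 2)"
    unfolding m0 using nz by (simp add: field_simps power2_eq_square power3_eq_cube)
  have "U1 * s\<^sup>2 * (P * D - 2 * P1 * S\<^sup>2) / 2 = U1 * (s * P * (s * D) / 2 - s\<^sup>2 * P1 * S\<^sup>2)"
    by (simp add: power2_eq_square field_simps)
  also have "\<dots> = U1 * s * P * R + S\<^sup>2 * (U1 * (s * P - s\<^sup>2 * P1))"
    unfolding DR by (simp add: algebra_simps)
  also have "\<dots> = U1 * s * P * R + S\<^sup>2 * (K * U\<^sup>2 * s + U\<^sup>2 - R)" unfolding key ..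
  finally have m: "U1 * s\<^sup>2 * (P * D - 2 * P1 * S\<^sup>2) / 2 = U1 * s * P * R + S\<^sup>2 * (K * U\<^sup>2 * s + U\<^sup>2 - R)" .
  show "- (U1 / U) * (((- 2 * P * P1 + \<delta>2 * D) / (2 * x) * S - x * (D / (2 * S))) / S\<^sup>2)
      = - 2 * (P / (x * S)) * (U / (2 * s) * (K + 1 / s) + R / (2 * s * S) * (- S / (U * s) + U1 * P / (U * S)))"
    unfolding l m using nz by (simp add: field_simps power2_eq_square power3_eq_cube)
  show "- 1 / s\<^sup>2 = (- S / (U * s) + U1 * P / (U * S)) * (U / (s * S))
        + 2 * (P / (x * S)) * (- (U1 / U) * (x / S)) * (U / (2 * s))"
    using nz by (simp add: field_simps power2_eq_square)
  have t1: "- ((D / (2 * S) * s - S) / s\<^sup>2) / U = (- (s * D / 2 - S\<^sup>2) * S\<^sup>2) / (U * S ^ 3 * s\<^sup>2)"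
    using nz by (simp add: field_simps power2_eq_square power3_eq_cube)
  have t2: "U1 / U * ((P1 * S - P * (D / (2 * S))) / S\<^sup>2)
      = (U1 * (s\<^sup>2 * P1 * S\<^sup>2 - s * P * (s * D / 2))) / (U * S ^ 3 * s\<^sup>2)"
    using nz by (simp add: field_simps power2_eq_square power3_eq_cube)
  have "- ((D / (2 * S) * s - S) / s\<^sup>2) / U + U1 / U * ((P1 * S - P * (D / (2 * S))) / S\<^sup>2)
      = (- (s * D / 2 - S\<^sup>2) * S\<^sup>2 + U1 * (s\<^sup>2 * P1 * S\<^sup>2 - s * P * (s * D / 2))) / (U * S ^ 3 * s\<^sup>2)"
    unfolding t1 t2 add_divide_distrib ..
  also have "- (s * D / 2 - S\<^sup>2) * S\<^sup>2 + U1 * (s\<^sup>2 * P1 * S\<^sup>2 - s * P * (s * D / 2))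
      = - R * S\<^sup>2 - S\<^sup>2 * (U1 * (s * P - s\<^sup>2 * P1)) - U1 * s * P * R"
    unfolding DR by (simp add: field_simps power2_eq_square)
  also have "\<dots> = - S\<^sup>2 * (K * U\<^sup>2 * s + U\<^sup>2) - U1 * s * P * R" unfolding key by (simp add: algebra_simps)
  finally have m2: "- ((D / (2 * S) * s - S) / s\<^sup>2) / U + U1 / U * ((P1 * S - P * (D / (2 * S))) / S\<^sup>2)
      = (- S\<^sup>2 * (K * U\<^sup>2 * s + U\<^sup>2) - U1 * s * P * R) / (U * S ^ 3 * s\<^sup>2)" .
  show "- ((D / (2 * S) * s - S) / s\<^sup>2) / U + U1 / U * ((P1 * S - P * (D / (2 * S))) / S\<^sup>2)
      = - (K + 1 / s) * (U / (s * S)) + 2 * (P / (x * S)) * (- (U1 / U) * (x / S)) * (R / (2 * s * S))"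
    unfolding m2 using nz by (simp add: field_simps power2_eq_square power3_eq_cube)
qed

context rhombic_cylinder
begin

text \<open>
  The unit vector along \<open>f\<close> on \<open>u = \<omega>\<close>. Together with \<open>\<i> e\<close> and the normal of the curvature plane it is the
  orthonormal frame in which the axis is expressed.
\<close>

definition e :: "real \<Rightarrow> complex" where "e v = of_real U * \<gamma> \<omega> (w v)"

abbreviation "W v \<equiv> W1 \<tau> \<omega> (w v)"

lemma cmod_e: "cmod (e v) = 1"
  using U_nz by (simp add: e_def norm_mult cmod_planar_curve_\<omega>[OF w_height])

lemma e_cnj: "e v * cnj (e v) = 1"
  using complex_norm_square[of "e v"] by (simp add: cmod_e)

lemma \<gamma>_\<omega>: "\<gamma> \<omega> (w v) = e v / U"
  using U_nz by (simp add: e_def)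

lemma curve_u_e: "curve_u \<omega> (w v) = e v / \<sigma> v"
  by (simp add: curve_u_\<omega>[OF w_height] e_def \<sigma>_def)

lemma e_DERIV: "(e has_vector_derivative \<i> * of_real (U * deriv w v / \<sigma> v) * e v) (at v)"
proof -
  have "((\<lambda>v. \<gamma> \<omega> (w v)) has_vector_derivative deriv w v *\<^sub>R (\<i> * curve_u \<omega> (w v))) (at v)"
    using vector_diff_chain_at[of w "deriv w v" v "\<gamma> \<omega>", OF _ planar_curve_has_vector_derivative_w[OF w_height]]
      w_DERIV[of v] by (simp add: o_def has_real_derivative_iff_has_vector_derivative)
  then have "((\<lambda>v. of_real U * \<gamma> \<omega> (w v)) has_vector_derivative of_real U * (deriv w v *\<^sub>R (\<i> * curve_u \<omega> (w v)))) (at v)"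
    by (rule has_vector_derivative_mult_right)
  then show ?thesis
    by (simp add: e_def[abs_def] curve_u_e[unfolded e_def] scaleR_conv_of_real mult_ac)
qed

lemma Re_W: "Re (W v * cnj (e v)) = U / (2 * \<sigma> v)"
proof -
  have "2 * Re (\<gamma> \<omega> (w v) * cnj (W v)) = cmod (curve_u \<omega> (w v))"
    unfolding isothermic_identity[OF w_height] by (simp add: curve_u_def norm_mult norm_power)
  also have "\<dots> = 1 / \<sigma> v" using \<sigma>_pos[of v] by (simp add: curve_u_e norm_divide cmod_e)
  finally have "Re (\<gamma> \<omega> (w v) * cnj (W v)) = 1 / (2 * \<sigma> v)" by simp
  moreover have "W v * cnj (e v) = of_real U * cnj (\<gamma> \<omega> (w v) * cnj (W v))"
    by (simp add: e_def)
  then have "Re (W v * cnj (e v)) = U * Re (\<gamma> \<omega> (w v) * cnj (W v))"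
    by (simp only: mult.commute[of "of_real U"]) simp
  ultimately show ?thesis by simp
qed

text \<open>
  This is \<open>s Q\<^sub>3'(s)/2 - Q\<^sub>3(s)\<close>.
\<close>

definition RR :: "real \<Rightarrow> real" where "RR s = U1' * s ^ 3 + U' * s + U\<^sup>2"

lemma poly_pderiv_q3: "poly (pderiv q3) s = 6 * U1' * s\<^sup>2 - 2 * U2 * s - 2 * U'"
  by (simp add: Q3_def pderiv_pCons power2_eq_square algebra_simps)

lemma Im_W:
  assumes s: "s \<in> {sm<..<sp}"
  shows "Im (W (v_at s) * cnj (e (v_at s))) = RR s / (2 * s * sqrt (poly q3 s))"
proof -
  have sp: "s > 0" using s sm_pos by simp
  have \<sigma>: "\<sigma> (v_at s) = s" "s_of_w \<tau> \<omega> (w (v_at s)) = s"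
    using \<sigma>_at[of s] s by (simp_all add: \<sigma>_def)
  define I where "I = Im (W (v_at s) * cnj (e (v_at s)))"
  have "Im (curve_u \<omega> (w (v_at s)) * cnj (W (v_at s))) = - I / s"
    by (simp add: I_def curve_u_e \<sigma> algebra_simps diff_divide_distrib)
  then have "2 * s\<^sup>2 * sqrt (poly q3 s) * (- I / s) = poly q3 s - s * (poly (pderiv q3) s / 2)"
    using Im_curve_u_W1[OF w_height, of "v_at s"] q3_pos[OF s]
    unfolding \<sigma>(2) deriv_s_at[OF s] deriv_deriv_s_at[OF s] by simp
  also have "\<dots> = - RR s"
    by (simp add: poly_q3 poly_pderiv_q3 RR_def power2_eq_square power3_eq_cube field_simps)
  finally have "2 * s\<^sup>2 * sqrt (poly q3 s) * (- I / s) = - RR s" .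
  then have "I = RR s / (2 * s * sqrt (poly q3 s))"
    using sp q3_pos[OF s] by (simp add: field_simps power2_eq_square)
  then show ?thesis by (simp only: I_def)
qed

lemma norm_\<Phi>: "norm (\<Phi> v) = 1"
  using cylinder by (simp add: isothermic_planar_cylinder_def)

lemma \<Phi>_nz: "\<Phi> v \<noteq> 0" using norm_\<Phi>[of v] by auto

definition A :: "real \<Rightarrow> quat" where "A v = Quat 0 (\<i> * (of_real (r v) * W v))"

lemma \<Phi>_DERIV: "(\<Phi> has_vector_derivative A v * \<Phi> v) (at v)"
proof -
  have "quat_of_complex (r v * W v) * quat_k = A v"
    by (simp add: quat_of_complex_def quat_k_def A_def quat_eq_iff mult_ac)
  then show ?thesis using cylinder unfolding isothermic_planar_cylinder_def by metis
qed

lemma f_eq: "f u v = rot (\<Phi> v) (qvec 0 (\<gamma> u (w v)))"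
proof -
  have "quat_of_complex (\<gamma> u (w v)) * quat_j = qvec 0 (\<gamma> u (w v))"
    by (simp add: quat_of_complex_def quat_j_def quat_eq_iff)
  then show ?thesis using cylinder unfolding isothermic_planar_cylinder_def rot_def by metis
qed

text \<open>
  The coordinates of the axis with respect to the normal, \<open>e\<close> and \<open>\<i> e\<close>. They result from the ansatz that the
  \<open>e\<close>-coordinate is a constant plus \<open>1/s\<close>: the equation for it determines one linear combination of the other two,
  and the length is constant only if the free factor in front of \<open>sqrt Q\<close> is \<open>- U\<^sub>1'/(U sqrt Q\<^sub>3)\<close>. The constant is then the
  one in \<open>Q2_tilde\<close>.
\<close>

definition axis_a :: "real \<Rightarrow> real" where
  "axis_a s = - (U1' / U) * (sqrt (poly q s) / sqrt (poly q3 s))"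
definition axis_b1 :: "real \<Rightarrow> real" where
  "axis_b1 s = (U' + s1 * s2 * U1') / U\<^sup>2 + 1 / s"
definition axis_b2 :: "real \<Rightarrow> real" where
  "axis_b2 s = - sqrt (poly q3 s) / (U * s) + U1' * ((s - s1) * (s - s2)) / (U * sqrt (poly q3 s))"
definition \<xi> :: "real \<Rightarrow> quat" where
  "\<xi> s = qvec (axis_a s) (Complex (axis_b1 s) (axis_b2 s) * e (v_at s))"
text \<open>
  This is \<open>r dv/ds\<close>, the coefficient of the frame equation in the variable \<open>s\<close>.
\<close>

definition \<rho> :: "real \<Rightarrow> real" where
  "\<rho> s = (s - s1) * (s - s2) / (sqrt (poly q s) * sqrt (poly q3 s))"

lemma axis_ODE:
  assumes s: "s \<in> {sm<..<sp}"
  defines "S \<equiv> sqrt (poly q3 s)"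
  shows "(axis_a has_real_derivative
      - 2 * \<rho> s * (U / (2 * s) * axis_b1 s + RR s / (2 * s * S) * axis_b2 s)) (at s)"
    and "(axis_b1 has_real_derivative axis_b2 s * (U / (s * S)) + 2 * \<rho> s * axis_a s * (U / (2 * s))) (at s)"
    and "(axis_b2 has_real_derivative - axis_b1 s * (U / (s * S)) + 2 * \<rho> s * axis_a s * (RR s / (2 * s * S))) (at s)"
proof -
  define x where "x = sqrt (poly q s)"
  define P where "P = (s - s1) * (s - s2)"
  define P1 where "P1 = 2 * s - s1 - s2"
  define D where "D = poly (pderiv q3) s"
  have nz: "s \<noteq> 0" "x \<noteq> 0" "S \<noteq> 0" "x > 0" "S > 0"
    using sm_pos s q_pos[OF s] q3_pos[OF s] by (auto simp: x_def S_def)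
  have sq: "x\<^sup>2 = poly q s" "S\<^sup>2 = poly q3 s" using q_pos[OF s] q3_pos[OF s] by (simp_all add: x_def S_def)
  note alg = axis_algebra[where x=x and S=S and P=P and ?P1.0=P1 and D=D and ?\<delta>2.0="\<delta>\<^sup>2" and R="RR s" and K="(U' + s1 * s2 * U1') / U\<^sup>2",
      OF nz(1) U_nz nz(2,3) P_def P1_def RR_def refl sq(1)[unfolded poly_q, folded P_def sq(2)] sq(2)[unfolded poly_q3] D_def[unfolded poly_pderiv_q3]]
  have \<rho>: "\<rho> s = P / (x * S)" by (simp add: \<rho>_def P_def x_def S_def)
  have vals: "axis_a s = - (U1' / U) * (x / S)" "axis_b1 s = (U' + s1 * s2 * U1') / U\<^sup>2 + 1 / s"
    "axis_b2 s = - S / (U * s) + U1' * P / (U * S)"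
    by (simp_all add: axis_a_def axis_b1_def axis_b2_def x_def S_def P_def)
  have dP: "((\<lambda>s. (s - s1) * (s - s2)) has_real_derivative P1) (at s)"
    by (auto intro!: derivative_eq_intros simp: P1_def algebra_simps)
  have dS: "((\<lambda>s. sqrt (poly q3 s)) has_real_derivative D / (2 * S)) (at s)"
    using q3_pos[OF s] by (auto intro!: derivative_eq_intros simp: D_def S_def field_simps)
  have dq: "(poly q has_real_derivative - 2 * P * P1 + \<delta>\<^sup>2 * D) (at s)"
  proof -
    have "((\<lambda>s. - ((s - s1) * (s - s2))\<^sup>2 + \<delta>\<^sup>2 * poly q3 s) has_real_derivative - 2 * P * P1 + \<delta>\<^sup>2 * D) (at s)"
      by (rule derivative_eq_intros dP refl)+ (simp add: P_def D_def)
    then show ?thesis by (simp add: poly_q[abs_def] flip: poly_q)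
  qed
  have dx: "((\<lambda>s. sqrt (poly q s)) has_real_derivative (- 2 * P * P1 + \<delta>\<^sup>2 * D) / (2 * x)) (at s)"
    using DERIV_chain2[OF DERIV_real_sqrt[OF q_pos[OF s]] dq] by (simp add: x_def field_simps)
  have da: "(axis_a has_real_derivative - (U1' / U) * (((- 2 * P * P1 + \<delta>\<^sup>2 * D) / (2 * x) * S - x * (D / (2 * S))) / S\<^sup>2)) (at s)"
    unfolding axis_a_def using DERIV_cmult[OF DERIV_divide[OF dx dS], of "- (U1' / U)"] nz
    by (simp add: x_def[symmetric] S_def[symmetric] power2_eq_square)
  show "(axis_a has_real_derivative
      - 2 * \<rho> s * (U / (2 * s) * axis_b1 s + RR s / (2 * s * S) * axis_b2 s)) (at s)"
    using da unfolding \<rho> vals(2,3) alg(1) .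
  have db1: "(axis_b1 has_real_derivative - 1 / s\<^sup>2) (at s)"
    unfolding axis_b1_def using nz by (auto intro!: derivative_eq_intros simp: power2_eq_square)
  show "(axis_b1 has_real_derivative axis_b2 s * (U / (s * S)) + 2 * \<rho> s * axis_a s * (U / (2 * s))) (at s)"
    using db1 unfolding \<rho> vals(1,3) alg(2) .
  have 1: "((\<lambda>s. sqrt (poly q3 s) / s) has_real_derivative (D / (2 * S) * s - S) / s\<^sup>2) (at s)"
    using DERIV_divide[OF dS DERIV_ident nz(1)] by (simp add: S_def[symmetric] power2_eq_square)
  have 2: "((\<lambda>s. (s - s1) * (s - s2) / sqrt (poly q3 s)) has_real_derivative (P1 * S - P * (D / (2 * S))) / S\<^sup>2) (at s)"
    using DERIV_divide[OF dP dS] nz by (simp add: S_def[symmetric] P_def[symmetric] power2_eq_square)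
  have "((\<lambda>s. - (sqrt (poly q3 s) / s) / U + U1' / U * ((s - s1) * (s - s2) / sqrt (poly q3 s))) has_real_derivative
      - ((D / (2 * S) * s - S) / s\<^sup>2) / U + U1' / U * ((P1 * S - P * (D / (2 * S))) / S\<^sup>2)) (at s)"
    by (intro DERIV_add DERIV_cmult DERIV_cdivide DERIV_minus 1 2)
  moreover have "(\<lambda>s. - (sqrt (poly q3 s) / s) / U + U1' / U * ((s - s1) * (s - s2) / sqrt (poly q3 s))) = axis_b2"
    by (simp add: axis_b2_def[abs_def] mult_ac)
  ultimately have db2: "(axis_b2 has_real_derivative - ((D / (2 * S) * s - S) / s\<^sup>2) / U + U1' / U * ((P1 * S - P * (D / (2 * S))) / S\<^sup>2)) (at s)"
    by simp
  show "(axis_b2 has_real_derivative - axis_b1 s * (U / (s * S)) + 2 * \<rho> s * axis_a s * (RR s / (2 * s * S))) (at s)"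
    using db2 unfolding \<rho> vals(1,2) alg(3) .
qed

text \<open>
  This is the origin of the formula for \<open>Z\<^sub>0\<close>: the sum of the first and third square is \<open>Q2_tilde/s\<^sup>2\<close>.
\<close>

lemma axis_norm:
  assumes s: "s \<in> {sm<..<sp}"
  shows "(axis_a s)\<^sup>2 + (axis_b1 s)\<^sup>2 + (axis_b2 s)\<^sup>2 = Z0\<^sup>2"
proof -
  define x where "x = sqrt (poly q s)"
  define S where "S = sqrt (poly q3 s)"
  define P where "P = (s - s1) * (s - s2)"
  define k where "k = U' + s1 * s2 * U1'"
  have nz: "s \<noteq> 0" "x \<noteq> 0" "S \<noteq> 0" "U \<noteq> 0"
    using sm_pos s q_pos[OF s] q3_pos[OF s] U_nz by (auto simp: x_def S_def)
  have sq: "x\<^sup>2 = - P\<^sup>2 + \<delta>\<^sup>2 * S\<^sup>2" "S\<^sup>2 = poly q3 s"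
    using q_pos[OF s] q3_pos[OF s] by (simp_all add: x_def S_def P_def poly_q)
  have "(axis_a s)\<^sup>2 + (axis_b2 s)\<^sup>2
      = (U1'\<^sup>2 * s\<^sup>2 * (x\<^sup>2 + P\<^sup>2) / S\<^sup>2 + S\<^sup>2 - 2 * U1' * P * s) / (U\<^sup>2 * s\<^sup>2)"
    unfolding axis_a_def axis_b2_def x_def[symmetric] S_def[symmetric] P_def[symmetric]
    using nz by (simp add: field_simps power2_eq_square)
  also have "U1'\<^sup>2 * s\<^sup>2 * (x\<^sup>2 + P\<^sup>2) / S\<^sup>2 = U1'\<^sup>2 * s\<^sup>2 * \<delta>\<^sup>2"
    unfolding sq(1) using nz by simp
  also have "U1'\<^sup>2 * s\<^sup>2 * \<delta>\<^sup>2 + S\<^sup>2 - 2 * U1' * P * s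
      = (2 * (s1 + s2) * U1' + \<delta>\<^sup>2 * U1'\<^sup>2 - U2) * s\<^sup>2 - 2 * k * s - U\<^sup>2"
    unfolding sq(2) poly_q3 P_def k_def by (simp add: power2_eq_square power3_eq_cube algebra_simps)
  finally have 1: "(axis_a s)\<^sup>2 + (axis_b2 s)\<^sup>2
      = ((2 * (s1 + s2) * U1' + \<delta>\<^sup>2 * U1'\<^sup>2 - U2) * s\<^sup>2 - 2 * k * s - U\<^sup>2) / (U\<^sup>2 * s\<^sup>2)" .
  have 2: "(axis_b1 s)\<^sup>2 = (k\<^sup>2 * s\<^sup>2 / U\<^sup>2 + 2 * k * s + U\<^sup>2) / (U\<^sup>2 * s\<^sup>2)"
    unfolding axis_b1_def k_def[symmetric] using nz by (simp add: field_simps power2_eq_square)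
  have "(axis_a s)\<^sup>2 + (axis_b1 s)\<^sup>2 + (axis_b2 s)\<^sup>2
      = ((2 * (s1 + s2) * U1' + \<delta>\<^sup>2 * U1'\<^sup>2 - U2) * s\<^sup>2 + k\<^sup>2 * s\<^sup>2 / U\<^sup>2) / (U\<^sup>2 * s\<^sup>2)"
    using 1 2 by (simp add: add_divide_distrib diff_divide_distrib)
  also have "\<dots> = Z0\<^sup>2"
    unfolding Z0_sq k_def[symmetric] using nz by (simp add: add_divide_distrib power2_eq_square power4_eq_xxxx)
  finally show ?thesis .
qed

lemma rot_\<Phi>_DERIV:
  assumes "(x has_vector_derivative x') (at v)"
  shows "((\<lambda>v. rot (\<Phi> v) (x v)) has_vector_derivative rot (\<Phi> v) (x' + (x v * A v - A v * x v))) (at v)"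
  by (rule rot_has_vector_derivative[OF \<Phi>_DERIV \<Phi>_nz assms])

lemma \<Phi>_at_DERIV:
  assumes s: "s \<in> {sm<..<sp}"
  shows "((\<lambda>s. \<Phi> (v_at s)) has_vector_derivative Quat 0 (\<i> * (of_real (\<rho> s) * W (v_at s))) * \<Phi> (v_at s)) (at s)"
proof -
  have "((\<lambda>s. \<Phi> (v_at s)) has_vector_derivative (\<delta> / sqrt (poly q s)) *\<^sub>R (A (v_at s) * \<Phi> (v_at s))) (at s)"
    using vector_diff_chain_at[of v_at "\<delta> / sqrt (poly q s)" s \<Phi>, OF _ \<Phi>_DERIV] v_at_DERIV[OF s]
    by (simp add: o_def has_real_derivative_iff_has_vector_derivative)
  moreover have "(\<delta> / sqrt (poly q s)) *\<^sub>R A (v_at s) = Quat 0 (\<i> * (of_real (\<rho> s) * W (v_at s)))"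
  proof -
    have "\<rho> s = \<delta> / sqrt (poly q s) * r (v_at s)"
      unfolding r_at[OF s] \<rho>_def using \<delta>_nz by simp
    moreover have "c *\<^sub>R Quat 0 z = Quat 0 (of_real c * z)" for c z
      by (simp add: scaleR_quat_def scaleR_conv_of_real[where 'a = complex])
    ultimately show ?thesis by (simp add: A_def mult_ac)
  qed
  ultimately show ?thesis by (simp only: mult_scaleR_left[symmetric])
qed

lemma e_at_DERIV:
  assumes s: "s \<in> {sm<..<sp}"
  shows "((\<lambda>s. e (v_at s)) has_vector_derivative \<i> * of_real (U / (s * sqrt (poly q3 s))) * e (v_at s)) (at s)"
proof -
  have "((\<lambda>s. e (v_at s)) has_vector_derivative
      (\<delta> / sqrt (poly q s)) *\<^sub>R (\<i> * of_real (U * deriv w (v_at s) / \<sigma> (v_at s)) * e (v_at s))) (at s)"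
    using vector_diff_chain_at[of v_at "\<delta> / sqrt (poly q s)" s e, OF _ e_DERIV] v_at_DERIV[OF s]
    by (simp add: o_def has_real_derivative_iff_has_vector_derivative)
  moreover have scale: "d *\<^sub>R (\<i> * of_real x * z) = \<i> * of_real (d * x) * z" for d x and z :: complex
    by (simp add: scaleR_conv_of_real mult_ac)
  moreover have "\<delta> / sqrt (poly q s) * (U * deriv w (v_at s) / \<sigma> (v_at s)) = U / (s * sqrt (poly q3 s))"
    using \<delta>_nz q_pos[OF s] s \<sigma>_at[of s] by (simp add: deriv_w_at)
  then have "(\<delta> / sqrt (poly q s)) *\<^sub>R (\<i> * of_real (U * deriv w (v_at s) / \<sigma> (v_at s)) * e (v_at s))
      = \<i> * of_real (U / (s * sqrt (poly q3 s))) * e (v_at s)"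
    by (simp only: scale)
  ultimately show ?thesis by simp
qed

text \<open>
  The equations \<open>axis_ODE\<close> say that the derivative of the coordinates cancels the commutator in
  \<open>rot_has_vector_derivative\<close>, so the vector is at rest in space.
\<close>

lemma rot_\<xi>_DERIV:
  assumes s: "s \<in> {sm<..<sp}"
  shows "((\<lambda>s. rot (\<Phi> (v_at s)) (\<xi> s)) has_vector_derivative 0) (at s)"
proof -
  define S where "S = sqrt (poly q3 s)"
  define k where "k = U / (s * S)"
  define b where "b = Complex (axis_b1 s) (axis_b2 s)"
  define ev where "ev = e (v_at s)"
  define p where "p = U / (2 * s)"
  define qq where "qq = RR s / (2 * s * S)"
  define R where "R = \<rho> s"
  define a where "a = axis_a s"
  define a' where "a' = - 2 * R * (p * axis_b1 s + qq * axis_b2 s)"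
  define b' where "b' = Complex (axis_b2 s * k + 2 * R * a * p) (- axis_b1 s * k + 2 * R * a * qq)"
  have Da: "(axis_a has_real_derivative a') (at s)"
    using axis_ODE(1)[OF s] by (simp only: a'_def R_def p_def qq_def S_def)
  have "((\<lambda>s. Complex (axis_b1 s) (axis_b2 s)) has_vector_derivative b') (at s)"
    unfolding has_vector_derivative_complex_iff b'_def using axis_ODE(2,3)[OF s] by (simp add: k_def p_def qq_def R_def a_def S_def)
  then have "((\<lambda>s. Complex (axis_b1 s) (axis_b2 s) * e (v_at s)) has_vector_derivative
      b * (\<i> * of_real k * ev) + b' * ev) (at s)"
    using e_at_DERIV[OF s] unfolding b_def ev_def k_def S_def by (intro has_vector_derivative_mult)
  then have "(\<xi> has_vector_derivative qvec a' (b * (\<i> * of_real k * ev) + b' * ev)) (at s)"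
    unfolding \<xi>_def by (intro qvec_has_vector_derivative Da)
  then have "((\<lambda>s. rot (\<Phi> (v_at s)) (\<xi> s)) has_vector_derivative
      rot (\<Phi> (v_at s)) (qvec a' (b * (\<i> * of_real k * ev) + b' * ev)
        + (\<xi> s * Quat 0 (\<i> * (of_real (\<rho> s) * W (v_at s))) - Quat 0 (\<i> * (of_real (\<rho> s) * W (v_at s))) * \<xi> s))) (at s)"
    by (rule rot_has_vector_derivative[OF \<Phi>_at_DERIV[OF s] \<Phi>_nz])
  moreover have "qvec a' (b * (\<i> * of_real k * ev) + b' * ev)
        + (\<xi> s * Quat 0 (\<i> * (of_real (\<rho> s) * W (v_at s))) - Quat 0 (\<i> * (of_real (\<rho> s) * W (v_at s))) * \<xi> s) = 0"
  proof -
    have "W (v_at s) * cnj ev = Complex p qq"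
      using Re_W[of "v_at s"] Im_W[OF s] \<sigma>_at[of s] s
      by (simp add: complex_eq_iff ev_def p_def qq_def S_def)
    then have "W (v_at s) * (ev * cnj ev) = Complex p qq * ev" by (simp add: mult_ac)
    then have W: "W (v_at s) = Complex p qq * ev" by (simp add: ev_def e_cnj)
    have "W (v_at s) * cnj (b * ev) = Complex p qq * cnj b * (ev * cnj ev)" by (simp add: W mult_ac)
    then have "W (v_at s) * cnj (b * ev) = Complex p qq * cnj b" by (simp add: ev_def e_cnj)
    then have re: "Re (W (v_at s) * cnj (b * ev)) = p * axis_b1 s + qq * axis_b2 s"
      by (simp only:) (simp add: b_def)
    have "b * (\<i> * of_real k) + b' + (- 2 * of_real (R * a)) * Complex p qq = 0"
      by (simp add: complex_eq_iff b_def b'_def algebra_simps)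
    then have j: "b * (\<i> * of_real k * ev) + b' * ev + (- 2 * of_real (R * a) * W (v_at s)) = 0"
      unfolding W by (simp add: mult.assoc[symmetric] distrib_right[symmetric])
    show ?thesis
      unfolding \<xi>_def b_def[symmetric] ev_def[symmetric] a_def[symmetric] R_def[symmetric] qvec_commutator re
      using j by (simp add: quat_eq_iff a'_def)
  qed
  ultimately show ?thesis by (simp add: rot_def)
qed

definition X0 :: quat where "X0 = rot (\<Phi> (v_at ((sm + sp) / 2))) (\<xi> ((sm + sp) / 2))"

lemma rot_\<xi>_const:
  assumes s: "s \<in> {sm<..<sp}"
  shows "rot (\<Phi> (v_at s)) (\<xi> s) = X0"
proof -
  obtain c where "\<And>s. s \<in> {sm<..<sp} \<Longrightarrow> rot (\<Phi> (v_at s)) (\<xi> s) = c"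
    using has_vector_derivative_zero_constant[of "{sm<..<sp}" "\<lambda>s. rot (\<Phi> (v_at s)) (\<xi> s)"]
      rot_\<xi>_DERIV has_vector_derivative_at_within by blast
  then show ?thesis using s sm_sp unfolding X0_def by simp
qed

lemma norm_\<xi>:
  assumes s: "s \<in> {sm<..<sp}" shows "norm (\<xi> s) = Z0"
proof -
  have "(norm (\<xi> s))\<^sup>2 = (axis_a s)\<^sup>2 + (cmod (Complex (axis_b1 s) (axis_b2 s)))\<^sup>2"
    unfolding \<xi>_def norm_qvec norm_mult cmod_e by simp
  also have "\<dots> = Z0\<^sup>2" using axis_norm[OF s] by (simp add: cmod_power2)
  finally show ?thesis by (rule power2_eq_imp_eq) (use Z0_pos in auto)
qed

lemma mid: "(sm + sp) / 2 \<in> {sm<..<sp}" using sm_sp by simp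

lemma gauge_exists: "\<exists>g. norm g = 1 \<and> rot g ((1 / Z0) *\<^sub>R X0) = qvec 1 0"
proof -
  have "norm X0 = Z0" unfolding X0_def norm_rot[OF \<Phi>_nz] by (rule norm_\<xi>[OF mid])
  then have n: "norm ((1 / Z0) *\<^sub>R X0) = 1" using Z0_pos by simp
  have "Re (quat_C X0) = 0"
    unfolding X0_def Re_quat_C_rot[OF \<Phi>_nz] by (simp add: \<xi>_def)
  then have "(1 / Z0) *\<^sub>R X0 = qvec (Im (quat_C X0) / Z0) (quat_J X0 / of_real Z0)"
    by (simp add: quat_eq_iff complex_eq_iff)
  moreover obtain g where "norm g = 1" "rot g (qvec (Im (quat_C X0) / Z0) (quat_J X0 / of_real Z0)) = qvec 1 0"
    by (rule unit_imaginary_rot_to_axis[OF n[unfolded calculation]])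
  ultimately show ?thesis by auto
qed

text \<open>
  A fixed rotation of space that puts the axis into the direction \<open>\<^bold>i\<close>. Afterwards the axial component of a vector is
  the imaginary part of its first complex coordinate, and the component orthogonal to the axis is the second.
\<close>

definition g :: quat where "g = (SOME g. norm g = 1 \<and> rot g ((1 / Z0) *\<^sub>R X0) = qvec 1 0)"

lemma norm_g: "norm g = 1" and rot_g_X0: "rot g X0 = Z0 *\<^sub>R qvec 1 0"
proof -
  have "norm g = 1 \<and> rot g ((1 / Z0) *\<^sub>R X0) = qvec 1 0"
    unfolding g_def by (rule someI_ex[OF gauge_exists])
  then have n: "norm g = 1" and r: "(1 / Z0) *\<^sub>R rot g X0 = qvec 1 0" by (simp_all only: rot_scaleR)
  from n show "norm g = 1" .
  have "Z0 *\<^sub>R ((1 / Z0) *\<^sub>R rot g X0) = Z0 *\<^sub>R qvec 1 0" by (simp only: r)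
  then show "rot g X0 = Z0 *\<^sub>R qvec 1 0" using Z0_pos by simp
qed

lemma g_nz: "g \<noteq> 0" using norm_g by auto

definition \<Psi> :: "real \<Rightarrow> quat" where "\<Psi> v = \<Phi> v * g"

lemma \<Psi>_nz: "\<Psi> v \<noteq> 0" using \<Phi>_nz g_nz by (simp add: \<Psi>_def)

lemma rot_\<Psi>: "rot (\<Psi> v) x = rot g (rot (\<Phi> v) x)"
  by (simp add: \<Psi>_def rot_rot[OF \<Phi>_nz g_nz])

lemma \<Psi>_DERIV: "(\<Psi> has_vector_derivative A v * \<Psi> v) (at v)"
  using has_vector_derivative_mult_left[OF \<Phi>_DERIV, of g v] by (simp add: \<Psi>_def[abs_def] mult.assoc)

lemma rot_\<Psi>_\<xi>: "s \<in> {sm<..<sp} \<Longrightarrow> rot (\<Psi> (v_at s)) (\<xi> s) = Z0 *\<^sub>R qvec 1 0"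
  by (simp add: rot_\<Psi> rot_\<xi>_const rot_g_X0)

lemma axial_component:
  assumes s: "s \<in> {sm<..<sp}"
  shows "Im (quat_C (rot (\<Psi> (v_at s)) x)) = qdot x (\<xi> s) / Z0"
proof -
  have "Z0 * Im (quat_C (rot (\<Psi> (v_at s)) x)) = qdot (rot (\<Psi> (v_at s)) x) (rot (\<Psi> (v_at s)) (\<xi> s))"
    unfolding rot_\<Psi>_\<xi>[OF s] qdot_scaleR_right qdot_axis ..
  also have "\<dots> = qdot x (\<xi> s)" by (rule qdot_rot[OF \<Psi>_nz])
  finally show ?thesis using Z0_pos by (simp add: field_simps)
qed

text \<open>
  The normal vector of the curvature plane.
\<close>

definition E :: "real \<Rightarrow> quat" where "E v = rot (\<Psi> v) (qvec 1 0)"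

lemma rot_\<Psi>_DERIV:
  assumes "(x has_vector_derivative x') (at v)"
  shows "((\<lambda>v. rot (\<Psi> v) (x v)) has_vector_derivative rot (\<Psi> v) (x' + (x v * A v - A v * x v))) (at v)"
  by (rule rot_has_vector_derivative[OF \<Psi>_DERIV \<Psi>_nz assms])

lemma continuous_rot_\<Psi>: "continuous_on S (\<lambda>v. rot (\<Psi> v) x)"
  using rot_\<Psi>_DERIV[OF has_vector_derivative_const] has_vector_derivative_continuous
  by (intro continuous_at_imp_continuous_on ballI) blast

lemma axis_a_eq: "s \<in> {sm<..<sp} \<Longrightarrow> axis_a s = - (U1' / U) * \<delta> * deriv w (v_at s)"
  using \<delta>_nz by (simp add: axis_a_def deriv_w_at)

text \<open>
  The formula for \<open>axis_a\<close> breaks down at the ends of the oval, but written with \<open>w'\<close> it extends continuously.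
\<close>

lemma axial_E:
  assumes "s \<in> {sm..sp}"
  shows "Im (quat_C (E (v_at s))) = - (U1' / U) * \<delta> * deriv w (v_at s) / Z0"
proof -
  define h where "h s = Im (quat_C (E (v_at s))) + (U1' / U) * \<delta> * deriv w (v_at s) / Z0" for s
  have "continuous_on {sm..sp} (\<lambda>s. E (v_at s))"
    unfolding E_def by (rule continuous_on_compose2[OF continuous_rot_\<Psi>[of UNIV] continuous_on_v_at]) auto
  then have "continuous_on {sm..sp} (\<lambda>s. quat_C (E (v_at s)))"
    by (rule bounded_linear.continuous_on[OF bounded_linear_quat_C])
  moreover have "continuous_on {sm..sp} (\<lambda>s. deriv w (v_at s))"
    by (rule continuous_on_compose2[OF _ continuous_on_v_at, of UNIV])
       (use isCont_deriv_w in \<open>auto intro: continuous_at_imp_continuous_on\<close>)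
  ultimately have "continuous_on (closure {sm<..<sp}) h"
    unfolding h_def using sm_sp Z0_pos U_nz by (auto intro!: continuous_intros)
  moreover have "h s = 0" if s: "s \<in> {sm<..<sp}" for s
    using axial_component[OF s, of "qvec 1 0"] axis_a_eq[OF s] by (simp add: h_def E_def \<xi>_def qdot_qvec)
  ultimately have "h s = 0"
    using continuous_constant_on_closure[of "{sm<..<sp}" h 0 s] assms sm_sp by auto
  then show ?thesis by (simp add: h_def)
qed

section \<open>Monodromy\<close>

lemma deriv_w_reflect:
  assumes "\<And>t. w (c - t) = w (c + t)"
  shows "deriv w (c + t) = - deriv w (c - t)"
proof -
  have "((\<lambda>t. w (c + t)) has_real_derivative deriv w (c + t) * 1) (at t)"
    by (rule DERIV_chain2[OF w_DERIV]) (auto intro!: derivative_eq_intros)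
  moreover have "((\<lambda>t. w (c - t)) has_real_derivative deriv w (c - t) * (- 1)) (at t)"
    by (rule DERIV_chain2[OF w_DERIV]) (auto intro!: derivative_eq_intros)
  ultimately show ?thesis unfolding assms using DERIV_unique by fastforce
qed

lemma deriv_w_ends: "deriv w v0 = 0" "deriv w v1 = 0"
  using deriv_w_reflect[OF w_reflect0, of 0] deriv_w_reflect[OF w_reflect1, of 0] by simp_all

lemma norm_E: "norm (E v) = 1"
proof -
  have "(norm (qvec 1 0))\<^sup>2 = 1\<^sup>2" unfolding norm_qvec by simp
  then have "norm (qvec 1 0) = 1" by (rule power2_eq_imp_eq) auto
  then show ?thesis by (simp add: E_def norm_rot[OF \<Psi>_nz])
qed

definition c0 :: complex where "c0 = quat_J (E v0)"
definition c1 :: complex where "c1 = quat_J (E v1)"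

lemma E_ends: "E v0 = Quat 0 c0" "E v1 = Quat 0 c1" and cmod_c: "cmod c0 = 1" "cmod c1 = 1"
proof -
  have "E v = Quat 0 (quat_J (E v)) \<and> cmod (quat_J (E v)) = 1" if "Im (quat_C (E v)) = 0" for v
  proof -
    have 1: "E v = qvec (Im (quat_C (E v))) (quat_J (E v))"
      using rot_qvec_eq[OF \<Psi>_nz, of v 1 0] by (simp add: E_def)
    then have "E v = qvec 0 (quat_J (E v))" using that by simp
    moreover have "(cmod (quat_J (E v)))\<^sup>2 = 1\<^sup>2"
    proof -
      have "(norm (E v))\<^sup>2 = (norm (qvec 0 (quat_J (E v))))\<^sup>2"
        by (subst \<open>E v = qvec 0 (quat_J (E v))\<close>) (rule refl)
      then show ?thesis by (simp add: norm_qvec norm_E)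
    qed
    then have "cmod (quat_J (E v)) = 1" by (rule power2_eq_imp_eq) auto
    ultimately show ?thesis by (simp add: qvec_def)
  qed
  moreover have "Im (quat_C (E v0)) = 0" "Im (quat_C (E v1)) = 0"
    using axial_E[of sm] axial_E[of sp] sm_sp by (simp_all add: v_at_ends deriv_w_ends)
  ultimately show "E v0 = Quat 0 c0" "E v1 = Quat 0 c1" "cmod c0 = 1" "cmod c1 = 1"
    unfolding c0_def c1_def by blast+
qed

lemma c_cnj: "c0 * cnj c0 = 1" "c1 * cnj c1 = 1"
  by (simp_all only: complex_norm_square[symmetric] cmod_c) simp_all

lemma A_cong: "w v = w v' \<Longrightarrow> A v = A v'"
  using r_height_cong[of v v'] by (simp add: A_def)

text \<open>
  The angular velocity is orthogonal to \<open>\<^bold>i\<close>, so conjugation by \<open>\<^bold>i\<close> reverses it, as does the reflection of \<open>v\<close> in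
  a point about which \<open>w\<close> is even. Both sides thus solve the same linear equation with the same initial value.
\<close>

lemma \<Psi>_reflect:
  assumes refl: "\<And>t. w (c - t) = w (c + t)"
  shows "qvec 1 0 * \<Psi> (c - t) = \<Psi> (c + t) * E c"
proof -
  define D where "D t = inverse (\<Psi> (c + t)) * (qvec 1 0 * \<Psi> (c - t))" for t
  have "(D has_vector_derivative 0) (at t)" for t
  proof -
    have lin: "((\<lambda>t. c + t) has_vector_derivative 1) (at t)" "((\<lambda>t. c - t) has_vector_derivative - 1) (at t)"
      by (auto intro!: derivative_eq_intros)
    have 1: "((\<lambda>t. inverse (\<Psi> (c + t))) has_vector_derivative - (inverse (\<Psi> (c + t)) * A (c + t))) (at t)"
      using vector_diff_chain_at[OF lin(1), of "\<lambda>v. inverse (\<Psi> v)", OF inverse_frame_has_vector_derivative[OF \<Psi>_DERIV \<Psi>_nz]]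
      by (simp add: o_def)
    have 2: "((\<lambda>t. \<Psi> (c - t)) has_vector_derivative - (A (c + t) * \<Psi> (c - t))) (at t)"
      using vector_diff_chain_at[OF lin(2), of \<Psi>, OF \<Psi>_DERIV] A_cong[OF refl] by (simp add: o_def)
    have anti: "A v * qvec 1 0 = - (qvec 1 0 * A v)" for v
      by (simp add: A_def quat_eq_iff mult_ac)
    have "(D has_vector_derivative inverse (\<Psi> (c + t)) * (qvec 1 0 * - (A (c + t) * \<Psi> (c - t)))
        + - (inverse (\<Psi> (c + t)) * A (c + t)) * (qvec 1 0 * \<Psi> (c - t))) (at t)"
      unfolding D_def by (intro has_vector_derivative_mult has_vector_derivative_mult_right 1 2)
    moreover have "inverse (\<Psi> (c + t)) * (qvec 1 0 * - (A (c + t) * \<Psi> (c - t)))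
        + - (inverse (\<Psi> (c + t)) * A (c + t)) * (qvec 1 0 * \<Psi> (c - t))
      = - (inverse (\<Psi> (c + t)) * (qvec 1 0 * A (c + t) + A (c + t) * qvec 1 0) * \<Psi> (c - t))"
      by (simp add: algebra_simps)
    ultimately show ?thesis by (simp add: anti)
  qed
  then obtain k where "\<And>t. D t = k"
    using has_vector_derivative_zero_constant[of UNIV D] by auto
  then have "D t = D 0" by simp
  also have "D 0 = E c" by (simp add: D_def E_def rot_def mult.assoc)
  finally have "\<Psi> (c + t) * D t = \<Psi> (c + t) * E c" by simp
  moreover have "\<Psi> (c + t) * D t = qvec 1 0 * \<Psi> (c - t)"
    unfolding D_def mult.assoc[symmetric] using \<Psi>_nz[of "c + t"] by simp
  ultimately show ?thesis by simp
qed

definition \<mu> :: complex where "\<mu> = c0 * cnj c1"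

lemma cmod_\<mu>: "cmod \<mu> = 1" by (simp add: \<mu>_def norm_mult cmod_c)

lemma \<Psi>_per: "\<Psi> (v + per) = \<Psi> v * Quat \<mu> 0"
proof -
  have r0: "qvec 1 0 * \<Psi> (2 * v0 - v) = \<Psi> v * Quat 0 c0"
    using \<Psi>_reflect[OF w_reflect0, of "v - v0"] by (simp add: E_ends)
  have r1: "qvec 1 0 * \<Psi> (2 * v0 - v) = \<Psi> (v + per) * Quat 0 c1"
  proof -
    have "v1 - (v + per - v1) = 2 * v0 - v" "v1 + (v + per - v1) = v + per" by (simp_all add: v1_def)
    then show ?thesis using \<Psi>_reflect[OF w_reflect1, of "v + per - v1"] by (simp only: E_ends)
  qed
  have c: "Quat 0 c1 * Quat 0 (- c1) = 1" by (simp add: quat_eq_iff c_cnj)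
  have "\<Psi> (v + per) = \<Psi> (v + per) * (Quat 0 c1 * Quat 0 (- c1))" by (simp add: c)
  also have "\<dots> = \<Psi> v * (Quat 0 c0 * Quat 0 (- c1))"
    by (simp only: mult.assoc[symmetric] r1[symmetric] r0)
  also have "Quat 0 c0 * Quat 0 (- c1) = Quat \<mu> 0" by (simp add: quat_eq_iff \<mu>_def)
  finally show ?thesis .
qed

text \<open>
  The monodromy \<open>Quat \<mu> 0\<close> acts on the plane orthogonal to the axis as multiplication by \<open>\<kappa>\<close>.
\<close>

definition \<kappa> :: complex where "\<kappa> = (cnj \<mu>)\<^sup>2"

lemma \<mu>_cnj: "\<mu> * cnj \<mu> = 1"
  by (simp only: complex_norm_square[symmetric] cmod_\<mu>) simp

definition twist :: "quat \<Rightarrow> quat" where "twist z = Quat (quat_C z) (\<kappa> * quat_J z)"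

lemma twist_sel [simp]: "quat_C (twist z) = quat_C z" "quat_J (twist z) = \<kappa> * quat_J z"
  by (simp_all add: twist_def)

lemma rot_\<mu>: "rot (Quat \<mu> 0) z = twist z"
proof -
  have "inverse (Quat \<mu> 0) = Quat (cnj \<mu>) 0"
    by (rule inverse_unique) (simp add: quat_eq_iff \<mu>_cnj)
  then show ?thesis
    by (simp add: rot_def quat_eq_iff \<kappa>_def power2_eq_square \<mu>_cnj mult_ac)
qed

lemma Quat_\<mu>_nz: "Quat \<mu> 0 \<noteq> 0"
  using cmod_\<mu> by (auto simp: quat_eq_iff)

lemma rot_\<Psi>_per: "rot (\<Psi> (v + per)) x = twist (rot (\<Psi> v) x)"
  unfolding \<Psi>_per rot_rot[OF \<Psi>_nz Quat_\<mu>_nz] rot_\<mu> ..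

text \<open>
  Otherwise the monodromy is \<open>\<plusminus> 1\<close> and \<open>f\<close> is closed after one period.
\<close>

lemma \<kappa>_neq_1: "\<kappa> \<noteq> 1"
proof
  assume "\<kappa> = 1"
  have per1: "f u (v + per) = f u v" for u v
  proof -
    have "rot g (f u (v + per)) = rot (\<Psi> (v + per)) (qvec 0 (\<gamma> u (w (v + per))))"
      by (simp add: f_eq rot_\<Psi>)
    also have "\<dots> = rot g (f u v)"
      unfolding rot_\<Psi>_per w_per using \<open>\<kappa> = 1\<close> by (simp add: twist_def f_eq rot_\<Psi>)
    finally show ?thesis using rot_inverse(1)[OF g_nz] by metis
  qed
  have "f u (v + w_period \<tau> \<omega> \<delta> s1 s2 sm sp) = f u v" for u v
  proof (cases "per \<ge> 0")
    case True
    then show ?thesis using per1 by (simp add: w_period_def per_def)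
  next
    case False
    then have "w_period \<tau> \<omega> \<delta> s1 s2 sm sp = - per" by (simp add: w_period_def per_def)
    then show ?thesis using per1[of u "v - per"] by simp
  qed
  then show False using not_closed by blast
qed

end

section \<open>Bonnet mates\<close>

lemma bounded_linear_Im_quat_C: "bounded_linear (\<lambda>q. Im (quat_C q))"
  by (rule bounded_linear_compose[OF bounded_linear_Im bounded_linear_quat_C])

lemma bounded_linear_qdot: "bounded_linear (\<lambda>q. qdot q c)"
  unfolding qdot_def
  by (intro bounded_linear_compose[OF bounded_linear_Re] bounded_linear_add
      bounded_linear_compose[OF bounded_linear_mult_left] bounded_linear_quat_C bounded_linear_quat_J)

lemma has_vector_derivative_zero_unique:
  fixes f :: "real \<Rightarrow> 'a::real_normed_vector"
  assumes "\<And>t. (f has_vector_derivative 0) (at t)"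
  shows "f x = f y"
proof -
  obtain k where "\<And>t. f t = k"
    using has_vector_derivative_zero_constant[of UNIV f] assms by auto
  then show ?thesis by simp
qed

lemma zero_partials_imp_const:
  fixes D :: "real \<Rightarrow> real \<Rightarrow> 'a::real_normed_vector"
  assumes "\<And>u v. ((\<lambda>u. D u v) has_vector_derivative 0) (at u)"
    and "\<And>u v. ((\<lambda>v. D u v) has_vector_derivative 0) (at v)"
  shows "D u v = D u' v'"
  using has_vector_derivative_zero_unique[of "\<lambda>u. D u v" u u', OF assms(1)]
    has_vector_derivative_zero_unique[of "\<lambda>v. D u' v" v v', OF assms(2)] by simp

lemma has_vector_derivative_shift:
  assumes "(f has_vector_derivative f') (at (t + c))"
  shows "((\<lambda>t. f (t + c)) has_vector_derivative f') (at t)"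
proof -
  have "((\<lambda>t. t + c) has_vector_derivative 1) (at t)" by (auto intro!: derivative_eq_intros)
  from vector_diff_chain_at[OF this assms] show ?thesis by (simp add: o_def)
qed

context rhombic_cylinder
begin

lemma f_has_vector_derivative_u:
  "((\<lambda>u. f u v) has_vector_derivative rot (\<Phi> v) (qvec 0 (curve_u u (w v)))) (at u)"
  unfolding f_eq
  by (intro bounded_linear.has_vector_derivative[OF bounded_linear_rot] qvec_has_vector_derivative
      DERIV_const planar_curve_has_vector_derivative_u[OF w_height])

lemma \<gamma>_w_has_vector_derivative:
  "((\<lambda>v. \<gamma> u (w v)) has_vector_derivative \<i> * of_real (deriv w v) * curve_u u (w v)) (at v)"
  using vector_diff_chain_at[of w "deriv w v" v "\<gamma> u", OF _ planar_curve_has_vector_derivative_w[OF w_height]]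
    w_DERIV[of v] by (simp add: o_def has_real_derivative_iff_has_vector_derivative scaleR_conv_of_real mult_ac)

lemma f_has_vector_derivative_v:
  "((\<lambda>v. f u v) has_vector_derivative
     rot (\<Phi> v) (qvec (2 * r v * Re (W v * cnj (\<gamma> u (w v)))) (\<i> * of_real (deriv w v) * curve_u u (w v)))) (at v)"
proof -
  have "((\<lambda>v. rot (\<Phi> v) (qvec 0 (\<gamma> u (w v)))) has_vector_derivative
      rot (\<Phi> v) (qvec 0 (\<i> * of_real (deriv w v) * curve_u u (w v))
        + (qvec 0 (\<gamma> u (w v)) * A v - A v * qvec 0 (\<gamma> u (w v))))) (at v)"
    by (intro rot_\<Phi>_DERIV qvec_has_vector_derivative DERIV_const \<gamma>_w_has_vector_derivative)
  moreover have "qvec 0 (\<i> * of_real (deriv w v) * curve_u u (w v))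
        + (qvec 0 (\<gamma> u (w v)) * A v - A v * qvec 0 (\<gamma> u (w v)))
      = qvec (2 * r v * Re (W v * cnj (\<gamma> u (w v)))) (\<i> * of_real (deriv w v) * curve_u u (w v))"
    unfolding A_def qvec_commutator by (simp add: quat_eq_iff)
  ultimately show ?thesis by (simp only: f_eq)
qed

definition bonnet_conj :: "real \<Rightarrow> complex \<Rightarrow> quat \<Rightarrow> quat" where
  "bonnet_conj \<epsilon> c x = (of_real \<epsilon> - qvec 0 c) * x * (of_real \<epsilon> + qvec 0 c)"

text \<open>
  The partial derivatives of a Bonnet mate in the coordinates of the moving frame; the factor
  \<open>1/\<bar>\<gamma>\<^sub>u\<bar>\<^sup>2\<close> is \<open>exp (- 2 h)\<close>.
\<close>

definition mate_u :: "real \<Rightarrow> real \<Rightarrow> real \<Rightarrow> quat" where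
  "mate_u \<epsilon> u v = bonnet_conj \<epsilon> (\<gamma> u (w v))
     ((1 / (cmod (curve_u u (w v)))\<^sup>2) *\<^sub>R qvec 0 (curve_u u (w v)))"

definition mate_v :: "real \<Rightarrow> real \<Rightarrow> real \<Rightarrow> quat" where
  "mate_v \<epsilon> u v = bonnet_conj \<epsilon> (\<gamma> u (w v))
     ((- 1 / (cmod (curve_u u (w v)))\<^sup>2) *\<^sub>R
       qvec (2 * r v * Re (W v * cnj (\<gamma> u (w v)))) (\<i> * of_real (deriv w v) * curve_u u (w v)))"

lemma bonnet_partials:
  assumes F: "bonnet_mate \<epsilon> (\<lambda>u v. metric_h \<tau> \<omega> u (w v)) f F"
  shows "((\<lambda>u. rot g (F u v)) has_vector_derivative rot (\<Psi> v) (mate_u \<epsilon> u v)) (at u)"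
    and "((\<lambda>v. rot g (F u v)) has_vector_derivative rot (\<Psi> v) (mate_v \<epsilon> u v)) (at v)"
proof -
  define dd where "dd = dual_differential (\<lambda>u v. metric_h \<tau> \<omega> u (w v)) f u v"
  define D where "D d = (of_real \<epsilon> - f u v) * dd d * (of_real \<epsilon> + f u v)" for d
  have "((\<lambda>(u, v). F u v) has_derivative D) (at (u, v))"
    using F unfolding bonnet_mate_def D_def[abs_def] dd_def by blast
  then have h: "((\<lambda>p. F (fst p) (snd p)) has_derivative D) (at (u, v))"
    by (simp add: case_prod_unfold)
  have fu: "vector_derivative (\<lambda>u. f u v) (at u) = rot (\<Phi> v) (qvec 0 (curve_u u (w v)))"
    by (rule vector_derivative_at[OF f_has_vector_derivative_u])
  have fv: "vector_derivative (\<lambda>v. f u v) (at v) = rot (\<Phi> v) (qvec (2 * r v * Re (W v * cnj (\<gamma> u (w v)))) (\<i> * of_real (deriv w v) * curve_u u (w v)))"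
    by (rule vector_derivative_at[OF f_has_vector_derivative_v])
  have dd: "dd (a, b) = (1 / (cmod (curve_u u (w v)))\<^sup>2) *\<^sub>R
      (a *\<^sub>R rot (\<Phi> v) (qvec 0 (curve_u u (w v)))
       - b *\<^sub>R rot (\<Phi> v) (qvec (2 * r v * Re (W v * cnj (\<gamma> u (w v)))) (\<i> * of_real (deriv w v) * curve_u u (w v))))" for a b
    unfolding dd_def dual_differential_def prod.case fu fv exp_minus_2_metric_h[OF w_height] ..
  have rD: "rot g ((of_real \<epsilon> - f u v) * rot (\<Phi> v) x * (of_real \<epsilon> + f u v)) = rot (\<Psi> v) (bonnet_conj \<epsilon> (\<gamma> u (w v)) x)" for x
    unfolding bonnet_conj_def rot_\<Psi> f_eq rot_mult[OF \<Phi>_nz] rot_mult[OF g_nz] rot_add rot_diff rot_of_real[OF \<Phi>_nz] ..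
  have D1: "D (a, 0) = a *\<^sub>R D (1, 0)" and D2: "D (0, a) = a *\<^sub>R D (0, 1)" for a
    by (simp_all add: D_def dd)
  have "((\<lambda>u. F (fst (u, v)) (snd (u, v))) has_derivative (\<lambda>a. D (a, 0))) (at u)"
    by (rule has_derivative_compose[where f = "\<lambda>u. (u, v)" and g = "\<lambda>p. F (fst p) (snd p)" and f' = "\<lambda>a. (a, 0)", OF _ h])
       (auto intro!: derivative_eq_intros)
  then have "((\<lambda>u. F u v) has_vector_derivative D (1, 0)) (at u)"
    unfolding has_vector_derivative_def D1[symmetric] by simp
  then have "((\<lambda>u. rot g (F u v)) has_vector_derivative rot g (D (1, 0))) (at u)"
    by (rule bounded_linear.has_vector_derivative[OF bounded_linear_rot])
  moreover have "D (1, 0) = (of_real \<epsilon> - f u v) * rot (\<Phi> v) ((1 / (cmod (curve_u u (w v)))\<^sup>2) *\<^sub>R qvec 0 (curve_u u (w v))) * (of_real \<epsilon> + f u v)"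
    by (simp add: D_def dd rot_scaleR)
  ultimately show "((\<lambda>u. rot g (F u v)) has_vector_derivative rot (\<Psi> v) (mate_u \<epsilon> u v)) (at u)"
    by (simp only: rD mate_u_def)
  have "((\<lambda>v. F (fst (u, v)) (snd (u, v))) has_derivative (\<lambda>a. D (0, a))) (at v)"
    by (rule has_derivative_compose[where f = "\<lambda>v. (u, v)" and g = "\<lambda>p. F (fst p) (snd p)" and f' = "\<lambda>a. (0, a)", OF _ h])
       (auto intro!: derivative_eq_intros)
  then have "((\<lambda>v. F u v) has_vector_derivative D (0, 1)) (at v)"
    unfolding has_vector_derivative_def D2[symmetric] by simp
  then have "((\<lambda>v. rot g (F u v)) has_vector_derivative rot g (D (0, 1))) (at v)"
    by (rule bounded_linear.has_vector_derivative[OF bounded_linear_rot])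
  moreover have "D (0, 1) = (of_real \<epsilon> - f u v) * rot (\<Phi> v) ((- 1 / (cmod (curve_u u (w v)))\<^sup>2) *\<^sub>R
       qvec (2 * r v * Re (W v * cnj (\<gamma> u (w v)))) (\<i> * of_real (deriv w v) * curve_u u (w v))) * (of_real \<epsilon> + f u v)"
    by (simp add: D_def dd rot_scaleR rot_minus)
  ultimately show "((\<lambda>v. rot g (F u v)) has_vector_derivative rot (\<Psi> v) (mate_v \<epsilon> u v)) (at v)"
    by (simp only: rD mate_v_def)
qed

lemma Im_quat_C_mate_u:
  "Im (quat_C (mate_u \<epsilon> u v)) = 2 * \<epsilon> * Im (\<gamma> u (w v) / curve_u u (w v))"
proof -
  define c where "c = \<gamma> u (w v)"
  define d where "d = curve_u u (w v)"
  have "d \<noteq> 0" using curve_u_nz[OF w_height] by (simp add: d_def)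
  have "c / d = c * cnj d / of_real ((cmod d)\<^sup>2)"
    unfolding complex_norm_square using \<open>d \<noteq> 0\<close> by simp
  then have q: "Im (c / d) = Im (c * cnj d) / (cmod d)\<^sup>2" by (simp only: Im_divide_of_real)
  have "Im (quat_C (bonnet_conj \<epsilon> c (k *\<^sub>R qvec 0 d))) = 2 * \<epsilon> * (k * Im (c * cnj d))" for k
    by (simp add: bonnet_conj_def algebra_simps)
  from this[of "1 / (cmod d)\<^sup>2"] show ?thesis
    unfolding mate_u_def c_def[symmetric] d_def[symmetric] q by simp
qed

lemma cmod_curve_u_\<omega>: "cmod (curve_u \<omega> (w v)) = 1 / \<sigma> v"
  using \<sigma>_pos[of v] by (simp add: curve_u_e norm_divide cmod_e)

text \<open>
  The quaternion \<open>e \<^bold>j\<close> commutes with itself and anticommutes with the vectors orthogonal to it.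
\<close>

lemma bonnet_conj_e:
  "bonnet_conj \<epsilon> (e v / U) (qvec 0 (of_real k * e v)) = ((\<epsilon>\<^sup>2 + 1 / U\<^sup>2) * k) *\<^sub>R qvec 0 (e v)"
  "bonnet_conj \<epsilon> (e v / U) (qvec a (\<i> * of_real b * e v))
    = qvec ((\<epsilon>\<^sup>2 - 1 / U\<^sup>2) * a - 2 * \<epsilon> / U * b) (\<i> * e v * of_real ((\<epsilon>\<^sup>2 - 1 / U\<^sup>2) * b + 2 * \<epsilon> / U * a))"
proof -
  define z where "z = e v"
  have zz: "z * cnj z = 1" "cnj z * z = 1" using e_cnj[of v] by (simp_all add: z_def mult.commute)
  have zz': "z * (cnj z * x) = x" "cnj z * (z * x) = x" "z * (x * cnj z) = x" "cnj z * (x * z) = x" for x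
    using zz by (metis mult.assoc mult.commute mult_1)+
  show "bonnet_conj \<epsilon> (e v / U) (qvec 0 (of_real k * e v)) = ((\<epsilon>\<^sup>2 + 1 / U\<^sup>2) * k) *\<^sub>R qvec 0 (e v)"
    unfolding z_def[symmetric] bonnet_conj_def using U_nz
    by (simp add: quat_eq_iff field_simps scaleR_conv_of_real[where 'a = complex] power2_eq_square zz zz')
  show "bonnet_conj \<epsilon> (e v / U) (qvec a (\<i> * of_real b * e v))
    = qvec ((\<epsilon>\<^sup>2 - 1 / U\<^sup>2) * a - 2 * \<epsilon> / U * b) (\<i> * e v * of_real ((\<epsilon>\<^sup>2 - 1 / U\<^sup>2) * b + 2 * \<epsilon> / U * a))"
    unfolding z_def[symmetric] bonnet_conj_def using U_nz
    by (simp add: quat_eq_iff field_simps scaleR_conv_of_real[where 'a = complex] power2_eq_square zz zz')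
qed

lemma mate_u_\<omega>: "mate_u \<epsilon> \<omega> v = ((\<epsilon>\<^sup>2 + 1 / U\<^sup>2) * \<sigma> v) *\<^sub>R qvec 0 (e v)"
proof -
  have "(1 / (cmod (curve_u \<omega> (w v)))\<^sup>2) *\<^sub>R qvec 0 (curve_u \<omega> (w v)) = qvec 0 (of_real (\<sigma> v) * e v)"
    unfolding cmod_curve_u_\<omega> using \<sigma>_pos[of v]
    by (simp add: quat_eq_iff curve_u_e scaleR_conv_of_real[where 'a = complex] power2_eq_square)
  then show ?thesis unfolding mate_u_def by (simp only: \<gamma>_\<omega> bonnet_conj_e)
qed

lemma mate_v_\<omega>: "mate_v \<epsilon> \<omega> v =
    qvec (- (\<epsilon>\<^sup>2 - 1 / U\<^sup>2) * \<sigma> v * r v + 2 * \<epsilon> * \<sigma> v / U * deriv w v)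
      (\<i> * e v * of_real (- (\<epsilon>\<^sup>2 - 1 / U\<^sup>2) * \<sigma> v * deriv w v - 2 * \<epsilon> * \<sigma> v / U * r v))"
proof -
  have "Re (W v * cnj (\<gamma> \<omega> (w v))) = Re (W v * cnj (e v)) / U"
    unfolding \<gamma>_\<omega> using U_nz by (simp add: add_divide_distrib)
  then have "Re (W v * cnj (\<gamma> \<omega> (w v))) = U / (2 * \<sigma> v) / U" by (simp only: Re_W)
  then have "2 * Re (W v * cnj (\<gamma> \<omega> (w v))) = 1 / \<sigma> v"
    using U_nz by (simp only:) simp
  then have R: "2 * r v * Re (W v * cnj (\<gamma> \<omega> (w v))) = r v / \<sigma> v"
    by (metis mult.assoc mult.commute mult.right_neutral times_divide_eq_right)
  have "(- 1 / (cmod (curve_u \<omega> (w v)))\<^sup>2) *\<^sub>R qvec (r v / \<sigma> v) (\<i> * of_real (deriv w v) * curve_u \<omega> (w v))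
      = qvec (- \<sigma> v * r v) (\<i> * of_real (- \<sigma> v * deriv w v) * e v)"
    unfolding cmod_curve_u_\<omega> using \<sigma>_pos[of v]
    by (simp add: quat_eq_iff curve_u_e scaleR_conv_of_real[where 'a = complex] power2_eq_square)
  then have "mate_v \<epsilon> \<omega> v = bonnet_conj \<epsilon> (e v / U) (qvec (- \<sigma> v * r v) (\<i> * of_real (- \<sigma> v * deriv w v) * e v))"
    unfolding mate_v_def R by (simp only: \<gamma>_\<omega>)
  then show ?thesis unfolding bonnet_conj_e by (simp add: algebra_simps)
qed

lemma deriv_w_per: "deriv w (v + per) = deriv w v"
proof -
  have "((\<lambda>v. w (v + per)) has_real_derivative deriv w (v + per)) (at v)"
    using w_DERIV[of "v + per"] DERIV_shift by blast
  then show ?thesis unfolding w_per using w_DERIV DERIV_unique by blast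
qed

lemma mate_per: "mate_u \<epsilon> u (v + per) = mate_u \<epsilon> u v" "mate_v \<epsilon> u (v + per) = mate_v \<epsilon> u v"
  using r_height_cong[OF w_per] by (simp_all add: mate_u_def mate_v_def w_per deriv_w_per)

lemma mate_2pi: "mate_u \<epsilon> (u + 2 * pi) v = mate_u \<epsilon> u v" "mate_v \<epsilon> (u + 2 * pi) v = mate_v \<epsilon> u v"
  by (simp_all add: mate_u_def mate_v_def planar_curve_periodic curve_u_periodic)

lemma bounded_linear_twist: "bounded_linear twist"
proof -
  have "twist = (\<lambda>z. rot (Quat \<mu> 0) z)" by (simp add: fun_eq_iff rot_\<mu>)
  then show ?thesis using bounded_linear_rot by simp
qed

text \<open>
  Both partial derivatives of the difference vanish, since the monodromy rotates the velocities of the mate as it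
  rotates \<open>f\<close>. The vector \<open>b\<close> is the translational part of the screw motion.
\<close>

lemma bonnet_twist:
  assumes F: "bonnet_mate \<epsilon> (\<lambda>u v. metric_h \<tau> \<omega> u (w v)) f F"
  defines "G \<equiv> \<lambda>u v. rot g (F u v)"
  obtains b where "\<And>u v. G u (v + per) = twist (G u v) + b"
proof -
  have P: "((\<lambda>u. G u v) has_vector_derivative rot (\<Psi> v) (mate_u \<epsilon> u v)) (at u)"
    "((\<lambda>v. G u v) has_vector_derivative rot (\<Psi> v) (mate_v \<epsilon> u v)) (at v)" for u v
    unfolding G_def by (rule bonnet_partials[OF F])+
  define D where "D u v = G u (v + per) - twist (G u v)" for u v
  have Du: "((\<lambda>u. D u v) has_vector_derivative 0) (at u)" for u v
  proof -
    have "((\<lambda>u. G u (v + per) - twist (G u v)) has_vector_derivative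
        rot (\<Psi> (v + per)) (mate_u \<epsilon> u (v + per)) - twist (rot (\<Psi> v) (mate_u \<epsilon> u v))) (at u)"
      by (intro has_vector_derivative_diff bounded_linear.has_vector_derivative[OF bounded_linear_twist] P)
    then show ?thesis unfolding D_def rot_\<Psi>_per mate_per by simp
  qed
  have Dv: "((\<lambda>v. D u v) has_vector_derivative 0) (at v)" for u v
  proof -
    have "((\<lambda>v. G u (v + per) - twist (G u v)) has_vector_derivative
        rot (\<Psi> (v + per)) (mate_v \<epsilon> u (v + per)) - twist (rot (\<Psi> v) (mate_v \<epsilon> u v))) (at v)"
      by (intro has_vector_derivative_diff has_vector_derivative_shift bounded_linear.has_vector_derivative[OF bounded_linear_twist] P)
    then show ?thesis unfolding D_def rot_\<Psi>_per mate_per by simp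
  qed
  have "D u v = D 0 0" for u v
    by (rule zero_partials_imp_const[of D, OF Du Dv])
  then have "G u (v + per) = twist (G u v) + D 0 0" for u v
    unfolding D_def by (metis diff_eq_eq add.commute)
  then show ?thesis by (rule that)
qed

lemma quat_C_bonnet:
  assumes F: "bonnet_mate \<epsilon> (\<lambda>u v. metric_h \<tau> \<omega> u (w v)) f F"
  shows "Re (quat_C (rot g (F u v))) = 0"
  using F Re_quat_C_rot[OF g_nz, of "F u v"] by (simp add: bonnet_mate_def Im_quat_def)

lemma deriv_w_mid_nz: "deriv w (v_at ((sm + sp) / 2)) \<noteq> 0"
  unfolding deriv_w_at[OF mid] using q_pos[OF mid] q3_pos[OF mid] \<delta>_nz by simp

text \<open>
  The period vector \<open>c\<close> does not depend on \<open>(u, v)\<close>, so it is fixed by \<open>twist\<close> and parallel to the axis. The component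
  of \<open>\<partial>\<^sub>u F\<close> along the normal of the curvature plane is \<open>2\<epsilon> Im (\<gamma>/\<gamma>\<^sub>u)\<close>, which is odd about \<open>u = \<omega>\<close>; hence \<open>c\<close> has no
  normal component. At an interior point of the oval the axis does have one, so \<open>c = 0\<close>.
\<close>

lemma bonnet_2pi_periodic:
  assumes F: "bonnet_mate \<epsilon> (\<lambda>u v. metric_h \<tau> \<omega> u (w v)) f F"
  shows "F (u + 2 * pi) v = F u v"
proof -
  define G where "G u v = rot g (F u v)" for u v
  have P: "((\<lambda>u. G u v) has_vector_derivative rot (\<Psi> v) (mate_u \<epsilon> u v)) (at u)"
    "((\<lambda>v. G u v) has_vector_derivative rot (\<Psi> v) (mate_v \<epsilon> u v)) (at v)" for u v
    unfolding G_def by (rule bonnet_partials[OF F])+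
  define D where "D u v = G (u + 2 * pi) v - G u v" for u v
  have "((\<lambda>u. D u v) has_vector_derivative rot (\<Psi> v) (mate_u \<epsilon> (u + 2 * pi) v) - rot (\<Psi> v) (mate_u \<epsilon> u v)) (at u)" for u v
    unfolding D_def by (intro has_vector_derivative_diff has_vector_derivative_shift[of "\<lambda>u. G u v"] P)
  then have Du: "((\<lambda>u. D u v) has_vector_derivative 0) (at u)" for u v
    by (simp add: mate_2pi)
  have "((\<lambda>v. D u v) has_vector_derivative rot (\<Psi> v) (mate_v \<epsilon> (u + 2 * pi) v) - rot (\<Psi> v) (mate_v \<epsilon> u v)) (at v)" for u v
    unfolding D_def by (intro has_vector_derivative_diff P)
  then have Dv: "((\<lambda>v. D u v) has_vector_derivative 0) (at v)" for u v
    by (simp add: mate_2pi)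
  define c where "c = D 0 0"
  have Dc: "D u v = c" for u v
    unfolding c_def by (rule zero_partials_imp_const[of D, OF Du Dv])
  obtain b where b: "\<And>u v. G u (v + per) = twist (G u v) + b"
    using bonnet_twist[OF F] unfolding G_def by blast
  have "c = D 0 (0 + per)" by (simp add: Dc)
  also have "\<dots> = twist (D 0 0)"
    unfolding D_def b by (simp add: quat_eq_iff algebra_simps)
  finally have "c = twist c" by (simp add: Dc)
  then have "quat_J c = \<kappa> * quat_J c" by (metis twist_sel(2))
  then have cJ: "quat_J c = 0" using \<kappa>_neq_1 by (metis mult_cancel_right1)
  have "Re (quat_C c) = 0"
    using quat_C_bonnet[OF F] by (simp add: c_def D_def G_def)
  \<comment> \<open>any parameter value with \<open>w' \<noteq> 0\<close> would do\<close>
  define vm where "vm = v_at ((sm + sp) / 2)"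
  define h where "h u = qdot (G u vm) (E vm)" for u
  have h: "(h has_vector_derivative 2 * \<epsilon> * Im (\<gamma> u (w vm) / curve_u u (w vm))) (at u)" for u
  proof -
    have "(h has_vector_derivative qdot (rot (\<Psi> vm) (mate_u \<epsilon> u vm)) (E vm)) (at u)"
      unfolding h_def by (rule bounded_linear.has_vector_derivative[OF bounded_linear_qdot P(1)])
    then show ?thesis unfolding E_def qdot_rot[OF \<Psi>_nz] qdot_axis Im_quat_C_mate_u .
  qed
  define k where "k t = h (\<omega> + t) - h (\<omega> - t)" for t
  have "(k has_vector_derivative 0) (at t)" for t
  proof -
    have l: "((\<lambda>t. \<omega> + t) has_vector_derivative 1) (at t)" "((\<lambda>t. \<omega> - t) has_vector_derivative - 1) (at t)"
      by (auto intro!: derivative_eq_intros)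
    have "((h \<circ> (\<lambda>t. \<omega> + t)) has_vector_derivative 1 *\<^sub>R (2 * \<epsilon> * Im (\<gamma> (\<omega> + t) (w vm) / curve_u (\<omega> + t) (w vm)))) (at t)"
      by (rule vector_diff_chain_at[OF l(1) h])
    moreover have "((h \<circ> (\<lambda>t. \<omega> - t)) has_vector_derivative - 1 *\<^sub>R (2 * \<epsilon> * Im (\<gamma> (\<omega> - t) (w vm) / curve_u (\<omega> - t) (w vm)))) (at t)"
      by (rule vector_diff_chain_at[OF l(2) h])
    ultimately have "((\<lambda>t. (h \<circ> (\<lambda>t. \<omega> + t)) t - (h \<circ> (\<lambda>t. \<omega> - t)) t) has_vector_derivative
        1 *\<^sub>R (2 * \<epsilon> * Im (\<gamma> (\<omega> + t) (w vm) / curve_u (\<omega> + t) (w vm)))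
        - - 1 *\<^sub>R (2 * \<epsilon> * Im (\<gamma> (\<omega> - t) (w vm) / curve_u (\<omega> - t) (w vm)))) (at t)"
      by (rule has_vector_derivative_diff)
    then show ?thesis
      unfolding quotient_symmetric[OF w_height] k_def by (simp add: o_def)
  qed
  then have "k pi = k 0" by (rule has_vector_derivative_zero_unique)
  then have "h (\<omega> - pi + 2 * pi) = h (\<omega> - pi)" by (simp add: k_def algebra_simps)
  then have "qdot (D (\<omega> - pi) vm) (E vm) = 0" by (simp add: h_def D_def qdot_def algebra_simps)
  then have "Im (quat_C c) * Im (quat_C (E vm)) = 0"
    unfolding Dc by (simp add: qdot_def cJ \<open>Re (quat_C c) = 0\<close>)
  moreover have "Im (quat_C (E vm)) \<noteq> 0"
    unfolding vm_def using axial_E[of "(sm + sp) / 2"] mid deriv_w_mid_nz U_nz U1'_nz \<delta>_nz Z0_pos by simp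
  ultimately have "c = 0" using cJ \<open>Re (quat_C c) = 0\<close> by (simp add: quat_eq_iff complex_eq_iff)
  then have "rot g (F (u + 2 * pi) v) = rot g (F u v)" using Dc[of u v] by (simp add: D_def G_def)
  then show ?thesis using rot_inverse(1)[OF g_nz] by metis
qed

lemma axial_velocity:
  assumes s: "s \<in> {sm<..<sp}"
  defines "v \<equiv> v_at s"
  shows "deriv w v * axis_a s - r v * axis_b2 s = - Q2 \<tau> \<omega> \<delta> s1 s2 s / (U * \<delta> * s)"
proof -
  define x where "x = sqrt (poly q s)"
  define S where "S = sqrt (poly q3 s)"
  define P where "P = (s - s1) * (s - s2)"
  have nz: "s \<noteq> 0" "x \<noteq> 0" "S \<noteq> 0" "U \<noteq> 0" "\<delta> \<noteq> 0"
    using sm_pos s q_pos[OF s] q3_pos[OF s] U_nz \<delta>_nz by (auto simp: x_def S_def)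
  have sq: "x\<^sup>2 = - P\<^sup>2 + \<delta>\<^sup>2 * S\<^sup>2"
    using q_pos[OF s] q3_pos[OF s] by (simp_all add: x_def S_def P_def poly_q)
  have "deriv w v * axis_a s - r v * axis_b2 s = (- U1' * (x\<^sup>2 + P\<^sup>2) / S\<^sup>2 + P / s) / (U * \<delta>)"
    unfolding v_def deriv_w_at[OF s] r_at[OF s] axis_a_def axis_b2_def x_def[symmetric] S_def[symmetric] P_def[symmetric]
    using nz by (simp add: field_simps power2_eq_square)
  also have "\<dots> = (- U1' * \<delta>\<^sup>2 + P / s) / (U * \<delta>)"
    unfolding sq using nz by simp
  also have "\<dots> = - Q2 \<tau> \<omega> \<delta> s1 s2 s / (U * \<delta> * s)"
    unfolding Q2_def P_def using nz by (simp add: field_simps)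
  finally show ?thesis .
qed

text \<open>
  The axial velocity of the mate on \<open>u = \<omega>\<close> is a multiple of \<open>s'(v)\<close> plus a multiple of \<open>Q\<^sub>2(s)\<close>. Under the
  reflection in \<open>v1\<close> the first part changes sign relative to the second, so the sum over the two halves of a period
  contains \<open>Q\<^sub>2\<close> only.
\<close>

lemma axial_translation:
  assumes F: "bonnet_mate \<epsilon> (\<lambda>u v. metric_h \<tau> \<omega> u (w v)) f F"
    and b: "\<And>u v. rot g (F u (v + per)) = twist (rot g (F u v)) + b"
  shows "Im (quat_C b) = - (4 * \<epsilon> / (U\<^sup>2 * Z0)) * integral {sm..sp} (\<lambda>s. Q2 \<tau> \<omega> \<delta> s1 s2 s / sqrt (poly q s))"
proof -
  define H where "H v = Im (quat_C (rot g (F \<omega> v)))" for v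
  define L where "L s = H (2 * v1 - v_at s) - H (v_at s)" for s
  have H: "(H has_real_derivative Im (quat_C (rot (\<Psi> v) (mate_v \<epsilon> \<omega> v)))) (at v)" for v
    unfolding H_def has_real_derivative_iff_has_vector_derivative
    by (rule bounded_linear.has_vector_derivative[OF bounded_linear_Im_quat_C bonnet_partials(2)[OF F]])
  have Hc: "continuous_on UNIV H" using H by (intro continuous_at_imp_continuous_on ballI DERIV_isCont) blast
  define c where "c = 4 * \<epsilon> / (U\<^sup>2 * Z0)"
  have "((\<lambda>s. c * (Q2 \<tau> \<omega> \<delta> s1 s2 s / sqrt (poly q s))) has_integral L sp - L sm) {sm..sp}"
  proof (rule fundamental_theorem_of_calculus_interior)
    show "continuous_on {sm..sp} L"
      unfolding L_def
      by (intro continuous_intros continuous_on_compose2[OF Hc] continuous_on_v_at) auto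
    fix s assume s: "s \<in> {sm<..<sp}"
    define v where "v = v_at s"
    define v' where "v' = 2 * v1 - v"
    have vv: "v = v1 - (v1 - v)" "v' = v1 + (v1 - v)" by (simp_all add: v'_def)
    have wv: "w v' = w v" using w_reflect1[of "v1 - v"] unfolding vv[symmetric] by simp
    have dw: "deriv w v' = - deriv w v" using deriv_w_reflect[OF w_reflect1, of "v1 - v"] unfolding vv[symmetric] .
    have same: "\<sigma> v' = \<sigma> v" "e v' = e v" "r v' = r v" using wv r_height_cong[OF wv] by (simp_all add: \<sigma>_def e_def)
    have \<sigma>: "\<sigma> v = s" using \<sigma>_at[of s] s by (simp add: v_def)
    \<comment> \<open>by \<open>\<Psi>_reflect\<close>, passing to the mirror image is conjugation by \<open>\<^bold>i\<close> in the frame followed by the half-turn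
      about \<open>E v1\<close> in space, which reverses the axis\<close>
    have refl: "Im (quat_C (rot (\<Psi> v') (qvec \<alpha> \<beta>))) = Im (quat_C (rot (\<Psi> v) (qvec (- \<alpha>) \<beta>)))" for \<alpha> \<beta>
    proof -
      have "qvec 1 0 * \<Psi> v = \<Psi> v' * E v1" using \<Psi>_reflect[OF w_reflect1, of "v1 - v"] unfolding vv[symmetric] .
      then have "rot (\<Psi> v' * E v1) (qvec \<alpha> \<beta>) = rot (qvec 1 0 * \<Psi> v) (qvec \<alpha> \<beta>)" by simp
      moreover have nz: "E v1 \<noteq> 0" "qvec 1 0 \<noteq> 0"
        using norm_E[of v1] by (metis norm_zero zero_neq_one) (simp add: quat_eq_iff)
      moreover have i: "inverse (qvec 1 0) = qvec (- 1) 0" by (rule inverse_unique) (simp add: quat_eq_iff)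
      then have "rot (qvec 1 0) (qvec \<alpha> \<beta>) = qvec \<alpha> (- \<beta>)" by (simp add: rot_def quat_eq_iff mult_ac)
      ultimately have eq: "rot (E v1) (rot (\<Psi> v') (qvec \<alpha> \<beta>)) = rot (\<Psi> v) (qvec \<alpha> (- \<beta>))"
        by (simp add: rot_rot[OF \<Psi>_nz nz(1)] rot_rot[OF nz(2) \<Psi>_nz])
      have "inverse (E v1) = - E v1" by (rule inverse_unique) (simp add: quat_eq_iff E_ends c_cnj)
      then have "Im (quat_C (rot (E v1) y)) = - Im (quat_C y)" if "Re (quat_C y) = 0" for y
      proof -
        have "quat_C (rot (E v1) y) = c1 * cnj c1 * cnj (quat_C y)"
          unfolding rot_def \<open>inverse (E v1) = - E v1\<close> by (simp add: E_ends mult_ac)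
        then show ?thesis by (simp add: c_cnj)
      qed
      then have "- Im (quat_C (rot (\<Psi> v') (qvec \<alpha> \<beta>))) = Im (quat_C (rot (\<Psi> v) (qvec \<alpha> (- \<beta>))))"
        unfolding eq[symmetric] by (simp add: Re_quat_C_rot[OF \<Psi>_nz])
      moreover have "qvec (- \<alpha>) \<beta> = - qvec \<alpha> (- \<beta>)" by (simp add: quat_eq_iff)
      ultimately show ?thesis by (simp add: rot_minus)
    qed
    define m where "m = 2 * \<epsilon> * s / U"
    define n where "n = (\<epsilon>\<^sup>2 - 1 / U\<^sup>2) * s"
    have mv: "mate_v \<epsilon> \<omega> v = qvec (- n * r v + m * deriv w v) (\<i> * e v * of_real (- n * deriv w v - m * r v))"
      unfolding mate_v_\<omega> \<sigma> by (simp add: m_def n_def algebra_simps)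
    have mv': "mate_v \<epsilon> \<omega> v' = qvec (- n * r v - m * deriv w v) (\<i> * e v * of_real (n * deriv w v - m * r v))"
      unfolding mate_v_\<omega> same dw \<sigma> by (simp add: m_def n_def algebra_simps)
    have "Im (quat_C (rot (\<Psi> v') (mate_v \<epsilon> \<omega> v'))) + Im (quat_C (rot (\<Psi> v) (mate_v \<epsilon> \<omega> v)))
        = Im (quat_C (rot (\<Psi> v) (qvec (n * r v + m * deriv w v) (\<i> * e v * of_real (n * deriv w v - m * r v)) + mate_v \<epsilon> \<omega> v)))"
      unfolding mv' refl by (simp add: rot_add add.commute)
    also have "qvec (n * r v + m * deriv w v) (\<i> * e v * of_real (n * deriv w v - m * r v)) + mate_v \<epsilon> \<omega> v
        = (2 * m) *\<^sub>R qvec (deriv w v) (\<i> * e v * of_real (- r v))"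
      unfolding mv by (simp add: quat_eq_iff scaleR_conv_of_real[where 'a = complex] algebra_simps)
    also have "Im (quat_C (rot (\<Psi> v) ((2 * m) *\<^sub>R qvec (deriv w v) (\<i> * e v * of_real (- r v)))))
        = 2 * m * (qdot (qvec (deriv w v) (\<i> * e v * of_real (- r v))) (\<xi> s) / Z0)"
      unfolding rot_scaleR v_def axial_component[OF s, symmetric] by simp
    also have "qdot (qvec (deriv w v) (\<i> * e v * of_real (- r v))) (\<xi> s) = deriv w v * axis_a s - r v * axis_b2 s"
    proof -
      have "\<i> * e v * of_real (- r v) * cnj (Complex (axis_b1 s) (axis_b2 s) * e v)
          = (e v * cnj (e v)) * (\<i> * of_real (- r v) * cnj (Complex (axis_b1 s) (axis_b2 s)))" by (simp add: mult_ac)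
      also have "Re \<dots> = - r v * axis_b2 s" unfolding e_cnj by simp
      finally show ?thesis unfolding \<xi>_def v_def[symmetric] qdot_qvec by simp
    qed
    also have "\<dots> = - Q2 \<tau> \<omega> \<delta> s1 s2 s / (U * \<delta> * s)" unfolding v_def by (rule axial_velocity[OF s])
    finally have sum: "Im (quat_C (rot (\<Psi> v') (mate_v \<epsilon> \<omega> v'))) + Im (quat_C (rot (\<Psi> v) (mate_v \<epsilon> \<omega> v)))
        = - c * Q2 \<tau> \<omega> \<delta> s1 s2 s / \<delta>"
      using sm_pos s U_nz by (simp add: m_def c_def power2_eq_square mult_ac)
    have "(L has_real_derivative Im (quat_C (rot (\<Psi> v') (mate_v \<epsilon> \<omega> v'))) * (0 - \<delta> / sqrt (poly q s))
        - Im (quat_C (rot (\<Psi> v) (mate_v \<epsilon> \<omega> v))) * (\<delta> / sqrt (poly q s))) (at s)"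
      unfolding L_def v'_def v_def
      by (intro DERIV_diff DERIV_chain2[OF H] DERIV_const v_at_DERIV[OF s])
    moreover have "Im (quat_C (rot (\<Psi> v') (mate_v \<epsilon> \<omega> v'))) * (0 - \<delta> / sqrt (poly q s))
        - Im (quat_C (rot (\<Psi> v) (mate_v \<epsilon> \<omega> v))) * (\<delta> / sqrt (poly q s))
      = - (\<delta> / sqrt (poly q s)) * (Im (quat_C (rot (\<Psi> v') (mate_v \<epsilon> \<omega> v'))) + Im (quat_C (rot (\<Psi> v) (mate_v \<epsilon> \<omega> v))))"
      by (simp add: algebra_simps)
    ultimately have "(L has_real_derivative c * (Q2 \<tau> \<omega> \<delta> s1 s2 s / sqrt (poly q s))) (at s)"
      unfolding sum using \<delta>_nz by simp
    then show "(L has_vector_derivative c * (Q2 \<tau> \<omega> \<delta> s1 s2 s / sqrt (poly q s))) (at s)"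
      by (simp only: has_real_derivative_iff_has_vector_derivative)
  qed (use sm_sp in auto)
  then have "c * integral {sm..sp} (\<lambda>s. Q2 \<tau> \<omega> \<delta> s1 s2 s / sqrt (poly q s)) = L sp - L sm"
    by (metis integral_mult_right integral_unique)
  also have "L sp = 0" by (simp add: L_def v_at_ends)
  also have "L sm = H (v0 + per) - H v0" by (simp add: L_def v_at_ends v1_def)
  also have "\<dots> = Im (quat_C b)" by (simp add: H_def b)
  finally show ?thesis by (simp add: c_def)
qed

end

section \<open>The rotation angle\<close>

lemma sgn_has_vector_derivative:
  fixes z :: "real \<Rightarrow> complex"
  assumes z: "(z has_vector_derivative z') (at t)" and nz: "z t \<noteq> 0"
  shows "((\<lambda>t. sgn (z t)) has_vector_derivative
    \<i> * of_real (Im (z' * cnj (z t)) / (cmod (z t))\<^sup>2) * sgn (z t)) (at t)"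
proof -
  define N where "N t = cmod (z t)" for t
  have N: "N t = sqrt (Re (z t * cnj (z t)))" for t
    unfolding N_def complex_norm_square[symmetric] by simp
  have Npos: "N t > 0" using nz by (simp add: N_def)
  have zz: "z t * cnj (z t) = of_real ((N t)\<^sup>2)" by (simp add: N_def complex_norm_square del: of_real_power)
  have "Re (z t * cnj (z t)) > 0" using Npos unfolding zz by simp
  then have "((\<lambda>t. sqrt (Re (z t * cnj (z t)))) has_real_derivative
      inverse (sqrt (Re (z t * cnj (z t)))) / 2 * (Re (z' * cnj (z t)) + Re (z t * cnj z'))) (at t)"
    by (intro DERIV_chain2[OF DERIV_real_sqrt] Re_mult_cnj_has_real_derivative z)
  moreover have "inverse (sqrt (Re (z t * cnj (z t)))) / 2 * (Re (z' * cnj (z t)) + Re (z t * cnj z')) = Re (z' * cnj (z t)) / N t"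
  proof -
    have sym: "Re (z t * cnj z') = Re (z' * cnj (z t))" by (simp add: mult.commute)
    have half: "inverse n / 2 * (a + a) = a / n" for a n :: real by (simp add: field_simps)
    show ?thesis unfolding N[symmetric] sym by (rule half)
  qed
  ultimately have "((\<lambda>t. sqrt (Re (z t * cnj (z t)))) has_real_derivative Re (z' * cnj (z t)) / N t) (at t)"
    by (simp only:)
  then have dN: "(N has_real_derivative Re (z' * cnj (z t)) / N t) (at t)"
    by (rule has_field_derivative_transform_within_open[OF _ open_UNIV UNIV_I]) (rule N[symmetric])
  have "((\<lambda>t. of_real (1 / N t) * z t) has_vector_derivative
      of_real (1 / N t) * z' + of_real (- (Re (z' * cnj (z t)) / N t) / (N t)\<^sup>2) * z t) (at t)"
    using Npos by (intro has_vector_derivative_mult has_vector_derivative_of_real z)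
      (auto intro!: derivative_eq_intros dN simp: power2_eq_square)
  moreover have "(\<lambda>t. of_real (1 / N t) * z t) = (\<lambda>t. sgn (z t))"
    by (simp add: fun_eq_iff sgn_div_norm N_def scaleR_conv_of_real inverse_eq_divide)
  moreover have "of_real (1 / N t) * z' + of_real (- (Re (z' * cnj (z t)) / N t) / (N t)\<^sup>2) * z t
      = \<i> * of_real (Im (z' * cnj (z t)) / (cmod (z t))\<^sup>2) * sgn (z t)"
  proof -
    define d where "d = z' * cnj (z t)"
    have "d * z t = z' * (z t * cnj (z t))" by (simp add: d_def mult_ac)
    then have z': "z' = d * z t / of_real ((N t)\<^sup>2)" unfolding zz using Npos by simp
    have d: "d = of_real (Re d) + \<i> * of_real (Im d)" by (simp add: complex_eq_iff)
    have "of_real (1 / N t) * z' + of_real (- (Re d / N t) / (N t)\<^sup>2) * z t = (d - of_real (Re d)) * z t / of_real (N t ^ 3)"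
      unfolding z' using Npos by (simp add: field_simps power2_eq_square power3_eq_cube)
    also have "d - of_real (Re d) = \<i> * of_real (Im d)" by (simp add: complex_eq_iff)
    also have "\<i> * of_real (Im d) * z t / of_real (N t ^ 3) = \<i> * of_real (Im d / (cmod (z t))\<^sup>2) * sgn (z t)"
      using Npos by (simp add: sgn_div_norm N_def scaleR_conv_of_real field_simps power2_eq_square power3_eq_cube)
    finally show ?thesis by (simp only: d_def)
  qed
  ultimately show ?thesis by simp
qed

text \<open>
  A continuous logarithm of \<open>h\<close> on the closed interval is an antiderivative of \<open>k\<close> in the interior. The argument shows
  that \<open>k\<close> is integrable up to the ends, where no bound on \<open>k\<close> is assumed.
\<close>

lemma angle_integral:
  fixes h :: "real \<Rightarrow> complex" and k :: "real \<Rightarrow> real"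
  assumes ab: "a < b" and cont: "continuous_on {a..b} h"
    and unit: "\<And>s. s \<in> {a..b} \<Longrightarrow> cmod (h s) = 1"
    and der: "\<And>s. s \<in> {a<..<b} \<Longrightarrow> (h has_vector_derivative \<i> * of_real (k s) * h s) (at s)"
  shows "h b = cis (integral {a..b} k) * h a"
proof -
  obtain G where G: "continuous_on {a..b} G" "\<And>s. s \<in> {a..b} \<Longrightarrow> h s = exp (G s)"
    using continuous_logarithm_on_contractible[OF cont] unit
    by (metis convex_imp_contractible convex_real_interval(5) norm_zero zero_neq_one)
  define \<phi> where "\<phi> s = Im (G s)" for s
  have \<phi>c: "continuous_on {a..b} \<phi>" unfolding \<phi>_def by (intro continuous_intros G)
  have h: "h s = cis (\<phi> s)" if "s \<in> {a..b}" for s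
  proof -
    have "exp (Re (G s)) = 1" using unit[OF that] G(2)[OF that] by simp
    then have "Re (G s) = 0" by simp
    then have "G s = \<i> * of_real (\<phi> s)" by (simp add: complex_eq_iff \<phi>_def)
    then show ?thesis using G(2)[OF that] by (simp add: cis_conv_exp)
  qed
  have "(\<phi> has_vector_derivative k s) (at s)" if s: "s \<in> {a<..<b}" for s
  proof -
    define D where "D t = Im (h t * cnj (h s))" for t
    have hs: "cmod (h s) = 1" "h s * cnj (h s) = 1"
      using unit[of s] s by (simp_all add: h cis_cnj cis_mult)
    have "((\<lambda>t. Im (h t * cnj (h s))) has_real_derivative Im (\<i> * of_real (k s) * h s * cnj (h s)) + Im (h s * cnj 0)) (at s)"
      by (rule Im_mult_cnj_has_real_derivative[OF der[OF s] has_vector_derivative_const])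
    moreover have "\<i> * of_real (k s) * h s * cnj (h s) = \<i> * of_real (k s)" using hs(2) by (simp add: mult.assoc)
    ultimately have D: "(D has_real_derivative k s) (at s)" by (simp add: D_def[abs_def])
    have "D s = 0" unfolding D_def hs(2) by simp
    have as0: "((\<lambda>t. arcsin (D t)) has_real_derivative inverse (sqrt (1 - (D s)\<^sup>2)) * k s) (at s)"
      by (rule DERIV_chain2[OF DERIV_arcsin D]) (simp_all add: \<open>D s = 0\<close>)
    have as: "((\<lambda>t. \<phi> s + arcsin (D t)) has_real_derivative k s) (at s)"
      using DERIV_add[OF DERIV_const[of "\<phi> s"] as0] \<open>D s = 0\<close> by simp
    have "isCont \<phi> s"
      using \<phi>c s by (simp add: continuous_on_interior)
    then have "(\<phi> \<longlongrightarrow> \<phi> s) (nhds s)"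
      by (simp add: isCont_def tendsto_at_iff_tendsto_nhds)
    then have "\<forall>\<^sub>F t in nhds s. dist (\<phi> t) (\<phi> s) < pi / 2"
      by (rule tendstoD) simp
    \<comment> \<open>near \<open>s\<close> the angle is a differentiable function of \<open>h\<close>, and \<open>\<phi>\<close> inherits the derivative\<close>
    then have ev: "\<forall>\<^sub>F t in nhds s. \<phi> t = \<phi> s + arcsin (D t)"
    proof (rule eventually_elim2[OF _ eventually_nhds_in_open[of "{a<..<b}" s]])
      fix t assume t: "dist (\<phi> t) (\<phi> s) < pi / 2" "t \<in> {a<..<b}"
      have "h t * cnj (h s) = cis (\<phi> t - \<phi> s)"
        using t s by (simp add: h cis_cnj cis_mult)
      then have "D t = sin (\<phi> t - \<phi> s)" by (simp add: D_def)
      moreover have "arcsin (sin (\<phi> t - \<phi> s)) = \<phi> t - \<phi> s"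
        using t(1) by (intro arcsin_sin) (auto simp: dist_real_def abs_if split: if_splits)
      ultimately show "\<phi> t = \<phi> s + arcsin (D t)" by simp
    qed (use s in auto)
    have "(\<phi> has_real_derivative k s) (at s)"
      using DERIV_cong_ev[OF refl ev refl] as by blast
    then show ?thesis by (simp only: has_real_derivative_iff_has_vector_derivative)
  qed
  then have "(k has_integral \<phi> b - \<phi> a) {a..b}"
    using ab \<phi>c by (intro fundamental_theorem_of_calculus_interior) auto
  then have "integral {a..b} k = \<phi> b - \<phi> a" by (rule integral_unique)
  then show ?thesis using ab by (simp add: h cis_mult)
qed

lemma sgn_limit_at_zero:
  fixes z :: "real \<Rightarrow> complex"
  assumes z: "(z has_vector_derivative z') (at c)" "z c = 0" "z' \<noteq> 0"
    and g: "(g \<longlongrightarrow> c) F" and k: "\<forall>\<^sub>F s in F. sgn (g s - c) = k" "k \<noteq> 0"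
  shows "((\<lambda>s. sgn (z (g s))) \<longlongrightarrow> of_real k * sgn z') F"
proof -
  have "((\<lambda>v. Re (z v)) has_real_derivative Re z') (at c)" "((\<lambda>v. Im (z v)) has_real_derivative Im z') (at c)"
    using z(1) by (simp_all add: has_vector_derivative_complex_iff)
  then have "((\<lambda>v. Complex ((Re (z v) - Re (z c)) / (v - c)) ((Im (z v) - Im (z c)) / (v - c))) \<longlongrightarrow> Complex (Re z') (Im z')) (at c)"
    unfolding has_field_derivative_iff by (rule tendsto_Complex)
  moreover have "Complex ((Re (z v) - Re (z c)) / (v - c)) ((Im (z v) - Im (z c)) / (v - c)) = z v / of_real (v - c)" for v
    by (simp add: complex_eq_iff z(2))
  ultimately have lim: "((\<lambda>v. z v / of_real (v - c)) \<longlongrightarrow> z') (at c)" by simp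
  have ne: "\<forall>\<^sub>F s in F. g s \<noteq> c" using k(1) by eventually_elim (use k(2) in auto)
  have "((\<lambda>s. z (g s) / of_real (g s - c)) \<longlongrightarrow> z') F"
    by (rule filterlim_compose[OF lim filterlim_atI[OF g ne]])
  then have "((\<lambda>s. of_real k * sgn (z (g s) / of_real (g s - c))) \<longlongrightarrow> of_real k * sgn z') F"
    by (intro tendsto_mult tendsto_const tendsto_sgn z(3))
  moreover have "\<forall>\<^sub>F s in F. of_real k * sgn (z (g s) / of_real (g s - c)) = sgn (z (g s))"
    using k(1)
  proof eventually_elim
    case (elim s)
    then have nz: "g s - c \<noteq> 0" using k(2) by auto
    have "z (g s) = of_real (g s - c) * (z (g s) / of_real (g s - c))"
      using nz by (metis nonzero_mult_div_cancel_left of_real_eq_0_iff times_divide_eq_right)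
    then have "sgn (z (g s)) = sgn (complex_of_real (g s - c)) * sgn (z (g s) / of_real (g s - c))"
      by (metis Real_Vector_Spaces.sgn_mult)
    also have "sgn (complex_of_real (g s - c)) = of_real k"
      unfolding elim[symmetric] by (simp only: sgn_of_real)
    finally show ?case by simp
  qed
  ultimately show ?thesis by (rule Lim_transform_eventually)
qed

context rhombic_cylinder
begin

text \<open>
  The component of \<open>f\<close> on \<open>u = \<omega>\<close> orthogonal to the axis, up to the factor \<open>U\<close>.
\<close>

definition \<zeta> :: "real \<Rightarrow> complex" where
  "\<zeta> v = quat_J (rot (\<Psi> v) (qvec 0 (e v)))"

lemma rot_e_has_vector_derivative:
  "((\<lambda>v. rot (\<Psi> v) (qvec 0 (e v))) has_vector_derivative
     rot (\<Psi> v) (qvec (r v * U / \<sigma> v) (\<i> * of_real (U * deriv w v / \<sigma> v) * e v))) (at v)"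
proof -
  have "((\<lambda>v. rot (\<Psi> v) (qvec 0 (e v))) has_vector_derivative
      rot (\<Psi> v) (qvec 0 (\<i> * of_real (U * deriv w v / \<sigma> v) * e v) + (qvec 0 (e v) * A v - A v * qvec 0 (e v)))) (at v)"
    by (intro rot_\<Psi>_DERIV qvec_has_vector_derivative DERIV_const e_DERIV)
  moreover have "qvec 0 (\<i> * of_real (U * deriv w v / \<sigma> v) * e v) + (qvec 0 (e v) * A v - A v * qvec 0 (e v))
      = qvec (r v * U / \<sigma> v) (\<i> * of_real (U * deriv w v / \<sigma> v) * e v)"
    unfolding A_def qvec_commutator Re_W by (simp add: quat_eq_iff)
  ultimately show ?thesis by simp
qed

lemma \<zeta>_has_vector_derivative:
  "(\<zeta> has_vector_derivative quat_J (rot (\<Psi> v) (qvec (r v * U / \<sigma> v) (\<i> * of_real (U * deriv w v / \<sigma> v) * e v)))) (at v)"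
  unfolding \<zeta>_def[abs_def]
  by (rule bounded_linear.has_vector_derivative[OF bounded_linear_quat_J rot_e_has_vector_derivative])

lemma cmod_\<zeta>:
  assumes s: "s \<in> {sm<..<sp}"
  shows "(cmod (\<zeta> (v_at s)))\<^sup>2 = Q2_tilde \<tau> \<omega> s1 s2 Z0 s / (s\<^sup>2 * Z0\<^sup>2)"
    and "\<zeta> (v_at s) \<noteq> 0"
proof -
  define v where "v = v_at s"
  have sp: "s > 0" using sm_pos s by simp
  have "qdot (qvec 0 (e v)) (\<xi> s) = axis_b1 s"
  proof -
    have "e v * cnj (Complex (axis_b1 s) (axis_b2 s) * e v) = (e v * cnj (e v)) * cnj (Complex (axis_b1 s) (axis_b2 s))"
      by (simp add: mult_ac)
    also have "Re \<dots> = axis_b1 s" unfolding e_cnj by simp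
    finally have re: "Re (e v * cnj (Complex (axis_b1 s) (axis_b2 s) * e v)) = axis_b1 s" .
    show ?thesis unfolding \<xi>_def v_def[symmetric] qdot_qvec re by simp
  qed
  then have "Im (quat_C (rot (\<Psi> v) (qvec 0 (e v)))) = axis_b1 s / Z0"
    unfolding v_def axial_component[OF s] by simp
  then have "rot (\<Psi> v) (qvec 0 (e v)) = qvec (axis_b1 s / Z0) (\<zeta> v)"
    using rot_qvec_eq[OF \<Psi>_nz, of v 0 "e v"] by (simp add: \<zeta>_def)
  then have "(norm (rot (\<Psi> v) (qvec 0 (e v))))\<^sup>2 = (axis_b1 s / Z0)\<^sup>2 + (cmod (\<zeta> v))\<^sup>2"
    by (simp add: norm_qvec)
  then have c: "(cmod (\<zeta> v))\<^sup>2 = 1 - (axis_b1 s / Z0)\<^sup>2"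
    by (simp add: norm_rot[OF \<Psi>_nz] norm_qvec cmod_e)
  also have "\<dots> = (Z0\<^sup>2 - (axis_b1 s)\<^sup>2) / Z0\<^sup>2" using Z0_pos by (simp add: power_divide diff_divide_distrib)
  finally have c: "(cmod (\<zeta> v))\<^sup>2 = (Z0\<^sup>2 - (axis_b1 s)\<^sup>2) / Z0\<^sup>2" .
  have "axis_b1 s = (1 + s / U\<^sup>2 * (U' + s1 * s2 * U1')) / s"
    unfolding axis_b1_def using sp by (simp add: add_divide_distrib)
  then have "Z0\<^sup>2 - (axis_b1 s)\<^sup>2 = Q2_tilde \<tau> \<omega> s1 s2 Z0 s / s\<^sup>2"
    unfolding Q2_tilde_def using sp by (simp add: power_divide diff_divide_distrib)
  then show "(cmod (\<zeta> (v_at s)))\<^sup>2 = Q2_tilde \<tau> \<omega> s1 s2 Z0 s / (s\<^sup>2 * Z0\<^sup>2)"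
    using c by (simp add: v_def mult.commute)
  have "Z0\<^sup>2 - (axis_b1 s)\<^sup>2 = (axis_a s)\<^sup>2 + (axis_b2 s)\<^sup>2" using axis_norm[OF s] by simp
  moreover have "axis_a s \<noteq> 0"
    unfolding axis_a_def using q_pos[OF s] q3_pos[OF s] U_nz U1'_nz by simp
  ultimately have "Z0\<^sup>2 - (axis_b1 s)\<^sup>2 > 0" by (simp add: add_pos_nonneg)
  then have "(cmod (\<zeta> v))\<^sup>2 > 0" unfolding c using Z0_pos by simp
  then show "\<zeta> (v_at s) \<noteq> 0" by (auto simp: v_def)
qed

text \<open>
  The angular velocity about the axis is the axial part of \<open>y \<times> y'\<close> divided by the squared distance from the axis, and
  this squared distance is \<open>Q2_tilde\<close> up to a factor.
\<close>

lemma sgn_\<zeta>_has_vector_derivative: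
  assumes s: "s \<in> {sm<..<sp}"
  shows "((\<lambda>s. sgn (\<zeta> (v_at s))) has_vector_derivative
    \<i> * of_real (- (Z0 / Q2_tilde \<tau> \<omega> s1 s2 Z0 s * (Q2 \<tau> \<omega> \<delta> s1 s2 s / sqrt (poly q s)))) * sgn (\<zeta> (v_at s))) (at s)"
proof -
  define v where "v = v_at s"
  have \<sigma>: "\<sigma> v = s" using \<sigma>_at[of s] s by (simp add: v_def)
  have sp: "s > 0" using sm_pos s by simp
  define y where "y = rot (\<Psi> v) (qvec 0 (e v))"
  define y' where "y' = rot (\<Psi> v) (qvec (r v * U / s) (\<i> * of_real (U * deriv w v / s) * e v))"
  define l where "l = \<delta> / sqrt (poly q s)"
  have "((\<lambda>s. \<zeta> (v_at s)) has_vector_derivative l *\<^sub>R quat_J y') (at s)"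
    using vector_diff_chain_at[of v_at l s \<zeta>, OF _ \<zeta>_has_vector_derivative] v_at_DERIV[OF s]
    by (simp add: o_def has_real_derivative_iff_has_vector_derivative l_def y'_def v_def[symmetric] \<sigma>)
  from sgn_has_vector_derivative[OF this cmod_\<zeta>(2)[OF s]]
  have d: "((\<lambda>s. sgn (\<zeta> (v_at s))) has_vector_derivative
      \<i> * of_real (Im (l *\<^sub>R quat_J y' * cnj (\<zeta> v)) / (cmod (\<zeta> v))\<^sup>2) * sgn (\<zeta> (v_at s))) (at s)"
    by (simp only: v_def)
  have Re0: "Re (quat_C y) = 0" "Re (quat_C y') = 0"
    by (simp_all add: y_def y'_def Re_quat_C_rot[OF \<Psi>_nz])
  have "Im (quat_J y' * cnj (\<zeta> v)) = Im (quat_C (y * y'))"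
    using Re0 by (simp add: y_def[symmetric] \<zeta>_def algebra_simps)
  also have "y * y' = rot (\<Psi> v) (qvec (U * deriv w v / s) (- \<i> * of_real (r v * U / s) * e v))"
  proof -
    have "qvec 0 (e v) * qvec (r v * U / s) (\<i> * of_real (U * deriv w v / s) * e v)
        = qvec (U * deriv w v / s) (- \<i> * of_real (r v * U / s) * e v)"
    proof -
      have "quat_C (qvec 0 (e v) * qvec (r v * U / s) (\<i> * of_real (U * deriv w v / s) * e v))
          = \<i> * of_real (U * deriv w v / s) * (e v * cnj (e v))" by (simp add: mult_ac)
      then show ?thesis by (simp add: quat_eq_iff e_cnj)
    qed
    then show ?thesis unfolding y_def y'_def rot_mult[OF \<Psi>_nz, symmetric] by simp
  qed
  also have "Im (quat_C (rot (\<Psi> v) (qvec (U * deriv w v / s) (- \<i> * of_real (r v * U / s) * e v))))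
      = U / s * (deriv w v * axis_a s - r v * axis_b2 s) / Z0"
  proof -
    have "- \<i> * of_real (r v * U / s) * e v * cnj (Complex (axis_b1 s) (axis_b2 s) * e v)
        = (e v * cnj (e v)) * (- \<i> * of_real (r v * U / s) * cnj (Complex (axis_b1 s) (axis_b2 s)))" by (simp add: mult_ac)
    also have "Re \<dots> = - (r v * U / s) * axis_b2 s" unfolding e_cnj by simp
    finally have re: "Re (- \<i> * of_real (r v * U / s) * e v * cnj (Complex (axis_b1 s) (axis_b2 s) * e v))
      = - (r v * U / s) * axis_b2 s" .
    show ?thesis
      unfolding v_def axial_component[OF s] unfolding \<xi>_def v_def[symmetric] qdot_qvec re
      by (simp add: algebra_simps)
  qed
  also have "\<dots> = - Q2 \<tau> \<omega> \<delta> s1 s2 s / (\<delta> * s\<^sup>2 * Z0)"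
    unfolding v_def axial_velocity[OF s] using U_nz sp by (simp add: power2_eq_square)
  finally have im: "Im (quat_J y' * cnj (\<zeta> v)) = - Q2 \<tau> \<omega> \<delta> s1 s2 s / (\<delta> * s\<^sup>2 * Z0)" .
  have scale: "Im (l *\<^sub>R quat_J y' * cnj (\<zeta> v)) = l * Im (quat_J y' * cnj (\<zeta> v))"
    by (simp add: scaleR_conv_of_real algebra_simps)
  have "Im (l *\<^sub>R quat_J y' * cnj (\<zeta> v)) / (cmod (\<zeta> v))\<^sup>2
      = - (Z0 / Q2_tilde \<tau> \<omega> s1 s2 Z0 s * (Q2 \<tau> \<omega> \<delta> s1 s2 s / sqrt (poly q s)))"
    unfolding scale im unfolding v_def cmod_\<zeta>(1)[OF s] l_def using \<delta>_nz sp Z0_pos by (simp add: field_simps power2_eq_square)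
  then show ?thesis using d by simp
qed

lemma v_at_increasing:
  assumes "sm \<le> a" "a < b" "b \<le> sp"
  shows "\<delta> * v_at a < \<delta> * v_at b"
proof (rule DERIV_pos_imp_increasing_open[OF assms(2)])
  fix x assume "a < x" "x < b"
  then have x: "x \<in> {sm<..<sp}" using assms by simp
  have "((\<lambda>s. \<delta> * v_at s) has_real_derivative \<delta> * (\<delta> / sqrt (poly q x))) (at x)"
    by (rule DERIV_cmult[OF v_at_DERIV[OF x]])
  moreover have "\<delta> * (\<delta> / sqrt (poly q x)) = \<delta>\<^sup>2 / sqrt (poly q x)" by (simp add: power2_eq_square)
  moreover have "\<delta>\<^sup>2 / sqrt (poly q x) > 0" using \<delta>_nz q_pos[OF x] by simp
  ultimately show "\<exists>y. ((\<lambda>s. \<delta> * v_at s) has_real_derivative y) (at x) \<and> y > 0" by metis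
next
  show "continuous_on {a..b} (\<lambda>s. \<delta> * v_at s)"
    using continuous_on_subset[OF continuous_on_v_at] assms by (intro continuous_intros) auto
qed

text \<open>
  At the ends of the oval \<open>w' = 0\<close>, so the axis lies in the curvature plane. If \<open>f\<close> is not on the axis there, \<open>\<zeta>\<close> is
  orthogonal to the normal \<open>c\<close>. If it is, then \<open>\<zeta>\<close> vanishes to first order and its velocity is parallel to \<open>c\<close>. In both cases
  the limit direction is \<open>c\<close> up to a fourth root of unity.
\<close>

lemma end_direction:
  assumes E0: "E v = Quat 0 c" "cmod c = 1" and dw: "deriv w v = 0"
    and lim: "(v_at \<longlongrightarrow> v) F" and side: "\<forall>\<^sub>F s in F. sgn (v_at s - v) = k" "k \<noteq> 0" "\<bar>k\<bar> = 1"
  obtains d where "((\<lambda>s. sgn (\<zeta> (v_at s))) \<longlongrightarrow> d) F" "d ^ 4 = c ^ 4" "cmod d = 1"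
proof -
  have x4: "sgn x ^ 4 = 1" if "x \<noteq> 0" for x :: real
    using that by (simp add: sgn_if)
  have cc: "c * cnj c = 1" using E0(2) by (simp only: complex_norm_square[symmetric]) simp
  have rv: "(r v)\<^sup>2 = 1" using r_sq[of v] dw by simp
  have sc: "sgn c = c" using E0(2) by (simp add: sgn_div_norm)
  define x where "x = r v * U / \<sigma> v"
  have xnz: "x \<noteq> 0" using rv U_nz \<sigma>_pos[of v] by (auto simp: x_def)
  have "rot (\<Psi> v) (qvec x 0) = x *\<^sub>R E v"
  proof -
    have "qvec x 0 = x *\<^sub>R qvec 1 0" by (simp add: quat_eq_iff scaleR_conv_of_real[where 'a = complex])
    then show ?thesis by (simp only: rot_scaleR E_def)
  qed
  then have z': "(\<zeta> has_vector_derivative of_real x * c) (at v)"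
    using \<zeta>_has_vector_derivative[of v] unfolding dw E0 by (simp add: x_def scaleR_conv_of_real[where 'a = complex])
  show ?thesis
  proof (cases "\<zeta> v = 0")
    case True
    have "((\<lambda>s. sgn (\<zeta> (v_at s))) \<longlongrightarrow> of_real k * sgn (of_real x * c)) F"
      by (rule sgn_limit_at_zero[OF z' True _ lim side(1,2)]) (use xnz E0(2) in auto)
    moreover have "of_real k * sgn (of_real x * c) = of_real (k * sgn x) * c"
      by (simp add: Real_Vector_Spaces.sgn_mult sc sgn_of_real mult.assoc)
    moreover have "(of_real (k * sgn x) * c) ^ 4 = c ^ 4"
    proof -
      have "k = 1 \<or> k = - 1" using side(3) by linarith
      then have "k ^ 4 = 1" by auto
      then have "(k * sgn x) ^ 4 = 1" using x4[OF xnz] by (simp add: power_mult_distrib)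
      then have "complex_of_real (k * sgn x) ^ 4 = 1" by (metis of_real_1 of_real_power)
      then show ?thesis unfolding power_mult_distrib[of _ c] by simp
    qed
    moreover have "cmod (of_real (k * sgn x) * c) = 1"
      using side(3) xnz E0(2) by (simp add: norm_mult abs_mult abs_sgn_eq)
    ultimately show ?thesis using that[of "of_real (k * sgn x) * c"] by simp
  next
    case False
    have "qdot (rot (\<Psi> v) (qvec 0 (e v))) (E v) = 0"
      unfolding E_def qdot_rot[OF \<Psi>_nz] by (simp add: qdot_qvec)
    then have "Re (\<zeta> v * cnj c) = 0" by (simp add: qdot_def E0 \<zeta>_def)
    then have "\<zeta> v * cnj c = \<i> * of_real (Im (\<zeta> v * cnj c))" by (simp add: complex_eq_iff)
    then have "\<zeta> v * (c * cnj c) = \<i> * of_real (Im (\<zeta> v * cnj c)) * c" by (simp add: mult_ac)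
    then have "\<zeta> v = \<i> * of_real (Im (\<zeta> v * cnj c)) * c" by (simp only: cc mult_1_right)
    then obtain y where y: "\<zeta> v = \<i> * of_real y * c" by blast
    then have ynz: "y \<noteq> 0" using False by auto
    have sg: "sgn (\<zeta> v) = \<i> * of_real (sgn y) * c"
      unfolding y by (simp add: Real_Vector_Spaces.sgn_mult sc sgn_of_real) (simp add: sgn_div_norm)
    have "isCont \<zeta> v" using \<zeta>_has_vector_derivative has_vector_derivative_continuous by blast
    then have "((\<lambda>s. \<zeta> (v_at s)) \<longlongrightarrow> \<zeta> v) F" by (rule isCont_tendsto_compose[OF _ lim])
    then have "((\<lambda>s. sgn (\<zeta> (v_at s))) \<longlongrightarrow> sgn (\<zeta> v)) F" by (rule tendsto_sgn[OF _ False])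
    moreover have "sgn (\<zeta> v) ^ 4 = c ^ 4"
    proof -
      have "complex_of_real (sgn y) ^ 4 = 1" using x4[OF ynz] by (metis of_real_1 of_real_power)
      then show ?thesis unfolding sg by (simp add: power_mult_distrib)
    qed
    moreover have "cmod (sgn (\<zeta> v)) = 1" using False by (simp add: norm_sgn)
    ultimately show ?thesis using that by blast
  qed
qed

text \<open>
  The limit directions of \<open>\<zeta>\<close> at the two ends differ by the angle \<open>-\<theta>/2\<close>. Fourth powers remove the ambiguity of
  \<open>end_direction\<close>, so \<open>(c1/c0)\<^sup>4\<close> is known, and it equals \<open>\<kappa>\<^sup>2\<close>.
\<close>

lemma \<kappa>_sq:
  assumes \<theta>: "\<theta> / 2 = integral {sm..sp} (\<lambda>s. Z0 / Q2_tilde \<tau> \<omega> s1 s2 Z0 s * (Q2 \<tau> \<omega> \<delta> s1 s2 s / sqrt (poly q s)))"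
  shows "\<kappa>\<^sup>2 = cis (- 2 * \<theta>)"
proof -
  have l0: "(v_at \<longlongrightarrow> v0) (at_right sm)" "(v_at \<longlongrightarrow> v1) (at_left sp)"
    using continuous_on_Icc_at_rightD[OF continuous_on_v_at sm_sp] continuous_on_Icc_at_leftD[OF continuous_on_v_at sm_sp]
    by (simp_all add: v_at_ends)
  have sg: "sgn x = sgn \<delta>" if "\<delta> * x > 0" for x
    using that by (auto simp: zero_less_mult_iff)
  have k: "sgn \<delta> \<noteq> 0" "\<bar>sgn \<delta>\<bar> = 1" "- sgn \<delta> \<noteq> 0" "\<bar>- sgn \<delta>\<bar> = 1"
    using \<delta>_nz by (auto simp: sgn_if)
  have ev0: "\<forall>\<^sub>F s in at_right sm. sgn (v_at s - v0) = sgn \<delta>"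
    unfolding eventually_at_right_field
  proof (intro exI[of _ sp] conjI allI impI)
    fix s assume "sm < s" "s < sp"
    then have "\<delta> * (v_at s - v0) > 0" using v_at_increasing[of sm s] by (simp add: v_at_ends algebra_simps)
    then show "sgn (v_at s - v0) = sgn \<delta>" by (rule sg)
  qed (rule sm_sp)
  obtain d0 where d0: "((\<lambda>s. sgn (\<zeta> (v_at s))) \<longlongrightarrow> d0) (at_right sm)" "d0 ^ 4 = c0 ^ 4" "cmod d0 = 1"
    using end_direction[OF E_ends(1) cmod_c(1) deriv_w_ends(1) l0(1) ev0 k(1,2)] by blast
  have ev1: "\<forall>\<^sub>F s in at_left sp. sgn (v_at s - v1) = - sgn \<delta>"
    unfolding eventually_at_left_field
  proof (intro exI[of _ sm] conjI allI impI)
    fix s assume "sm < s" "s < sp"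
    then have "\<delta> * (v1 - v_at s) > 0" using v_at_increasing[of s sp] by (simp add: v_at_ends algebra_simps)
    then have "sgn (v1 - v_at s) = sgn \<delta>" by (rule sg)
    then show "sgn (v_at s - v1) = - sgn \<delta>" using sgn_minus[of "v1 - v_at s"] by simp
  qed (rule sm_sp)
  obtain d1 where d1: "((\<lambda>s. sgn (\<zeta> (v_at s))) \<longlongrightarrow> d1) (at_left sp)" "d1 ^ 4 = c1 ^ 4" "cmod d1 = 1"
    using end_direction[OF E_ends(2) cmod_c(2) deriv_w_ends(2) l0(2) ev1 k(3,4)] by blast
  define h where "h s = (if s = sm then d0 else if s = sp then d1 else sgn (\<zeta> (v_at s)))" for s
  define k where "k s = - (Z0 / Q2_tilde \<tau> \<omega> s1 s2 Z0 s * (Q2 \<tau> \<omega> \<delta> s1 s2 s / sqrt (poly q s)))" for s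
  have hin: "h s = sgn (\<zeta> (v_at s))" if "s \<in> {sm<..<sp}" for s using that by (auto simp: h_def)
  have der: "(h has_vector_derivative \<i> * of_real (k s) * h s) (at s)" if s: "s \<in> {sm<..<sp}" for s
  proof (rule has_vector_derivative_transform_within_open[OF _ open_greaterThanLessThan s])
    show "((\<lambda>s. sgn (\<zeta> (v_at s))) has_vector_derivative \<i> * of_real (k s) * h s) (at s)"
      unfolding k_def hin[OF s] by (rule sgn_\<zeta>_has_vector_derivative[OF s])
  qed (simp add: hin)
  have "continuous_on {sm..sp} h"
  proof (rule continuous_on_IccI)
    show "(h \<longlongrightarrow> h sm) (at_right sm)"
    proof (rule Lim_transform_eventually)
      show "((\<lambda>s. sgn (\<zeta> (v_at s))) \<longlongrightarrow> h sm) (at_right sm)" using d0(1) by (simp add: h_def)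
      show "\<forall>\<^sub>F s in at_right sm. sgn (\<zeta> (v_at s)) = h s"
        using sm_sp by (auto simp: eventually_at_right_field h_def intro!: exI[of _ sp])
    qed
    show "(h \<longlongrightarrow> h sp) (at_left sp)"
    proof (rule Lim_transform_eventually)
      show "((\<lambda>s. sgn (\<zeta> (v_at s))) \<longlongrightarrow> h sp) (at_left sp)" using d1(1) sm_sp by (simp add: h_def)
      show "\<forall>\<^sub>F s in at_left sp. sgn (\<zeta> (v_at s)) = h s"
        using sm_sp by (auto simp: eventually_at_left_field h_def intro!: exI[of _ sm])
    qed
    show "h \<midarrow>s\<rightarrow> h s" if "sm < s" "s < sp" for s
      using has_vector_derivative_continuous[OF der[of s]] that by (simp add: isCont_def)
  qed (rule sm_sp)
  moreover have "cmod (h s) = 1" if "s \<in> {sm..sp}" for s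
    using that d0(3) d1(3) cmod_\<zeta>(2)[of s] by (auto simp: h_def norm_sgn)
  ultimately have "h sp = cis (integral {sm..sp} k) * h sm"
    using angle_integral[OF sm_sp] der by blast
  moreover have "integral {sm..sp} k = - (\<theta> / 2)"
    unfolding k_def integral_neg \<theta> ..
  ultimately have "d1 = cis (- (\<theta> / 2)) * d0" using sm_sp by (simp add: h_def)
  then have "d1 ^ 4 = cis (- (\<theta> / 2)) ^ 4 * d0 ^ 4" by (simp add: power_mult_distrib)
  also have "cis (- (\<theta> / 2)) ^ 4 = cis (- 2 * \<theta>)"
  proof -
    have "real 4 * - (\<theta> / 2) = - 2 * \<theta>" by simp
    then show ?thesis using Complex.DeMoivre[of "- (\<theta> / 2)" 4] by (simp only:)
  qed
  finally have c: "c1 ^ 4 = cis (- 2 * \<theta>) * c0 ^ 4" using d0 d1 by simp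
  have "\<kappa>\<^sup>2 = (cnj \<mu>) ^ 4" unfolding \<kappa>_def power_mult[symmetric] by simp
  also have "cnj \<mu> = c1 * cnj c0" by (simp add: \<mu>_def)
  also have "(c1 * cnj c0) ^ 4 = c1 ^ 4 * (cnj c0) ^ 4" by (rule power_mult_distrib)
  also have "\<dots> = cis (- 2 * \<theta>) * (c0 * cnj c0) ^ 4" unfolding c by (simp add: power_mult_distrib)
  finally show ?thesis by (simp add: c_cnj)
qed

section \<open>Periods of Bonnet mates\<close>

lemma per_nz: "per \<noteq> 0"
  using v_at_increasing[of sm sp] sm_sp by (auto simp: v_at_ends v1_def)

lemma \<sigma>_per: "\<sigma> (v + per) = \<sigma> v" by (simp add: \<sigma>_def w_per)

lemma \<sigma>_nat_per: "\<sigma> (v + real n * per) = \<sigma> v" "\<sigma> (v - real n * per) = \<sigma> v"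
proof -
  show *: "\<sigma> (v + real n * per) = \<sigma> v" for v
    by (induction n) (use \<sigma>_per[of "v + real _ * per"] in \<open>simp_all add: algebra_simps\<close>)
  show "\<sigma> (v - real n * per) = \<sigma> v" using *[of "v - real n * per"] by simp
qed

lemma \<sigma>_reflect: "\<sigma> (v0 - t) = \<sigma> (v0 + t)" by (simp add: \<sigma>_def w_reflect0)

lemma \<sigma>_minimum_half_period:
  assumes t: "0 \<le> t" "t \<le> \<bar>per\<bar> / 2" and \<sigma>: "\<sigma> (v0 + t) = sm"
  shows "t = 0"
proof -
  define x where "x = (if per > 0 then t else - t)"
  have "\<sigma> (v0 + x) = sm" using \<sigma> \<sigma>_reflect by (auto simp: x_def)
  have c: "continuous_on {sm..sp} v_at" by (rule continuous_on_v_at)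
  have "\<exists>s\<ge>sm. s \<le> sp \<and> v_at s = v0 + x"
  proof (cases "per > 0")
    case True
    then show ?thesis using t sm_sp by (intro IVT'[OF _ _ _ c]) (auto simp: v_at_ends v1_def x_def)
  next
    case False
    then show ?thesis using t sm_sp by (intro IVT2'[OF _ _ _ c]) (auto simp: v_at_ends v1_def x_def)
  qed
  then obtain s where s: "s \<in> {sm..sp}" "v_at s = v0 + x" by auto
  then have "s = sm" using \<open>\<sigma> (v0 + x) = sm\<close> \<sigma>_at[of s] by simp
  then have "x = 0" using s by (simp add: v_at_ends)
  then show ?thesis by (auto simp: x_def split: if_splits)
qed

text \<open>
  On \<open>[v0, v0 + \<bar>per\<bar>)\<close> the minimum \<open>sm\<close> is attained at \<open>v0\<close> only; the part beyond half a period is reflected to the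
  first half.
\<close>

lemma \<sigma>_period_is_multiple:
  assumes T: "T > 0" "\<And>v. \<sigma> (v + T) = \<sigma> v"
  obtains n :: nat where "n > 0" "T = real n * \<bar>per\<bar>"
proof -
  define p where "p = \<bar>per\<bar>"
  have p: "p > 0" using per_nz by (simp add: p_def)
  define n where "n = nat \<lfloor>T / p\<rfloor>"
  define t where "t = T - real n * p"
  have "real n \<le> T / p" "T / p < real n + 1" using T(1) p by (auto simp: n_def)
  then have t: "0 \<le> t" "t < p" using p by (auto simp: t_def field_simps)
  have \<sigma>p: "\<sigma> (v - real k * p) = \<sigma> v" for v k
    using \<sigma>_nat_per by (auto simp: p_def abs_if)
  have "\<sigma> (v0 + t) = \<sigma> (v0 + T - real n * p)" by (simp add: t_def algebra_simps)
  also have "\<dots> = \<sigma> v0" unfolding \<sigma>p T(2) ..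
  also have "\<dots> = sm" using \<sigma>_at[of sm] sm_sp by (simp add: v_at_ends)
  finally have \<sigma>: "\<sigma> (v0 + t) = sm" .
  have "t = 0"
  proof (cases "t \<le> p / 2")
    case True
    then show ?thesis using \<sigma>_minimum_half_period t \<sigma> by (simp add: p_def)
  next
    case False
    have "\<sigma> (v0 + (p - t)) = \<sigma> (v0 + t - real 1 * p)" using \<sigma>_reflect[of "p - t"] by (simp add: algebra_simps)
    then have "\<sigma> (v0 + (p - t)) = sm" unfolding \<sigma>p \<sigma> .
    then have "p - t = 0" using \<sigma>_minimum_half_period[of "p - t"] t False by (simp add: p_def)
    then show ?thesis using t by simp
  qed
  then have "T = real n * p" by (simp add: t_def)
  moreover have "n > 0" using calculation T(1) by (cases n) auto
  ultimately show ?thesis using that by (simp add: p_def)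
qed

lemma bonnet_nat_per:
  assumes b: "\<And>u v. G u (v + per) = twist (G u v) + b"
  shows "quat_C (G u (v + real n * per)) = quat_C (G u v) + of_nat n * quat_C b"
    and "quat_J (G u (v + real n * per)) = \<kappa> ^ n * quat_J (G u v) + (\<Sum>j<n. \<kappa> ^ j) * quat_J b"
proof (induction n)
  case (Suc n)
  have s: "v + real (Suc n) * per = (v + real n * per) + per" by (simp add: algebra_simps)
  {
    case 1
    show ?case unfolding s b using Suc by (simp add: algebra_simps)
  next
    case 2
    have "(\<Sum>j<Suc n. \<kappa> ^ j) = 1 + \<kappa> * (\<Sum>j<n. \<kappa> ^ j)"
      by (simp add: sum.lessThan_Suc_shift sum_distrib_left del: sum.lessThan_Suc)
    then show ?case unfolding s b using Suc by (simp add: algebra_simps)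
  }
qed auto

text \<open>
  The length of \<open>\<partial>\<^sub>u F\<close> on \<open>u = \<omega>\<close> is \<open>(\<epsilon>\<^sup>2 + 1/U\<^sup>2) s\<close>, so \<open>T\<close> is a multiple of the period. The axial part of the screw
  motion adds up over periods and must vanish. If the rotational part had not become trivial, \<open>F\<close> would be confined to a
  parallel of the axis, contrary to the velocity along \<open>u\<close> having the nonzero component \<open>\<zeta>\<close>.
\<close>

lemma torus_period_imp:
  assumes F: "bonnet_mate \<epsilon> (\<lambda>u v. metric_h \<tau> \<omega> u (w v)) f F" and \<epsilon>: "\<epsilon> \<noteq> 0"
    and T: "T > 0" "\<And>u v. F u (v + T) = F u v"
  obtains n where "n > 0" "\<kappa> ^ n = 1"
    "integral {sm..sp} (\<lambda>s. Q2 \<tau> \<omega> \<delta> s1 s2 s / sqrt (poly q s)) = 0"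
proof -
  define G where "G u v = rot g (F u v)" for u v
  have P: "((\<lambda>u. G u v) has_vector_derivative rot (\<Psi> v) (mate_u \<epsilon> u v)) (at u)" for u v
    unfolding G_def by (rule bonnet_partials(1)[OF F])
  have GT: "G u (v + T) = G u v" for u v by (simp add: G_def T)
  define K where "K = \<epsilon>\<^sup>2 + 1 / U\<^sup>2"
  have K: "K > 0" using \<epsilon> by (simp add: K_def add_pos_nonneg)
  have n: "norm (rot (\<Psi> v) (mate_u \<epsilon> \<omega> v)) = K * \<sigma> v" for v
  proof -
    have "(norm (qvec 0 (e v)))\<^sup>2 = 1\<^sup>2" unfolding norm_qvec cmod_e by simp
    then have "norm (qvec 0 (e v)) = 1" by (rule power2_eq_imp_eq) auto
    then show ?thesis using K \<sigma>_pos[of v] unfolding norm_rot[OF \<Psi>_nz] mate_u_\<omega> K_def[symmetric] by simp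
  qed
  have "\<sigma> (v + T) = \<sigma> v" for v
  proof -
    have "rot (\<Psi> (v + T)) (mate_u \<epsilon> \<omega> (v + T)) = rot (\<Psi> v) (mate_u \<epsilon> \<omega> v)"
      using P[of "v + T" \<omega>] P[of v \<omega>] unfolding GT by (rule vector_derivative_unique_at)
    then have "K * \<sigma> (v + T) = K * \<sigma> v" using n by metis
    then show ?thesis using K by simp
  qed
  then obtain n where n: "n > 0" "T = real n * \<bar>per\<bar>"
    using \<sigma>_period_is_multiple[OF T(1)] by blast
  have Gn: "G u (v + real n * per) = G u v" for u v
    using GT[of u v] GT[of u "v + real n * per"] n(2) by (auto simp: abs_if split: if_splits)
  obtain b where b: "\<And>u v. G u (v + per) = twist (G u v) + b"
    using bonnet_twist[OF F] unfolding G_def by blast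
  note B = bonnet_nat_per[of G b, OF b]
  have "of_nat n * quat_C b = 0" using B(1)[of 0 0 n] unfolding Gn by simp
  then have "quat_C b = 0" using n(1) by simp
  then have "(4 * \<epsilon> / (U\<^sup>2 * Z0)) * integral {sm..sp} (\<lambda>s. Q2 \<tau> \<omega> \<delta> s1 s2 s / sqrt (poly q s)) = 0"
    using axial_translation[OF F, of b] b by (simp add: G_def)
  then have int: "integral {sm..sp} (\<lambda>s. Q2 \<tau> \<omega> \<delta> s1 s2 s / sqrt (poly q s)) = 0"
    using \<epsilon> U_nz Z0_pos by simp
  have "\<kappa> ^ n = 1"
  proof (rule ccontr)
    assume ne: "\<kappa> ^ n \<noteq> 1"
    define vm where "vm = v_at ((sm + sp) / 2)"
    define k where "k = (\<Sum>j<n. \<kappa> ^ j) * quat_J b / (1 - \<kappa> ^ n)"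
    have "quat_J (G u vm) = k" for u
      using B(2)[of u vm n] ne by (simp add: Gn k_def field_simps)
    then have "((\<lambda>u. quat_J (G u vm)) has_vector_derivative 0) (at \<omega>)" by simp
    moreover have "((\<lambda>u. quat_J (G u vm)) has_vector_derivative quat_J (rot (\<Psi> vm) (mate_u \<epsilon> \<omega> vm))) (at \<omega>)"
      by (rule bounded_linear.has_vector_derivative[OF bounded_linear_quat_J P])
    ultimately have "quat_J (rot (\<Psi> vm) (mate_u \<epsilon> \<omega> vm)) = 0"
      using vector_derivative_unique_at by blast
    then have "(K * \<sigma> vm) *\<^sub>R \<zeta> vm = 0"
      unfolding mate_u_\<omega> rot_scaleR K_def \<zeta>_def by simp
    then show False using K \<sigma>_pos[of vm] cmod_\<zeta>(2)[OF mid] by (simp add: vm_def)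
  qed
  then show ?thesis using that n(1) int by blast
qed

text \<open>
  A geometric sum over the powers of \<open>\<kappa> \<noteq> 1\<close> vanishes, so the translation orthogonal to the axis cancels over
  \<open>n\<close> periods.
\<close>

lemma torus_period_if:
  assumes F: "bonnet_mate \<epsilon> (\<lambda>u v. metric_h \<tau> \<omega> u (w v)) f F"
    and \<kappa>n: "\<kappa> ^ n = 1"
    and int: "integral {sm..sp} (\<lambda>s. Q2 \<tau> \<omega> \<delta> s1 s2 s / sqrt (poly q s)) = 0"
  shows "F u (v + real n * \<bar>per\<bar>) = F u v"
proof -
  define G where "G u v = rot g (F u v)" for u v
  obtain b where b: "\<And>u v. G u (v + per) = twist (G u v) + b"
    using bonnet_twist[OF F] unfolding G_def by blast
  note B = bonnet_nat_per[of G b, OF b]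
  have "Im (quat_C b) = 0"
    using axial_translation[OF F, of b] b int by (simp add: G_def)
  moreover have "quat_C (G 0 per) = quat_C (G 0 0) + quat_C b" using b[of 0 0] by simp
  then have "Re (quat_C b) = 0" using quat_C_bonnet[OF F, of 0 per] quat_C_bonnet[OF F, of 0 0] by (simp add: G_def)
  ultimately have "quat_C b = 0" by (simp add: complex_eq_iff)
  moreover have "(\<Sum>j<n. \<kappa> ^ j) = 0"
    using \<kappa>n \<kappa>_neq_1 by (simp add: geometric_sum)
  ultimately have Gn: "G u (v + real n * per) = G u v" for u v
    using B[of u v n] \<kappa>n by (simp add: quat_eq_iff)
  have "G u (v + real n * \<bar>per\<bar>) = G u v"
    using Gn[of u v] Gn[of u "v - real n * per"] by (auto simp: abs_if)
  then show ?thesis unfolding G_def using rot_inverse(1)[OF g_nz] by metis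
qed

lemma \<kappa>_root_of_unity_iff:
  assumes \<theta>: "\<theta> / 2 = integral {sm..sp} (\<lambda>s. Z0 / Q2_tilde \<tau> \<omega> s1 s2 Z0 s * (Q2 \<tau> \<omega> \<delta> s1 s2 s / sqrt (poly q s)))"
  shows "(\<exists>n>0. \<kappa> ^ n = 1) \<longleftrightarrow> (\<exists>k::nat. k > 0 \<and> (\<exists>m::int. real k * \<theta> = 2 * pi * of_int m))"
proof -
  have pow: "\<kappa> ^ (2 * n) = cis (- (2 * real n * \<theta>))" for n
    unfolding power_mult \<kappa>_sq[OF \<theta>] Complex.DeMoivre by (simp add: mult_ac)
  have cis1: "cis x = 1 \<longleftrightarrow> (\<exists>m::int. x = 2 * pi * of_int m)" for x
  proof
    assume "cis x = 1"
    then have "cos x = 1" by (simp add: complex_eq_iff)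
    then show "\<exists>m::int. x = 2 * pi * of_int m" by (auto simp: cos_one_2pi_int mult_ac)
  qed auto
  show ?thesis
  proof
    assume "\<exists>n>0. \<kappa> ^ n = 1"
    then obtain n where n: "n > 0" "\<kappa> ^ n = 1" by blast
    then have "cis (- (2 * real n * \<theta>)) = 1" unfolding pow[symmetric] by (simp add: mult.commute[of 2] power_mult)
    then obtain m :: int where m: "- (2 * real n * \<theta>) = 2 * pi * of_int m" unfolding cis1 by blast
    have "real (2 * n) * \<theta> = 2 * pi * of_int (- m)" using m by simp
    then show "\<exists>k::nat. k > 0 \<and> (\<exists>m::int. real k * \<theta> = 2 * pi * of_int m)" using n(1) by (metis nat_0_less_mult_iff zero_less_numeral)
  next
    assume "\<exists>k::nat. k > 0 \<and> (\<exists>m::int. real k * \<theta> = 2 * pi * of_int m)"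
    then obtain k :: nat and m :: int where k: "k > 0" "real k * \<theta> = 2 * pi * of_int m" by blast
    have "- (2 * real k * \<theta>) = 2 * pi * of_int (- 2 * m)" using k(2) by (simp add: mult_ac)
    then have "\<kappa> ^ (2 * k) = 1" unfolding pow cis1 by blast
    then show "\<exists>n>0. \<kappa> ^ n = 1" using k(1) by (metis nat_0_less_mult_iff zero_less_numeral)
  qed
qed

end

theorem theorem7:
  fixes \<tau> \<tau>0 :: complex
    and \<omega> \<delta> s1 s2 sm sp \<epsilon> Z0 \<theta> :: real
    and w r :: "real \<Rightarrow> real"
    and \<Phi> :: "real \<Rightarrow> quat"
    and f fp fm :: "real \<Rightarrow> real \<Rightarrow> quat"
  assumes tau0: "Re \<tau>0 = 1/2" "0 < Im \<tau>0" "(deriv ^^ 2) (theta2 \<tau>0) 0 = 0"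
    and tau: "Re \<tau> = 1/2" "0 < Im \<tau>" "Im \<tau> < Im \<tau>0"
    and omega: "0 < \<omega>" "\<omega> < pi / 4" "deriv (theta2 \<tau>) \<omega> = 0"
    and cylinder: "isothermic_planar_cylinder \<tau> \<omega> w r \<Phi> f"
    and rhombic: "rhombic_fundamental_piece \<tau> \<omega> \<delta> s1 s2 sm sp w r f"
    and epsilon: "\<epsilon> \<noteq> 0"
    and bonnet_plus: "bonnet_mate \<epsilon> (\<lambda>u v. metric_h \<tau> \<omega> u (w v)) f fp"
    and bonnet_minus: "bonnet_mate (- \<epsilon>) (\<lambda>u v. metric_h \<tau> \<omega> u (w v)) f fm"
    and Z0: "0 < Z0"
      "Z0\<^sup>2 = (2 * (s1 + s2) * const_U1' \<tau> \<omega> + \<delta>\<^sup>2 * (const_U1' \<tau> \<omega>)\<^sup>2 - const_U2 \<tau> \<omega>)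
                / (const_U \<tau> \<omega>)\<^sup>2
              + (const_U' \<tau> \<omega> + s1 * s2 * const_U1' \<tau> \<omega>)\<^sup>2 / (const_U \<tau> \<omega>) ^ 4"
    and theta: "\<theta> / 2 = integral {sm..sp} (\<lambda>s. Z0 / Q2_tilde \<tau> \<omega> s1 s2 Z0 s *
                  (Q2 \<tau> \<omega> \<delta> s1 s2 s / sqrt (poly (Q \<tau> \<omega> \<delta> s1 s2) s)))"
  shows "pair_of_tori fp fm \<longleftrightarrow>
    (\<exists>k::nat. k > 0 \<and> (\<exists>m::int. real k * \<theta> = 2 * pi * of_int m)) \<and>
    integral {sm..sp} (\<lambda>s. Q2 \<tau> \<omega> \<delta> s1 s2 s / sqrt (poly (Q \<tau> \<omega> \<delta> s1 s2) s)) = 0"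
proof -
  obtain v0 where v0: "\<forall>s\<in>{sm..sp}. s_of_w \<tau> \<omega> (w (v0 + v_of_s \<tau> \<omega> \<delta> s1 s2 sm s)) = s"
    "\<forall>s\<in>{sm<..<sp}. ((\<lambda>s. w (v0 + v_of_s \<tau> \<omega> \<delta> s1 s2 sm s))
            has_real_derivative 1 / sqrt (poly (Q3 \<tau> \<omega>) s)) (at s)"
    "\<forall>v. w (v0 - v) = w (v0 + v)" "\<forall>v. w (v + w_period \<tau> \<omega> \<delta> s1 s2 sm sp) = w v"
    using rhombic unfolding rhombic_fundamental_piece_def rhombic_w_def by blast
  interpret rhombic_cylinder \<tau> \<omega> \<delta> s1 s2 sm sp Z0 v0 w r \<Phi> f
    by unfold_locales
      (use tau omega cylinder Z0 v0 rhombic[unfolded rhombic_fundamental_piece_def] in blast)+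
  have closed: "\<forall>u v. fp (u + 2 * pi) v = fp u v \<and> fm (u + 2 * pi) v = fm u v"
    using bonnet_2pi_periodic[OF bonnet_plus] bonnet_2pi_periodic[OF bonnet_minus] by blast
  show ?thesis
  proof
    assume "pair_of_tori fp fm"
    then obtain T where "T > 0" "\<And>u v. fp u (v + T) = fp u v"
      unfolding pair_of_tori_def by blast
    then obtain n where "n > 0" "\<kappa> ^ n = 1"
      "integral {sm..sp} (\<lambda>s. Q2 \<tau> \<omega> \<delta> s1 s2 s / sqrt (poly (Q \<tau> \<omega> \<delta> s1 s2) s)) = 0"
      using torus_period_imp[OF bonnet_plus epsilon] by blast
    then show "(\<exists>k::nat. k > 0 \<and> (\<exists>m::int. real k * \<theta> = 2 * pi * of_int m)) \<and>
      integral {sm..sp} (\<lambda>s. Q2 \<tau> \<omega> \<delta> s1 s2 s / sqrt (poly (Q \<tau> \<omega> \<delta> s1 s2) s)) = 0"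
      using \<kappa>_root_of_unity_iff[OF theta] by blast
  next
    assume R: "(\<exists>k::nat. k > 0 \<and> (\<exists>m::int. real k * \<theta> = 2 * pi * of_int m)) \<and>
      integral {sm..sp} (\<lambda>s. Q2 \<tau> \<omega> \<delta> s1 s2 s / sqrt (poly (Q \<tau> \<omega> \<delta> s1 s2) s)) = 0"
    then obtain n where n: "n > 0" "\<kappa> ^ n = 1" using \<kappa>_root_of_unity_iff[OF theta] by blast
    have "real n * \<bar>per\<bar> > 0" using n per_nz by simp
    moreover have "fp u (v + real n * \<bar>per\<bar>) = fp u v" "fm u (v + real n * \<bar>per\<bar>) = fm u v" for u v
      using torus_period_if[OF bonnet_plus n(2)] torus_period_if[OF bonnet_minus n(2)] R by auto
    ultimately show "pair_of_tori fp fm"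
      unfolding pair_of_tori_def using closed by blast
  qed
qed

end
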